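(* Let $\mathcal{C}$ be the class of labeled posets defined below. For labeled posets $(P,\omega)$ and $(Q,\omega')$ in $\mathcal{C}$, the following are equivalent: (a) $(P,\omega)$ and $(Q,\omega')$ are isomorphic (as labeled posets); (b) $K_{(P,\omega)}=K_{(Q,\omega')}$. In particular, $K_{(P,\omega)}$ distinguishes fair trees: two fair trees have equal $(P,\omega)$-partition enumerators if and only if they are isomorphic.
   Context: A labeled poset $(P,\omega)$ is a finite poset $P$ with $|P|=n$ together with a bijection $\omega:P\to[n]$. A cover relation $a\prec_P b$ is a strict edge if $\omega(a)>\omega(b)$ and a weak edge if $\omega(a)<\omega(b)$. Two labeled posets are isomorphic if there is a poset isomorphism between the underlying posets carrying strict edges to strict edges and weak edges to weak edges. A $(P,\omega)$-partition is a map $f:P\to\{1,2,\dots\}$ such that $a<_P b$ implies $f(a)\le f(b)$, and $a<_P b$ with $\omega(a)>\omega(b)$ implies $f(a)<f(b)$. The $(P,\omega)$-partition enumerator is $K_{(P,\omega)}(\mathbf{x})=\sum_f x_1^{\#f^{-1}(1)}x_2^{\#f^{-1}(2)}\cdots$, summed over all $(P,\omega)$-partitions $f$. For labeled posets $(P,\omega)$, $(Q,\omega')$ (viewed as posets with assignments of strict/weak edges), the weak (resp. strict) ordinal sum $(P,\omega)\uparrow(Q,\omega')$ (resp. $(P,\omega)\Uparrow(Q,\omega')$) is obtained by placing $P$ below $Q$ and adding a weak (resp. strict) edge from each maximal element of $P$ to each minimal element of $Q$; all other edges keep their type. $[1]$ denotes the one-element labeled poset. The class $\mathcal{C}$ is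 defined recursively: $[1]\in\mathcal{C}$; if $(P,\omega),(Q,\omega')\in\mathcal{C}$ then their disjoint union is in $\mathcal{C}$; if $(P,\omega)\in\mathcal{C}$ then $[1]\uparrow(P,\omega)$, $[1]\Uparrow(P,\omega)$, $(P,\omega)\uparrow[1]$ and $(P,\omega)\Uparrow[1]$ are in $\mathcal{C}$. A fair tree is a labeled poset whose underlying poset is a rooted tree (its Hasse diagram is a tree and it has a unique minimal element) and such that for each vertex, the edges from it to its children (the elements covering it) are either all strict or all weak. Every fair tree belongs to $\mathcal{C}$. *)

theory Defs
  imports "HOL-Library.FuncSet" "HOL-Library.Poly_Mapping"
begin

text \<open>
  A pair \<open>(a, b)\<close> in \<open>leq P\<close> means that \<open>a\<close> is below or equal to \<open>b\<close>.
\<close>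

record 'a pos =
  elts :: "'a set"
  leq :: "'a rel"

definition less_rel :: "('a, 'm) pos_scheme \<Rightarrow> 'a rel" where
  "less_rel P = {(a, b). (a, b) \<in> leq P \<and> a \<noteq> b}"

definition covers :: "('a, 'm) pos_scheme \<Rightarrow> 'a rel" where
  "covers P = {(a, b). (a, b) \<in> less_rel P \<and>
     \<not> (\<exists>c. (a, c) \<in> less_rel P \<and> (c, b) \<in> less_rel P)}"

definition min_elts :: "('a, 'm) pos_scheme \<Rightarrow> 'a set" where
  "min_elts P = {a \<in> elts P. \<not> (\<exists>b. (b, a) \<in> less_rel P)}"

definition max_elts :: "('a, 'm) pos_scheme \<Rightarrow> 'a set" where
  "max_elts P = {a \<in> elts P. \<not> (\<exists>b. (a, b) \<in> less_rel P)}"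

record 'a lpos = "'a pos" +
  lab :: "'a \<Rightarrow> nat"

definition labeled_poset :: "'a lpos \<Rightarrow> bool" where
  "labeled_poset P \<longleftrightarrow>
     finite (elts P) \<and> partial_order_on (elts P) (leq P) \<and>
     bij_betw (lab P) (elts P) {1..card (elts P)}"

definition strict_edges :: "'a lpos \<Rightarrow> 'a rel" where
  "strict_edges P = {(a, b) \<in> covers P. lab P a > lab P b}"

definition weak_edges :: "'a lpos \<Rightarrow> 'a rel" where
  "weak_edges P = {(a, b) \<in> covers P. lab P a < lab P b}"

definition labeled_poset_iso :: "'a lpos \<Rightarrow> 'b lpos \<Rightarrow> bool" where
  "labeled_poset_iso P Q \<longleftrightarrow> (\<exists>\<phi>.
     bij_betw \<phi> (elts P) (elts Q) \<and>
     (\<forall>a\<in>elts P. \<forall>b\<in>elts P. (a, b) \<in> leq P \<longleftrightarrow> (\<phi> a, \<phi> b) \<in> leq Q) \<and>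
     (\<forall>(a, b)\<in>strict_edges P. (\<phi> a, \<phi> b) \<in> strict_edges Q) \<and>
     (\<forall>(a, b)\<in>weak_edges P. (\<phi> a, \<phi> b) \<in> weak_edges Q))"

text \<open>
  Partitions are extensional outside of \<open>elts P\<close>, so that each map on \<open>elts P\<close> is counted once.
\<close>

definition P_partitions :: "'a lpos \<Rightarrow> ('a \<Rightarrow> nat) set" where
  "P_partitions P = {f \<in> elts P \<rightarrow>\<^sub>E {1..}.
     (\<forall>(a, b)\<in>less_rel P. f a \<le> f b) \<and>
     (\<forall>(a, b)\<in>less_rel P. lab P a > lab P b \<longrightarrow> f a < f b)}"

text \<open>
  A formal power series in the variables \<open>x\<^sub>1, x\<^sub>2, \<dots>\<close> is the function taking each monomial to its
  integer coefficient. Monomials are finitely supported exponent vectors; the index 0 belongs to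
  no variable and, as partitions take positive values, never occurs with a nonzero coefficient.
  Each partition \<open>f\<close> contributes the monomial in which \<open>x\<^sub>i\<close> has exponent the size of the fibre
  of \<open>f\<close> over \<open>i\<close>; for a finite poset only finitely many \<open>f\<close> contribute to a given monomial.
\<close>

type_synonym power_series = "(nat \<Rightarrow>\<^sub>0 nat) \<Rightarrow> int"

definition K_enum :: "'a lpos \<Rightarrow> power_series" where
  "K_enum P = (\<lambda>m. int (card {f \<in> P_partitions P.
     \<forall>i. Poly_Mapping.lookup m i = card {a \<in> elts P. f a = i}}))"

text \<open>
  For the ordinal sums, a labeled poset is viewed as a poset together with the set \<open>strict\<close> of its
  strict edges; the remaining cover relations are the weak edges.
\<close>

record 'a epos = "'a pos" +
  strict :: "'a rel"

definition edge_poset :: "'a lpos \<Rightarrow> 'a epos" where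
  "edge_poset P = \<lparr>elts = elts P, leq = leq P, strict = strict_edges P\<rparr>"

definition one_epos :: "'a \<Rightarrow> 'a epos" where
  "one_epos x = \<lparr>elts = {x}, leq = {(x, x)}, strict = {}\<rparr>"

text \<open>The next three operations are meant for posets with disjoint sets of elements.\<close>

definition disj_union :: "'a epos \<Rightarrow> 'a epos \<Rightarrow> 'a epos" where
  "disj_union P Q = \<lparr>elts = elts P \<union> elts Q, leq = leq P \<union> leq Q, strict = strict P \<union> strict Q\<rparr>"

definition weak_sum :: "'a epos \<Rightarrow> 'a epos \<Rightarrow> 'a epos" where
  "weak_sum P Q = \<lparr>elts = elts P \<union> elts Q,
     leq = leq P \<union> leq Q \<union> elts P \<times> elts Q,
     strict = strict P \<union> strict Q\<rparr>"

definition strict_sum :: "'a epos \<Rightarrow> 'a epos \<Rightarrow> 'a epos" where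
  "strict_sum P Q = \<lparr>elts = elts P \<union> elts Q,
     leq = leq P \<union> leq Q \<union> elts P \<times> elts Q,
     strict = strict P \<union> strict Q \<union> max_elts P \<times> min_elts Q\<rparr>"

text \<open>
  All pieces of a member of the class are subposets of it, so that it is enough to combine
  posets whose disjoint sets of elements lie in one type. As \<open>x\<close> is arbitrary, the class is
  closed under isomorphism.
\<close>

inductive_set class_C_edge :: "'a epos set" where
  one: "one_epos x \<in> class_C_edge"
| union: "P \<in> class_C_edge \<Longrightarrow> Q \<in> class_C_edge \<Longrightarrow> elts P \<inter> elts Q = {} \<Longrightarrow>
    disj_union P Q \<in> class_C_edge"
| weak_below: "P \<in> class_C_edge \<Longrightarrow> x \<notin> elts P \<Longrightarrow> weak_sum (one_epos x) P \<in> class_C_edge"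
| strict_below: "P \<in> class_C_edge \<Longrightarrow> x \<notin> elts P \<Longrightarrow> strict_sum (one_epos x) P \<in> class_C_edge"
| weak_above: "P \<in> class_C_edge \<Longrightarrow> x \<notin> elts P \<Longrightarrow> weak_sum P (one_epos x) \<in> class_C_edge"
| strict_above: "P \<in> class_C_edge \<Longrightarrow> x \<notin> elts P \<Longrightarrow> strict_sum P (one_epos x) \<in> class_C_edge"

definition class_C :: "'a lpos set" where
  "class_C = {P. labeled_poset P \<and> edge_poset P \<in> class_C_edge}"

definition hasse_adj :: "('a, 'm) pos_scheme \<Rightarrow> 'a rel" where
  "hasse_adj P = covers P \<union> (covers P)\<inverse>"

definition is_tree :: "'a set \<Rightarrow> 'a rel \<Rightarrow> bool" where
  "is_tree V E \<longleftrightarrow> V \<noteq> {} \<and>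
     (\<forall>u\<in>V. \<forall>v\<in>V. (u, v) \<in> E\<^sup>*) \<and>
     \<not> (\<exists>vs. length vs \<ge> 3 \<and> distinct vs \<and>
          successively (\<lambda>u v. (u, v) \<in> E) vs \<and> (last vs, hd vs) \<in> E)"

definition rooted_tree :: "('a, 'm) pos_scheme \<Rightarrow> bool" where
  "rooted_tree P \<longleftrightarrow> is_tree (elts P) (hasse_adj P) \<and> (\<exists>!r. r \<in> min_elts P)"

definition fair_tree :: "'a lpos \<Rightarrow> bool" where
  "fair_tree P \<longleftrightarrow> labeled_poset P \<and> rooted_tree P \<and>
     (\<forall>v\<in>elts P. (\<forall>w. (v, w) \<in> covers P \<longrightarrow> (v, w) \<in> strict_edges P) \<or>
                 (\<forall>w. (v, w) \<in> covers P \<longrightarrow> (v, w) \<in> weak_edges P))"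

end

theory Submission
  imports Defs "HOL-Computational_Algebra.Polynomial"
begin

text \<open>
  Evaluate the enumerator of \<open>P\<close> at all finite alphabets. This gives an element \<open>enum P\<close> of the ring
  of quasisymmetric functions, an integral domain, and disjoint unions become products. Inserting a
  letter \<open>t\<close> in front of or behind all other letters is a ring endomorphism depending polynomially on
  \<open>t\<close>, and so is its inverse. If \<open>E\<close> arises from \<open>A\<close> by adding a least or greatest element, then one
  of these four families of endomorphisms maps \<open>enum E\<close> to \<open>enum E + t * enum A\<close>. As only constants
  have degree 0 in \<open>t\<close>, all divisors of \<open>enum E\<close> are trivial; and \<open>enum E\<close> is even prime, by induction
  on the size of \<open>E\<close>: if it divides a product \<open>a * b\<close>, then division of polynomials in \<open>t\<close> shows that
  it divides \<open>(enum A)^k * a\<close> or \<open>(enum A)^k * b\<close>, and the factors of \<open>enum A\<close> are smaller primes that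
  do not divide \<open>enum E\<close>, hence can be cancelled. So \<open>enum P\<close> determines the enumerators of the
  connected components of \<open>P\<close>, and the linear behaviour in \<open>t\<close> determines the last step in the
  construction of a component together with the enumerator of what was there before that step.
\<close>

section \<open>Quasisymmetric functions as functions on finite alphabets\<close>

text \<open>Why adding an extreme element is linear in \<open>t\<close>: let \<open>E\<close> arise
  from \<open>A\<close> by a new least element \<open>x\<close>, and put a letter \<open>t\<close>
  in front of the alphabet \<open>X\<close>. Either \<open>x\<close> takes the value
  \<open>t\<close>, or no element does. If the new edges are strict, the other elements must avoid
  \<open>t\<close>, so E(tX) = E(X) + t A(X). If they are weak, then E(tX) = E(X) + t A(tX), where
  the last term may have any degree in \<open>t\<close>; solved for E(X), the relation is again
  linear, but for the inverse of the insertion. This is where the inverses come from; greatest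
  elements double the number of families to four. Two obstacles shape the rest. Irreducible factors
  alone do not make factorizations unique, so the enumerators have to be shown prime. And divisors
  are controlled only up to integer factors, which need not be units; so the final induction is
  about proportional enumerators, and homogeneity still yields the number of elements.\<close>

text \<open>
  Evaluation at the integer alphabets \<open>[x\<^sub>1, \<dots>, x\<^sub>n]\<close> of all lengths identifies quasisymmetric functions
  with functions on lists. They are characterized inductively by their expansion in the first letter.
\<close>

inductive qsym_fun :: "(int list \<Rightarrow> int) \<Rightarrow> bool" where
  qsym_funI: "(\<And>j. j \<in> {1..n} \<Longrightarrow> qsym_fun (G j)) \<Longrightarrow>
    (\<And>t X. F (t # X) = F X + (\<Sum>j=1..n. t ^ j * G j X)) \<Longrightarrow> qsym_fun F" for n :: nat

section \<open>Closure of \<open>qsym_fun\<close> under ring operations\<close>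

lemma qsym_fun_const: "qsym_fun (\<lambda>_. c)"
  by (rule qsym_funI[of 0 "\<lambda>_ _. 0"]) auto

lemma qsym_fun_add:
  assumes "qsym_fun F" "qsym_fun H"
  shows "qsym_fun (\<lambda>X. F X + H X)"
  using assms
proof (induction arbitrary: H)
  case (qsym_funI n G F)
  from \<open>qsym_fun H\<close> obtain m K where K: "\<And>j. j \<in> {1..m} \<Longrightarrow> qsym_fun (K j)"
    and H: "\<And>t X. H (t # X) = H X + (\<Sum>j=1..m. t ^ j * K j X)"
    by (rule qsym_fun.cases) blast
  let ?G = "\<lambda>j. if j \<in> {1..n} then G j else (\<lambda>_. 0)"
  let ?K = "\<lambda>j. if j \<in> {1..m} then K j else (\<lambda>_. 0)"
  have sumG: "(\<Sum>j=1..n. t ^ j * G j X) = (\<Sum>j=1..max n m. t ^ j * ?G j X)" for t X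
    by (rule sum.mono_neutral_cong_left) auto
  have sumK: "(\<Sum>j=1..m. t ^ j * K j X) = (\<Sum>j=1..max n m. t ^ j * ?K j X)" for t X
    by (rule sum.mono_neutral_cong_left) auto
  have K': "qsym_fun (?K j)" for j
    using K qsym_fun_const by simp
  show ?case
  proof (rule qsym_fun.qsym_funI[of "max n m" "\<lambda>j X. ?G j X + ?K j X"])
    show "qsym_fun (\<lambda>X. ?G j X + ?K j X)" if "j \<in> {1..max n m}" for j
    proof (cases "j \<in> {1..n}")
      case True
      then show ?thesis
        using qsym_funI.IH[OF True K'] by (simp only: True if_True)
    next
      case False
      then show ?thesis
        using K' by (simp only: False if_False add_0)
    qed
    show "F (t # X) + H (t # X) =
        F X + H X + (\<Sum>j=1..max n m. t ^ j * (?G j X + ?K j X))" for t X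
      unfolding qsym_funI.hyps(2) H sumG sumK distrib_left sum.distrib by (simp only: add_ac)
  qed
qed

lemma qsym_fun_sum: "(\<And>i. i \<in> I \<Longrightarrow> qsym_fun (F i)) \<Longrightarrow> qsym_fun (\<lambda>X. \<Sum>i\<in>I. F i X)"
  by (induction I rule: infinite_finite_induct) (auto intro: qsym_fun_const qsym_fun_add)

text \<open>Treats the constant term like the other coefficients: it is \<open>F\<close> itself, so
  a letter 0 is invisible. Every \<open>G j\<close> is defined, being zero beyond \<open>n\<close>,
  which avoids case distinctions for coefficients of products.\<close>

lemma qsym_fun_expand:
  assumes "qsym_fun F"
  obtains n G where "\<And>j. qsym_fun (G j)" "G 0 = F" "\<And>j. j > n \<Longrightarrow> G j = (\<lambda>_. 0)"
    "\<And>t X. F (t # X) = (\<Sum>j\<le>n. t ^ j * G j X)"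
proof -
  from assms obtain n G where G: "\<And>j. j \<in> {1..n} \<Longrightarrow> qsym_fun (G j)"
    and F: "\<And>t X. F (t # X) = F X + (\<Sum>j=1..n. t ^ j * G j X)"
    by (rule qsym_fun.cases) blast
  let ?G = "\<lambda>j. if j = 0 then F else if j \<le> n then G j else (\<lambda>_. 0)"
  have "F (t # X) = (\<Sum>j\<le>n. t ^ j * ?G j X)" for t X
  proof -
    have "{..n} = insert 0 {1..n}" by auto
    then show ?thesis by (simp add: F)
  qed
  then show ?thesis
    using that[of ?G n] G assms qsym_fun_const by auto
qed

lemma sum_mult_expand:
  fixes g h :: "nat \<Rightarrow> int"
  assumes "\<And>j. j > n \<Longrightarrow> g j = 0" "\<And>j. j > m \<Longrightarrow> h j = 0"
  shows "(\<Sum>j\<le>n. t ^ j * g j) * (\<Sum>j\<le>m. t ^ j * h j) =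
    (\<Sum>k\<le>n + m. t ^ k * (\<Sum>i\<le>k. g i * h (k - i)))"
  using polynomial_product[of n g m h t] assms by (simp only: mult.commute[of "t ^ _"])

text \<open>Nested induction. The coefficient of \<open>t ^ k\<close> with \<open>k > 0\<close> is a
  sum of products of coefficients at exponents \<open>i\<close> and \<open>k - i\<close>. If
  \<open>i > 0\<close>, the outer hypothesis applies to the first factor, whatever the second one
  is; if \<open>i = 0\<close>, the first factor is \<open>F\<close> itself, but then the inner
  hypothesis applies to the second one.\<close>

lemma qsym_fun_mult:
  assumes "qsym_fun F" "qsym_fun H"
  shows "qsym_fun (\<lambda>X. F X * H X)"
  using assms
proof (induction arbitrary: H)
  case (qsym_funI n G F)
  note outer = qsym_funI.IH and F = qsym_funI.hyps
  have qF: "qsym_fun F"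
    using qsym_fun.qsym_funI[of n G F] qsym_funI by blast
  from \<open>qsym_fun H\<close> show ?case
  proof induction
    case (qsym_funI m K H)
    note inner = qsym_funI.IH and H = qsym_funI.hyps
    have qH: "qsym_fun H"
      using qsym_fun.qsym_funI[of m K H] qsym_funI by blast
    let ?G = "\<lambda>j. if j = 0 then F else if j \<le> n then G j else (\<lambda>_. 0)"
    let ?K = "\<lambda>j. if j = 0 then H else if j \<le> m then K j else (\<lambda>_. 0)"
    have eF: "F (t # X) = (\<Sum>j\<le>n. t ^ j * ?G j X)" for t X
    proof -
      have "{..n} = insert 0 {1..n}" by auto
      then show ?thesis by (simp add: F)
    qed
    have eH: "H (t # X) = (\<Sum>j\<le>m. t ^ j * ?K j X)" for t X
    proof -
      have "{..m} = insert 0 {1..m}" by auto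
      then show ?thesis by (simp add: H)
    qed
    have qK: "qsym_fun (?K j)" for j
      using qH qsym_funI.hyps(1) qsym_fun_const by auto
    have prod: "qsym_fun (\<lambda>X. ?G i X * ?K j X)" if "i + j \<noteq> 0" for i j
    proof (cases "i = 0")
      case True
      then have j: "j \<noteq> 0" using that by simp
      show ?thesis
      proof (cases "j \<le> m")
        case True
        then show ?thesis
          using inner[of j] j \<open>i = 0\<close> by simp
      next
        case False
        then show ?thesis
          using j by (simp add: qsym_fun_const)
      qed
    next
      case False
      show ?thesis
      proof (cases "i \<le> n")
        case True
        then have "qsym_fun (\<lambda>X. G i X * ?K j X)"
          using outer[OF _ qK, of i j] False by simp
        then show ?thesis
          using True False by (simp only: if_False if_True)
      next
        case False
        then show ?thesis
          using \<open>i \<noteq> 0\<close> by (simp add: qsym_fun_const)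
      qed
    qed
    show ?case
    proof (rule qsym_fun.qsym_funI[of "n + m" "\<lambda>k X. \<Sum>i\<le>k. ?G i X * ?K (k - i) X"])
      show "qsym_fun (\<lambda>X. \<Sum>i\<le>k. ?G i X * ?K (k - i) X)" if "k \<in> {1..n + m}" for k
        by (rule qsym_fun_sum, rule prod) (use that in auto)
      have split: "{..n + m} = insert 0 {1..n + m}" by auto
      have "F (t # X) * H (t # X) =
          (\<Sum>k\<le>n + m. t ^ k * (\<Sum>i\<le>k. ?G i X * ?K (k - i) X))" for t X
        unfolding eF eH by (rule sum_mult_expand) auto
      then show "F (t # X) * H (t # X) = F X * H X +
          (\<Sum>k=1..n + m. t ^ k * (\<Sum>i\<le>k. ?G i X * ?K (k - i) X))" for t X
        unfolding split by simp
    qed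
  qed
qed

lemma qsym_fun_Cons:
  assumes "qsym_fun F"
  shows "qsym_fun (\<lambda>X. F (t # X))"
proof -
  obtain n G where "\<And>j. qsym_fun (G j)" "\<And>t X. F (t # X) = (\<Sum>j\<le>n. t ^ j * G j X)"
    by (rule qsym_fun_expand[OF assms]) blast
  then show ?thesis
    by (auto intro!: qsym_fun_sum qsym_fun_mult qsym_fun_const)
qed

section \<open>Expansion in the last letter, and reversal of alphabets\<close>

text \<open>The solution, starting with 0, of the recursion that adds \<open>s ^ j * G X\<close>
  when a letter \<open>s\<close> is appended to \<open>X\<close>. On monomial quasisymmetric
  functions and for \<open>j > 0\<close>, it appends the part \<open>j\<close> to the
  composition.\<close>

definition snoc_sum :: "nat \<Rightarrow> (int list \<Rightarrow> int) \<Rightarrow> int list \<Rightarrow> int" where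
  "snoc_sum j G X = (\<Sum>i<length X. (X ! i) ^ j * G (take i X))"

lemma snoc_sum_Nil: "snoc_sum j G [] = 0"
  by (simp add: snoc_sum_def)

lemma snoc_sum_snoc: "snoc_sum j G (X @ [s]) = snoc_sum j G X + s ^ j * G X"
  by (simp add: snoc_sum_def nth_append)

lemma snoc_sum_Cons: "snoc_sum j G (t # X) = t ^ j * G [] + snoc_sum j (\<lambda>Y. G (t # Y)) X"
  by (simp add: snoc_sum_def sum.lessThan_Suc_shift del: sum.lessThan_Suc)

lemma qsym_fun_snoc_sum:
  assumes "qsym_fun G" "j > 0"
  shows "qsym_fun (snoc_sum j G)"
  using assms(1)
proof induction
  case (qsym_funI n K G)
  \<comment> \<open>With \<open>t\<close> in front, the position of \<open>t\<close> contributes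
    \<open>t ^ j * G []\<close>, and the later positions see \<open>G\<close> on alphabets starting
    with \<open>t\<close>. As \<open>j > 0\<close>, the contribution of \<open>t\<close> itself
    belongs to a positive power.\<close>
  let ?L = "\<lambda>i X. (if i = j then G [] else 0) + (if i \<in> {1..n} then snoc_sum j (K i) X else 0)"
  show ?case
  proof (rule qsym_fun.qsym_funI[of "max n j" ?L])
    show "qsym_fun (?L i)" for i
    proof (intro qsym_fun_add qsym_fun_const)
      show "qsym_fun (\<lambda>X. if i \<in> {1..n} then snoc_sum j (K i) X else 0)"
        using qsym_funI.IH[of i] qsym_fun_const[of 0]
        by (cases "i \<in> {1..n}") (simp_all only: if_True if_False)
    qed
    fix t X
    have "(\<Sum>i=1..max n j. t ^ i * ?L i X) = (\<Sum>i=1..max n j. if i = j then t ^ j * G [] else 0)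
        + (\<Sum>i=1..max n j. if i \<in> {1..n} then t ^ i * snoc_sum j (K i) X else 0)"
      unfolding sum.distrib[symmetric] by (rule sum.cong) (auto simp: algebra_simps)
    also have "(\<Sum>i=1..max n j. if i = j then t ^ j * G [] else 0) = t ^ j * G []"
      using assms(2) by simp
    also have "(\<Sum>i=1..max n j. if i \<in> {1..n} then t ^ i * snoc_sum j (K i) X else 0) =
        (\<Sum>i=1..n. t ^ i * snoc_sum j (K i) X)"
      by (rule sum.mono_neutral_cong_right) auto
    also have "\<dots> = snoc_sum j (\<lambda>Y. \<Sum>i=1..n. t ^ i * K i Y) X"
      unfolding snoc_sum_def sum_distrib_left by (subst sum.swap) (simp add: algebra_simps)
    finally show "snoc_sum j G (t # X) = snoc_sum j G X + (\<Sum>i=1..max n j. t ^ i * ?L i X)"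
      unfolding snoc_sum_Cons qsym_funI.hyps(2) by (simp add: snoc_sum_def distrib_left sum.distrib)
  qed
qed

text \<open>The definition of \<open>qsym_fun\<close> favours the first letter. A recursion in the
  last letter is solved explicitly by a sum of functions \<open>snoc_sum j (G j)\<close>, which are
  known to qualify.\<close>

lemma qsym_fun_snocI:
  assumes "\<And>j. j \<in> {1..n} \<Longrightarrow> qsym_fun (G j)"
    and F: "\<And>s X. F (X @ [s]) = F X + (\<Sum>j=1..n. s ^ j * G j X)"
  shows "qsym_fun F"
proof -
  have "F X = F [] + (\<Sum>j=1..n. snoc_sum j (G j) X)" for X
    by (induction X rule: rev_induct)
      (simp_all add: F snoc_sum_Nil snoc_sum_snoc sum.distrib)
  then have "F = (\<lambda>X. F [] + (\<Sum>j=1..n. snoc_sum j (G j) X))" by blast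
  moreover have "qsym_fun (\<lambda>X. F [] + (\<Sum>j=1..n. snoc_sum j (G j) X))"
    by (intro qsym_fun_add qsym_fun_const qsym_fun_sum qsym_fun_snoc_sum assms(1)) auto
  ultimately show ?thesis by simp
qed

lemma qsym_fun_rev:
  assumes "qsym_fun F"
  shows "qsym_fun (\<lambda>X. F (rev X))"
  using assms
proof induction
  case (qsym_funI n G F)
  show ?case
  proof (rule qsym_fun_snocI[of n "\<lambda>j X. G j (rev X)"])
    show "qsym_fun (\<lambda>X. G j (rev X))" if "j \<in> {1..n}" for j
      using that by (rule qsym_funI.IH)
  qed (simp add: qsym_funI.hyps(2))
qed

section \<open>Integrality, and inverting the insertion of a letter\<close>

text \<open>For fixed \<open>X\<close>, both factors at \<open>t # X\<close> are integer polynomials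
  in \<open>t\<close>, so one of them vanishes identically. Pairing the coefficients
  \<open>G j\<close> of \<open>F\<close> with the constant coefficient \<open>H\<close> gives
  \<open>G j X * H X = 0\<close>, so \<open>G j\<close> vanishes by induction; then \<open>F\<close>
  is constant, and it is 0 where \<open>H\<close> is not.\<close>

lemma qsym_fun_no_zero_divisors:
  assumes "qsym_fun F" "qsym_fun H" "\<And>X. F X * H X = 0" "H \<noteq> (\<lambda>_. 0)"
  shows "F = (\<lambda>_. 0)"
  using assms
proof (induction arbitrary: H)
  case (qsym_funI n G F)
  obtain m K where K: "\<And>j. qsym_fun (K j)" "K 0 = H" "\<And>j. j > m \<Longrightarrow> K j = (\<lambda>_. 0)"
    and eH: "\<And>t X. H (t # X) = (\<Sum>j\<le>m. t ^ j * K j X)"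
    by (rule qsym_fun_expand[OF \<open>qsym_fun H\<close>]) blast
  let ?G = "\<lambda>j. if j = 0 then F else if j \<le> n then G j else (\<lambda>_. 0)"
  have eF: "F (t # X) = (\<Sum>j\<le>n. t ^ j * ?G j X)" for t X
  proof -
    have "{..n} = insert 0 {1..n}" by auto
    then show ?thesis by (simp add: qsym_funI.hyps(2))
  qed
  have coeffs: "(\<forall>j. ?G j X = 0) \<or> (\<forall>j. K j X = 0)" for X
  proof -
    define p where "p = (\<Sum>j\<le>n. monom (?G j X) j)"
    define q where "q = (\<Sum>j\<le>m. monom (K j X) j)"
    have "poly (p * q) t = 0" for t
      using qsym_funI.prems(2)[of "t # X"]
      by (simp add: p_def q_def poly_sum poly_monom eF eH mult.commute)
    then have "p = 0 \<or> q = 0"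
      using poly_all_0_iff_0[of "p * q"] by auto
    moreover have "coeff p j = ?G j X" "coeff q j = K j X" for j
      using K(3)[of j] by (auto simp: p_def q_def coeff_sum not_le)
    ultimately show ?thesis by (metis coeff_0)
  qed
  have G0: "G j = (\<lambda>_. 0)" if "j \<in> {1..n}" for j
  proof (rule qsym_funI.IH[OF that \<open>qsym_fun H\<close> _ \<open>H \<noteq> _\<close>])
    fix X
    have "?G j X = 0 \<or> K 0 X = 0" using coeffs by blast
    then show "G j X * H X = 0"
      using that K(2) by auto
  qed
  have "\<And>X. F X = F []"
    subgoal for X by (induction X) (use G0 in \<open>auto simp: qsym_funI.hyps(2)\<close>)
    done
  then show ?case
  proof -
    obtain X0 where "H X0 \<noteq> 0" using \<open>H \<noteq> _\<close> by auto
    then have "F X0 = 0" using qsym_funI.prems(2)[of X0] by simp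
    then have "F [] = 0" using \<open>\<And>X. F X = F []\<close>[of X0] by simp
    then show ?thesis using \<open>\<And>X. F X = F []\<close> by auto
  qed
qed

text \<open>
  The Neumann series of \<open>F \<mapsto> F (t # _)\<close> terminates, as \<open>F (t # _) - F\<close> only involves the
  coefficients of \<open>F\<close> at positive powers of \<open>t\<close>.
\<close>

lemma qsym_fun_diff_nilpotent:
  assumes "qsym_fun F"
  shows "\<exists>k. \<forall>l\<ge>k. ((\<lambda>H X. H (t # X) - H X) ^^ l) F = (\<lambda>_. 0 :: int)"
  using assms
proof induction
  case (qsym_funI n G F)
  let ?N = "\<lambda>H X. H (t # X) - H X :: int"
  have "\<forall>j\<in>{1..n}. \<exists>k. \<forall>l\<ge>k. (?N ^^ l) (G j) = (\<lambda>_. 0)"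
    using qsym_funI.IH by blast
  from bchoice[OF this] obtain k where k: "\<And>j l. j \<in> {1..n} \<Longrightarrow> l \<ge> k j \<Longrightarrow> (?N ^^ l) (G j) = (\<lambda>_. 0)"
    by blast
  have lin: "(?N ^^ l) (\<lambda>X. \<Sum>j\<in>J. t ^ j * H j X) = (\<lambda>X. \<Sum>j\<in>J. t ^ j * (?N ^^ l) (H j) X)"
    for l J H
    by (induction l) (simp_all add: sum_subtractf algebra_simps)
  have step: "?N F = (\<lambda>X. \<Sum>j=1..n. t ^ j * G j X)"
    by (simp add: qsym_funI.hyps(2))
  \<comment> \<open>The first application turns \<open>F\<close> into a combination of the
    \<open>G j\<close>; the sum of the \<open>k j\<close> is large enough for all of them.\<close>
  have "(?N ^^ l) F = (\<lambda>_. 0)" if "l \<ge> Suc (\<Sum>j=1..n. k j)" for l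
  proof -
    obtain l' where l': "l = Suc l'" "l' \<ge> (\<Sum>j=1..n. k j)"
      using \<open>l \<ge> _\<close> by (cases l) auto
    have "(?N ^^ l') (G j) = (\<lambda>_. 0)" if "j \<in> {1..n}" for j
      using k[OF that, of l'] member_le_sum[of j "{1..n}" k] that l'(2) by fastforce
    then show ?thesis
      unfolding l' funpow_Suc_right comp_def step lin by simp
  qed
  then show ?case by blast
qed

text \<open>On a function killed by the letter \<open>t\<close>, the difference operator acts as
  multiplication by -1, but some power of it vanishes.\<close>

lemma qsym_fun_Cons_eq_0:
  assumes "qsym_fun F" "\<And>X. F (t # X) = 0"
  shows "F = (\<lambda>_. 0)"
proof -
  have "((\<lambda>H X. H (t # X) - H X) ^^ l) F = (\<lambda>X. (-1) ^ l * F X)" for l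
    by (induction l) (simp_all add: assms(2))
  then have "\<exists>l. (\<lambda>X. (-1) ^ l * F X) = (\<lambda>_. 0)"
    using qsym_fun_diff_nilpotent[OF assms(1), of t] by (metis order_refl)
  then show ?thesis
    by (auto simp: fun_eq_iff)
qed

text \<open>\<open>F X\<close> is \<open>F (t # X)\<close> minus the terms
  \<open>t ^ i * G i X\<close>, so a preimage of \<open>F\<close> is \<open>F\<close> minus
  multiples of preimages of the \<open>G i\<close>. Its polynomial dependence on \<open>t\<close> is
  what makes the inverse operators polynomial.\<close>

lemma qsym_fun_Cons_surj:
  assumes "qsym_fun F"
  shows "\<exists>n H. (\<forall>j. qsym_fun (H j)) \<and> (\<forall>t X. (\<Sum>j\<le>n. t ^ j * H j (t # X)) = F X)"
  using assms
proof induction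
  case (qsym_funI n G F)
  have qF: "qsym_fun F"
    using qsym_fun.qsym_funI[of n G F] qsym_funI by blast
  have "\<forall>i\<in>{1..n}. \<exists>m K. (\<forall>j. qsym_fun (K j)) \<and> (\<forall>t X. (\<Sum>j\<le>m. t ^ j * K j (t # X)) = G i X)"
    using qsym_funI.IH by blast
  from bchoice[OF this] obtain m where
    "\<forall>i\<in>{1..n}. \<exists>K. (\<forall>j. qsym_fun (K j)) \<and> (\<forall>t X. (\<Sum>j\<le>m i. t ^ j * K j (t # X)) = G i X)"
    by (elim exE)
  from bchoice[OF this] obtain H where
    "\<forall>i\<in>{1..n}. (\<forall>j. qsym_fun (H i j)) \<and> (\<forall>t X. (\<Sum>j\<le>m i. t ^ j * H i j (t # X)) = G i X)"
    by (elim exE)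
  then have H: "\<And>i j. i \<in> {1..n} \<Longrightarrow> qsym_fun (H i j)"
    "\<And>i t X. i \<in> {1..n} \<Longrightarrow> (\<Sum>j\<le>m i. t ^ j * H i j (t # X)) = G i X"
    by blast+
  \<comment> \<open>\<open>?c i j\<close> below is the coefficient of \<open>t ^ j\<close> in
    \<open>t ^ i\<close> times the preimage of \<open>G i\<close>; its exponents end at
    \<open>i + m i\<close>, for which \<open>N\<close> is a common bound.\<close>
  define N where "N = n + (\<Sum>i=1..n. m i)"
  let ?c = "\<lambda>i j. if i \<le> j \<and> j \<le> i + m i then H i (j - i) else (\<lambda>_. 0)"
  define L where "L j X = (if j = 0 then F X else 0) - (\<Sum>i=1..n. ?c i j X)" for j X
  have "qsym_fun (L j)" for j
  proof -
    have "qsym_fun (?c i j)" if "i \<in> {1..n}" for i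
      using H(1)[OF that] qsym_fun_const by simp
    moreover have "qsym_fun (\<lambda>X. if j = 0 then F X else 0)"
      using qF qsym_fun_const by (cases "j = 0") auto
    ultimately have "qsym_fun (\<lambda>X. (if j = 0 then F X else 0) + (-1) * (\<Sum>i=1..n. ?c i j X))"
      by (intro qsym_fun_add qsym_fun_mult qsym_fun_const qsym_fun_sum)
    then show ?thesis
      by (simp add: L_def[abs_def])
  qed
  moreover have "(\<Sum>j\<le>N. t ^ j * L j (t # X)) = F X" for t X
  proof -
    have inner: "(\<Sum>j\<le>N. t ^ j * ?c i j (t # X)) = t ^ i * G i X" if i: "i \<in> {1..n}" for i
    proof -
      have le: "i + m i \<le> N"
        using member_le_sum[of i "{1..n}" m] i by (auto simp: N_def)
      have "(\<Sum>j\<le>N. t ^ j * ?c i j (t # X)) = (\<Sum>j=i..i + m i. t ^ j * H i (j - i) (t # X))"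
        by (rule sum.mono_neutral_cong_right) (use le in auto)
      also have "\<dots> = (\<Sum>j\<le>m i. t ^ (i + j) * H i j (t # X))"
        by (rule sum.reindex_bij_witness[of _ "\<lambda>j. i + j" "\<lambda>j. j - i"]) auto
      also have "\<dots> = t ^ i * G i X"
        using H(2)[OF i, of t X, symmetric] by (simp add: sum_distrib_left power_add mult.assoc)
      finally show ?thesis .
    qed
    have "(\<Sum>j\<le>N. t ^ j * L j (t # X)) = (\<Sum>j\<le>N. if j = 0 then F (t # X) else 0) -
        (\<Sum>j\<le>N. \<Sum>i=1..n. t ^ j * ?c i j (t # X))"
      unfolding L_def right_diff_distrib sum_subtractf sum_distrib_left
      by (rule arg_cong2[where f = "(-)"], rule sum.cong) auto
    also have "(\<Sum>j\<le>N. if j = 0 then F (t # X) else 0) = F (t # X)"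
      by simp
    also have "(\<Sum>j\<le>N. \<Sum>i=1..n. t ^ j * ?c i j (t # X)) = (\<Sum>i=1..n. t ^ i * G i X)"
      by (subst sum.swap) (use inner in auto)
    finally show ?thesis by (simp add: qsym_funI.hyps(2))
  qed
  ultimately show ?case by blast
qed

section \<open>The ring of quasisymmetric functions\<close>

typedef qsym = "{F. qsym_fun F}"
  using qsym_fun_const by blast

setup_lifting type_definition_qsym

instantiation qsym :: comm_ring_1
begin

lift_definition zero_qsym :: qsym is "\<lambda>_. 0" by (rule qsym_fun_const)
lift_definition one_qsym :: qsym is "\<lambda>_. 1" by (rule qsym_fun_const)
lift_definition plus_qsym :: "qsym \<Rightarrow> qsym \<Rightarrow> qsym" is "\<lambda>F G X. F X + G X" by (rule qsym_fun_add)
lift_definition times_qsym :: "qsym \<Rightarrow> qsym \<Rightarrow> qsym" is "\<lambda>F G X. F X * G X" by (rule qsym_fun_mult)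
lift_definition uminus_qsym :: "qsym \<Rightarrow> qsym" is "\<lambda>F X. - F X"
  using qsym_fun_mult[OF qsym_fun_const[of "-1"]] by simp
lift_definition minus_qsym :: "qsym \<Rightarrow> qsym \<Rightarrow> qsym" is "\<lambda>F G X. F X - G X"
  using qsym_fun_add[OF _ qsym_fun_mult[OF qsym_fun_const[of "-1"]]] by simp

instance
  by standard (transfer; simp add: algebra_simps fun_eq_iff)+

end

instance qsym :: idom
proof
  fix F G :: qsym
  assume "F \<noteq> 0" "G \<noteq> 0"
  then show "F * G \<noteq> 0"
    by transfer (metis qsym_fun_no_zero_divisors)
qed

lemma Rep_qsym_qsym_fun: "qsym_fun (Rep_qsym F)"
  using Rep_qsym[of F] by simp

lemma Rep_qsym_of_nat: "Rep_qsym (of_nat n) X = int n"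
  by (induction n) (simp_all add: zero_qsym.rep_eq one_qsym.rep_eq plus_qsym.rep_eq)

lemma Rep_qsym_of_int: "Rep_qsym (of_int n) X = n"
  by (cases n) (simp_all add: Rep_qsym_of_nat uminus_qsym.rep_eq one_qsym.rep_eq plus_qsym.rep_eq
      minus_qsym.rep_eq)

instance qsym :: ring_char_0
  by standard (auto simp: inj_on_def dest: arg_cong[where f = "\<lambda>F. Rep_qsym F []"] simp: Rep_qsym_of_nat)

lemma Rep_qsym_sum: "Rep_qsym (sum F I) X = (\<Sum>i\<in>I. Rep_qsym (F i) X)"
  by (induction I rule: infinite_finite_induct) (simp_all add: zero_qsym.rep_eq plus_qsym.rep_eq)

lemma qsym_eqI: "(\<And>X. Rep_qsym F X = Rep_qsym G X) \<Longrightarrow> F = G"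
  by (simp add: Rep_qsym_inject[symmetric] fun_eq_iff)

text \<open>The operators below are indexed by integers \<open>t\<close>; in characteristic 0 these
  are infinitely many points, enough to determine a polynomial over a domain.\<close>

lemma poly_of_int_eqI:
  fixes p q :: "'a :: {idom, ring_char_0} poly"
  assumes "\<And>t. poly p (of_int t) = poly q (of_int t)"
  shows "p = q"
proof (rule ccontr)
  assume "p \<noteq> q"
  then have "finite {x. poly (p - q) x = 0}"
    by (intro poly_roots_finite) simp
  moreover have "range of_int \<subseteq> {x. poly (p - q) x = 0}"
    using assms by auto
  ultimately have "finite (range (of_int :: int \<Rightarrow> 'a))"
    by (rule finite_subset[rotated])
  then show False
    by (simp add: finite_image_iff inj_on_def infinite_UNIV_int)
qed

section \<open>Endomorphisms depending polynomially on a parameter\<close>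

text \<open>The model is the substitution of \<open>x + t\<close> for \<open>x\<close> in a
  polynomial ring, where the constants are likewise the only elements invariant under all
  shifts.\<close>

locale translation =
  fixes \<phi> :: "int \<Rightarrow> qsym \<Rightarrow> qsym"
  assumes add: "\<phi> t (F + G) = \<phi> t F + \<phi> t G"
    and mult: "\<phi> t (F * G) = \<phi> t F * \<phi> t G"
    and one: "\<phi> t 1 = 1"
    and at_0: "\<phi> 0 F = F"
    and polynomial: "\<exists>p. \<forall>t. \<phi> t F = poly p (of_int t)"
    and invariant_const: "(\<And>t. \<phi> t F = F) \<Longrightarrow> \<exists>c. F = of_int c"
begin

text \<open>The whole family bundled into one injective ring homomorphism to
  \<open>qsym poly\<close>. The degree of \<open>expand F\<close> is therefore additive on products
  of nonzero elements; this degree is the invariant used throughout.\<close>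

definition expand :: "qsym \<Rightarrow> qsym poly" where
  "expand F = (THE p. \<forall>t. \<phi> t F = poly p (of_int t))"

lemma poly_expand: "poly (expand F) (of_int t) = \<phi> t F"
proof -
  obtain p where p: "\<forall>t. \<phi> t F = poly p (of_int t)"
    using polynomial by blast
  have "\<forall>t. \<phi> t F = poly (expand F) (of_int t)"
    unfolding expand_def by (rule theI[of _ p]) (use p in \<open>auto intro: poly_of_int_eqI\<close>)
  then show ?thesis by simp
qed

lemma expand_eqI: "(\<And>t. \<phi> t F = poly p (of_int t)) \<Longrightarrow> expand F = p"
  by (rule poly_of_int_eqI) (simp add: poly_expand)

lemma expand_add: "expand (F + G) = expand F + expand G"
  by (rule expand_eqI) (simp add: poly_expand add)

lemma expand_mult: "expand (F * G) = expand F * expand G"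
  by (rule expand_eqI) (simp add: poly_expand mult)

lemma coeff_expand_0: "coeff (expand F) 0 = F"
  using poly_expand[of F 0] by (simp add: at_0 poly_0_coeff_0)

lemma expand_eq_0_iff: "expand F = 0 \<longleftrightarrow> F = 0"
proof
  show "expand F = 0 \<Longrightarrow> F = 0"
    using coeff_expand_0[of F] by simp
  have "expand 0 + expand 0 = expand 0"
    using expand_add[of 0 0] by simp
  then show "F = 0 \<Longrightarrow> expand F = 0" by simp
qed

lemma zero: "\<phi> t 0 = 0"
  using poly_expand[of 0 t] expand_eq_0_iff[of 0] by simp

lemma of_nat: "\<phi> t (of_nat n) = of_nat n"
  by (induction n) (simp_all add: zero one add)

lemma uminus: "\<phi> t (- F) = - \<phi> t F"
  using add[of t F "- F"] zero[of t] by (simp add: eq_neg_iff_add_eq_0 add.commute)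

lemma diff: "\<phi> t (F - G) = \<phi> t F - \<phi> t G"
  using add[of t F "- G"] by (simp add: uminus)

lemma of_int: "\<phi> t (of_int c) = of_int c"
  by (cases c rule: int_diff_cases) (simp add: of_nat diff)

lemma expand_of_int: "expand (of_int c) = [:of_int c:]"
  by (rule expand_eqI) (simp add: of_int)

lemma degree_expand_eq_0: "degree (expand F) = 0 \<Longrightarrow> \<exists>c. F = of_int c"
proof (rule invariant_const)
  fix t
  assume "degree (expand F) = 0"
  then obtain G where "expand F = [:G:]"
    by (rule degree_eq_zeroE)
  then show "\<phi> t F = F"
    using poly_expand[of F t] coeff_expand_0[of F] by simp
qed

lemma degree_expand_mult:
  "F \<noteq> 0 \<Longrightarrow> G \<noteq> 0 \<Longrightarrow> degree (expand (F * G)) = degree (expand F) + degree (expand G)"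
  by (simp add: expand_mult degree_mult_eq expand_eq_0_iff)

lemma expand_linear_iff: "expand f = [:f, g:] \<longleftrightarrow> (\<forall>t. \<phi> t f = f + of_int t * g)"
proof
  assume "expand f = [:f, g:]"
  then show "\<forall>t. \<phi> t f = f + of_int t * g"
    by (simp add: poly_expand[symmetric])
qed (auto intro!: expand_eqI)

lemma dvd_linear:
  assumes f: "expand f = [:f, g:]" "g \<noteq> 0" and "f = F * G"
    and F: "\<nexists>c. F = of_int c"
  shows "\<exists>c. G = of_int c"
proof -
  have "f \<noteq> 0" using f expand_eq_0_iff[of f] by auto
  then have "F \<noteq> 0" "G \<noteq> 0" using \<open>f = F * G\<close> by auto
  from degree_expand_mult[OF this] have "1 = degree (expand F) + degree (expand G)"
    using f \<open>f = F * G\<close> by simp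
  moreover have "degree (expand F) \<noteq> 0"
    using degree_expand_eq_0 F by blast
  ultimately show ?thesis
    by (intro degree_expand_eq_0) simp
qed

text \<open>
  Pseudo-division of \<open>expand a\<close> and \<open>expand b\<close> by the linear polynomial \<open>expand f = [:f, g:]\<close>
  leaves constant remainders. If \<open>f\<close> divides \<open>a * b\<close>, then their product vanishes, so one of
  them vanishes, and the constant coefficients show that \<open>f\<close> divides \<open>g ^ k * a\<close> or \<open>g ^ k * b\<close>.
\<close>

lemma linear_dvd_power_mult:
  assumes f: "expand f = [:f, g:]" "g \<noteq> 0" and dvd: "f dvd a * b"
  shows "\<exists>k. f dvd g ^ k * a \<or> f dvd g ^ k * b"
proof -
  let ?q = "[:f, g:]"
  have q: "?q \<noteq> 0" "degree ?q = 1" "coeff ?q (degree ?q) = g"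
    using f(2) by simp_all
  have div: "\<exists>k s r. smult (g ^ k) p = ?q * s + [:r:]" for p
  proof -
    obtain s r where "pseudo_divmod p ?q = (s, r)"
      by (cases "pseudo_divmod p ?q")
    note * = pseudo_divmod[OF q(1) this]
    have "degree r = 0" using *(2) q(2) by auto
    then obtain r' where "r = [:r':]" by (rule degree_eq_zeroE)
    then show ?thesis using *(1) unfolding q(3) by blast
  qed
  obtain k s r where a: "smult (g ^ k) (expand a) = ?q * s + [:r:]" using div by blast
  obtain l u v where b: "smult (g ^ l) (expand b) = ?q * u + [:v:]" using div by blast
  obtain h where h: "a * b = f * h" using dvd by blast
  have "smult (g ^ k) (expand a) * smult (g ^ l) (expand b) = ?q * smult (g ^ k * g ^ l) (expand h)"
    using h f(1) by (simp add: expand_mult[symmetric] mult.commute) (simp add: expand_mult)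
  then have "(?q * s + [:r:]) * (?q * u + [:v:]) = ?q * smult (g ^ k * g ^ l) (expand h)"
    using a b by simp
  moreover have "(q * s + r) * (q * u + v) = q * h \<Longrightarrow> r * v = q * (h - s * (q * u + v) - r * u)"
    for q s r u v h :: "qsym poly"
    by algebra
  ultimately have "?q dvd [:r:] * [:v:]"
    by (metis dvd_triv_left)
  then have rv: "?q dvd [:r * v:]" by (simp add: mult.commute)
  have "r * v = 0"
  proof (rule ccontr)
    assume "r * v \<noteq> 0"
    then show False using dvd_imp_degree_le[OF rv] q(2) by simp
  qed
  then consider "r = 0" | "v = 0" by auto
  then show ?thesis
  proof cases
    case 1
    then have "g ^ k * a = f * coeff s 0"
      using arg_cong[OF a, of "\<lambda>p. coeff p 0"] by (simp add: coeff_expand_0)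
    then show ?thesis by (metis dvd_triv_left)
  next
    case 2
    then have "g ^ l * b = f * coeff u 0"
      using arg_cong[OF b, of "\<lambda>p. coeff p 0"] by (simp add: coeff_expand_0)
    then show ?thesis by (metis dvd_triv_left)
  qed
qed

end

section \<open>Cancelling primes\<close>

text \<open>A prime that divides \<open>f * h\<close> but not \<open>f\<close> divides
  \<open>h\<close> and can be cancelled on both sides; this removes the members of \<open>P\<close>
  one at a time.\<close>

lemma dvd_mult_prod_mset_primes:
  fixes f :: "'a :: idom"
  assumes "\<And>p. p \<in># P \<Longrightarrow> prime_elem p \<and> \<not> p dvd f" and "f dvd prod_mset P * a"
  shows "f dvd a"
  using assms
proof (induction P arbitrary: a)
  case (add p P)
  have p: "prime_elem p" "\<not> p dvd f" using add.prems(1) by auto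
  obtain h where h: "p * (prod_mset P * a) = f * h"
    using add.prems(2) by (auto simp: mult.assoc)
  then have "p dvd f * h" by (metis dvd_triv_left)
  then obtain h' where "h = p * h'"
    using p prime_elem_dvd_multD by blast
  then have "p * (prod_mset P * a) = p * (f * h')"
    using h by (simp add: mult_ac)
  then have "prod_mset P * a = f * h'"
    using p(1) by auto
  then have "f dvd prod_mset P * a" by simp
  moreover have "prime_elem q \<and> \<not> q dvd f" if "q \<in># P" for q
    using add.prems(1)[of q] that by simp
  ultimately show ?case
    using add.IH by blast
next
  case empty
  from empty.prems(2) show ?case by simp
qed

lemma dvd_power_mult_primes:
  fixes f :: "'a :: idom"
  assumes "\<And>p. p \<in># P \<Longrightarrow> prime_elem p \<and> \<not> p dvd f" and "f dvd prod_mset P ^ k * a"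
  shows "f dvd a"
  using assms(2)
proof (induction k)
  case (Suc k)
  then have "f dvd prod_mset P * (prod_mset P ^ k * a)"
    by (simp only: power_Suc mult.assoc)
  from dvd_mult_prod_mset_primes[OF assms(1) this] show ?case
    by (rule Suc.IH)
qed simp

lemma (in translation) prime_elem_linear:
  assumes f: "expand f = [:f, prod_mset P:]"
    and P: "\<And>p. p \<in># P \<Longrightarrow> prime_elem p \<and> \<not> p dvd f"
  shows "prime_elem f"
proof (rule prime_elemI)
  \<comment> \<open>0 is not a prime element, so it is not among the factors.\<close>
  have g: "prod_mset P \<noteq> 0"
    using P[of 0] by (auto simp: prod_mset_zero_iff)
  show "f \<noteq> 0"
    using f g expand_eq_0_iff[of f] by auto
  \<comment> \<open>A unit would have degree 0, but \<open>expand f\<close> has degree 1.\<close>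
  show "\<not> f dvd 1"
  proof
    assume "f dvd 1"
    then obtain h where "1 = f * h" by blast
    then have "degree (expand f) + degree (expand h) = degree (expand 1)"
      by (metis degree_expand_mult mult_zero_left mult_zero_right zero_neq_one)
    also have "\<dots> = 0" using expand_of_int[of 1] by simp
    finally show False using f g by simp
  qed
  fix a b
  assume "f dvd a * b"
  then show "f dvd a \<or> f dvd b"
    using linear_dvd_power_mult[OF f g] dvd_power_mult_primes[OF P] by blast
qed

section \<open>Inserting a letter\<close>

lift_definition cons_op :: "int \<Rightarrow> qsym \<Rightarrow> qsym" is "\<lambda>t F X. F (t # X)"
  by (rule qsym_fun_Cons)

lift_definition rev_op :: "qsym \<Rightarrow> qsym" is "\<lambda>F X. F (rev X)"
  by (rule qsym_fun_rev)

lemma cons_op_polynomial: "\<exists>p. \<forall>t. cons_op t F = poly p (of_int t)"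
proof -
  obtain n G where G: "\<And>j. qsym_fun (G j)" "\<And>t X. Rep_qsym F (t # X) = (\<Sum>j\<le>n. t ^ j * G j X)"
    by (rule qsym_fun_expand[OF Rep_qsym_qsym_fun[of F]]) blast
  have "cons_op t F = poly (\<Sum>j\<le>n. monom (Abs_qsym (G j)) j) (of_int t)" for t
    by (rule qsym_eqI)
      (simp add: poly_sum poly_monom Rep_qsym_sum times_qsym.rep_eq cons_op.rep_eq G Abs_qsym_inverse
        Rep_qsym_of_int mult.commute flip: of_int_power)
  then show ?thesis by blast
qed

lemma cons_op_surj_polynomial: "\<exists>p. \<forall>t. cons_op t (poly p (of_int t)) = F"
proof -
  obtain n H where H: "\<And>j. qsym_fun (H j)"
    "\<And>t X. (\<Sum>j\<le>n. t ^ j * H j (t # X)) = Rep_qsym F X"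
    using qsym_fun_Cons_surj[OF Rep_qsym_qsym_fun[of F]] by blast
  have "cons_op t (poly (\<Sum>j\<le>n. monom (Abs_qsym (H j)) j) (of_int t)) = F" for t
    by (rule qsym_eqI)
      (simp add: poly_sum poly_monom Rep_qsym_sum times_qsym.rep_eq cons_op.rep_eq Abs_qsym_inverse
        Rep_qsym_of_int mult.commute H(1) flip: of_int_power H(2)[of t])
  then show ?thesis by blast
qed

lemma cons_op_eq_0: "cons_op t F = 0 \<Longrightarrow> F = 0"
  by transfer (metis qsym_fun_Cons_eq_0)

interpretation cons_op: translation cons_op
proof
  show "cons_op t (F + G) = cons_op t F + cons_op t G" for t F G
    by transfer simp
  show "cons_op t (F * G) = cons_op t F * cons_op t G" for t F G
    by transfer simp
  show "cons_op t 1 = 1" for t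
    by transfer simp
  show "\<exists>p. \<forall>t. cons_op t F = poly p (of_int t)" for F
    by (rule cons_op_polynomial)
  show "cons_op 0 F = F" for F
  proof -
    have "Rep_qsym F (0 # X) = Rep_qsym F X" for X
    proof -
      obtain n G where "G 0 = Rep_qsym F" "\<And>t X. Rep_qsym F (t # X) = (\<Sum>j\<le>n. t ^ j * G j X)"
        by (rule qsym_fun_expand[OF Rep_qsym_qsym_fun[of F]]) blast
      then show ?thesis by (simp add: power_0_left if_distrib[of "\<lambda>x. x * _"] cong: if_cong)
    qed
    then show ?thesis by (intro qsym_eqI) (simp add: cons_op.rep_eq)
  qed
  \<comment> \<open>Invariance under inserting any letter allows every list to be shortened to
    \<open>[]\<close>.\<close>
  show "\<exists>c. F = of_int c" if "\<And>t. cons_op t F = F" for F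
  proof -
    have "Rep_qsym F (t # X) = Rep_qsym F X" for t X
      using arg_cong[OF that[of t], of "\<lambda>G. Rep_qsym G X"] by (simp add: cons_op.rep_eq)
    then have "Rep_qsym F X = Rep_qsym F []" for X
      by (induction X) simp_all
    then have "F = of_int (Rep_qsym F [])"
      by (intro qsym_eqI) (simp add: Rep_qsym_of_int)
    then show ?thesis ..
  qed
qed

lemma bij_cons_op: "bij (cons_op t)"
proof (rule bijI)
  show "inj (cons_op t)"
  proof (rule injI)
    fix F G
    assume "cons_op t F = cons_op t G"
    then show "F = G"
      using cons_op_eq_0[of t "F - G"] by (simp add: cons_op.diff)
  qed
  show "surj (cons_op t)"
    unfolding surj_def using cons_op_surj_polynomial[of _] by metis
qed

text \<open>
  In terms of alphabets, the inverse of inserting \<open>-t\<close> inserts \<open>t\<close> as a letter whose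
  occurrences are counted with the roles of weak and strict edges exchanged.
\<close>

interpretation inv_cons_op: translation "\<lambda>t. inv (cons_op (- t))"
proof
  have inv_eq: "cons_op t G = F \<Longrightarrow> inv (cons_op t) F = G" for t F G
    by (metis bij_cons_op bij_inv_eq_iff)
  have cancel: "cons_op t (inv (cons_op t) F) = F" for t F
    by (metis bij_cons_op bij_inv_eq_iff)
  show "inv (cons_op (- t)) (F + G) = inv (cons_op (- t)) F + inv (cons_op (- t)) G" for t F G
    by (rule inv_eq) (simp add: cons_op.add cancel)
  show "inv (cons_op (- t)) (F * G) = inv (cons_op (- t)) F * inv (cons_op (- t)) G" for t F G
    by (rule inv_eq) (simp add: cons_op.mult cancel)
  show "inv (cons_op (- t)) 1 = 1" for t
    by (rule inv_eq) (simp add: cons_op.one)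
  show "inv (cons_op (- 0)) F = F" for F
    by (rule inv_eq) (simp add: cons_op.at_0)
  show "\<exists>p. \<forall>t. inv (cons_op (- t)) F = poly p (of_int t)" for F
  proof -
    obtain p where "\<And>t. cons_op t (poly p (of_int t)) = F"
      using cons_op_surj_polynomial by blast
    then have "inv (cons_op (- t)) F = poly (pcompose p [:0, -1:]) (of_int t)" for t
      by (intro inv_eq) (metis (no_types) add_0 mult_minus1_right of_int_minus poly_pCons poly_0
          mult_zero_right add_0_right poly_pcompose)
    then show ?thesis by blast
  qed
  show "\<exists>c. F = of_int c" if "\<And>t. inv (cons_op (- t)) F = F" for F
  proof (rule cons_op.invariant_const)
    show "cons_op t F = F" for t
      using cancel[of t F] that[of "- t"] by simp
  qed
qed

text \<open>Applied to the reversal of alphabets, which moves the new letter from the front to the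
  back.\<close>

lemma translation_conj:
  assumes "translation \<phi>" and "\<And>F G. r (F + G) = r F + r G" "\<And>F G. r (F * G) = r F * r G" "r 1 = 1"
    and r: "\<And>F. r (r F) = F"
  shows "translation (\<lambda>t F. r (\<phi> t (r F)))"
proof -
  interpret translation \<phi> by fact
  have r0: "r 0 = 0"
    using assms(2)[of 0 0] by simp
  have r_of_nat: "r (of_nat n) = of_nat n" for n
    by (induction n) (simp_all add: assms(2,4) r0)
  have r_minus: "r (F - G) = r F - r G" for F G
    using assms(2)[of "F - G" G] by simp
  have r_of_int: "r (of_int c) = of_int c" for c
    by (cases c rule: int_diff_cases) (simp add: r_minus r_of_nat)
  show ?thesis
  proof
    fix F
    obtain p where p: "\<And>t. \<phi> t (r F) = poly p (of_int t)"
      using polynomial by blast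
    \<comment> \<open>\<open>r\<close> fixes the integers, so it acts on the coefficients
      only.\<close>
    have "r (poly p (of_int t)) = poly (map_poly r p) (of_int t)" for t
      by (induction p) (simp_all add: r0 map_poly_pCons assms(2,3) r_of_int)
    then show "\<exists>p. \<forall>t. r (\<phi> t (r F)) = poly p (of_int t)"
      using p by auto
    assume "\<And>t. r (\<phi> t (r F)) = F"
    then have "\<phi> t (r F) = r F" for t
      using r by metis
    then obtain c where "r F = of_int c"
      using invariant_const by blast
    then show "\<exists>c. F = of_int c"
      using r r_of_int by metis
  qed (simp_all add: add mult one at_0 assms)
qed

text \<open>The new letter is the last one if \<open>tp\<close> holds, and it is of the inverse kind if \<open>w\<close> holds.\<close>

definition letter_op :: "bool \<Rightarrow> bool \<Rightarrow> int \<Rightarrow> qsym \<Rightarrow> qsym" where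
  "letter_op tp w t =
    (let \<phi> = if w then inv (cons_op (- t)) else cons_op t in if tp then rev_op \<circ> \<phi> \<circ> rev_op else \<phi>)"

lemma rev_op_rev_op: "rev_op (rev_op F) = F"
  by transfer simp

interpretation letter_op: translation "letter_op tp w" for tp w
proof -
  have *: "translation (\<lambda>t. if w then inv (cons_op (- t)) else cons_op t)"
    by (cases w) (simp_all add: cons_op.translation_axioms inv_cons_op.translation_axioms)
  have "translation (\<lambda>t F. rev_op ((if w then inv (cons_op (- t)) else cons_op t) (rev_op F)))"
    by (rule translation_conj[OF *]) (transfer, simp)+
  then have "translation (\<lambda>t. rev_op \<circ> (if w then inv (cons_op (- t)) else cons_op t) \<circ> rev_op)"
    by (simp add: comp_def)
  with * have "translation (\<lambda>t. letter_op tp w t)"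
    by (cases tp) (simp_all add: letter_op_def Let_def)
  then show "translation (letter_op tp w)" by simp
qed

lemma Rep_letter_op:
  "Rep_qsym (letter_op False False t F) X = Rep_qsym F (t # X)"
  "Rep_qsym (letter_op True False t F) X = Rep_qsym F (X @ [t])"
  by (simp_all add: letter_op_def cons_op.rep_eq rev_op.rep_eq)

text \<open>The sign in the inverse kind of \<open>letter_op\<close> is chosen such that both kinds
  produce \<open>+ of_int t * enum A\<close> in \<open>letter_op_enum_ext\<close>; the price is the
  change of sign here.\<close>

lemma letter_op_inverse: "letter_op tp (\<not> w) t (letter_op tp w (- t) F) = F"
proof -
  have "inv (cons_op (- t)) (cons_op (- t) F) = F" "cons_op t (inv (cons_op t) F) = F" for F
    using bij_cons_op by (auto simp: bij_is_inj bij_is_surj surj_f_inv_f)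
  then show ?thesis
    by (cases w; cases tp) (simp_all add: letter_op_def rev_op_rev_op)
qed

lemma commute_inverse:
  assumes "\<And>x. f (g x) = x" "\<And>x. g (f x) = x" "\<And>x. h (g x) = g (h x)"
  shows "h (f x) = f (h x)"
  by (metis assms)

text \<open>Insertions at opposite ends of a list commute, and what commutes with a bijection
  commutes with its inverse. This is the algebraic counterpart of interchanging construction steps
  at the top and at the bottom.\<close>

lemma letter_op_commute:
  "letter_op tp w s (letter_op (\<not> tp) w' t F) = letter_op (\<not> tp) w' t (letter_op tp w s F)"
proof -
  have inv: "letter_op tp True s (letter_op tp False (- s) F) = F"
    "letter_op tp False (- s) (letter_op tp True s F) = F" for tp s F
    using letter_op_inverse[of tp False s F] letter_op_inverse[of tp True "- s" F] by simp_all
  have base: "letter_op False False t (letter_op True False s F) =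
      letter_op True False s (letter_op False False t F)" for s t F
    by (rule qsym_eqI) (simp add: Rep_letter_op)
  have "letter_op False False t (letter_op True w s F) =
      letter_op True w s (letter_op False False t F)" for w s t F
  proof (cases w)
    case True
    then have w: "w = True" by simp
    show ?thesis
      unfolding w by (rule commute_inverse[where f = "letter_op True True s"
            and g = "letter_op True False (- s)" and h = "letter_op False False t",
          OF inv base])
  qed (simp add: base)
  then have top: "letter_op True w s (letter_op False False t F) =
      letter_op False False t (letter_op True w s F)" for w s t F
    by simp
  have "letter_op True w s (letter_op False w' t F) =
      letter_op False w' t (letter_op True w s F)" for w w' s t F
  proof (cases w')
    case True
    then have w: "w' = True" by simp
    show ?thesis
      unfolding w by (rule commute_inverse[where f = "letter_op False True t"
            and g = "letter_op False False (- t)" and h = "letter_op True w s",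
          OF inv top])
  qed (simp add: top)
  then show ?thesis
    by (cases tp) simp_all
qed

text \<open>The hypothesis is implicit, as the operator also acts on \<open>g\<close>. Taking it at
  \<open>- t\<close> and undoing the operator by the other kind frees \<open>g\<close>.\<close>

lemma letter_op_exchange:
  assumes "\<And>t. letter_op tp w t f = f + of_int t * letter_op tp w t g"
  shows "letter_op tp (\<not> w) t f = f + of_int t * g"
proof -
  have "f = letter_op tp (\<not> w) t (letter_op tp w (- t) f)"
    by (simp only: letter_op_inverse)
  also have "\<dots> = letter_op tp (\<not> w) t f - of_int t * g"
    by (subst assms)
      (simp add: letter_op.add letter_op.mult letter_op.of_int letter_op_inverse letter_op.diff)
  finally show ?thesis by (simp add: eq_diff_eq)
qed

text \<open>The same inversion backwards: an explicitly linear relation for one kind becomes an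
  implicit one for the other.\<close>

lemma letter_op_exchange':
  assumes "\<And>t. letter_op tp w t f = f + of_int t * g"
  shows "letter_op tp (\<not> w) t f = f + of_int t * letter_op tp (\<not> w) t g"
proof -
  have "f = letter_op tp (\<not> w) t (letter_op tp w (- t) f)"
    by (simp only: letter_op_inverse)
  also have "\<dots> = letter_op tp (\<not> w) t f - of_int t * letter_op tp (\<not> w) t g"
    by (subst assms) (simp add: letter_op.add letter_op.mult letter_op.of_int letter_op.diff)
  finally show ?thesis by (simp add: eq_diff_eq)
qed

section \<open>Enumerators of posets with strict and weak edges\<close>

definition edge_poset_ok :: "'a epos \<Rightarrow> bool" where
  "edge_poset_ok S \<longleftrightarrow> finite (elts S) \<and> partial_order_on (elts S) (leq S) \<and> strict S \<subseteq> leq S"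

definition empty_epos :: "'a epos" where
  "empty_epos = \<lparr>elts = {}, leq = {}, strict = {}\<rparr>"

text \<open>
  The flag \<open>tp\<close> tells whether the new element is placed at the top or at the bottom, the flag
  \<open>w\<close> whether the new edges are weak or strict.
\<close>

definition ext_epos :: "bool \<Rightarrow> bool \<Rightarrow> 'a \<Rightarrow> 'a epos \<Rightarrow> 'a epos" where
  "ext_epos tp w x A =
    (if tp then (if w then weak_sum A (one_epos x) else strict_sum A (one_epos x))
     else (if w then weak_sum (one_epos x) A else strict_sum (one_epos x) A))"

text \<open>With the empty poset as a starting point, \<open>[1]\<close> need not be treated separately.\<close>

inductive_set class_C0 :: "'a epos set" where
  empty: "empty_epos \<in> class_C0"
| union: "P \<in> class_C0 \<Longrightarrow> Q \<in> class_C0 \<Longrightarrow> elts P \<inter> elts Q = {} \<Longrightarrow> disj_union P Q \<in> class_C0"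
| ext: "A \<in> class_C0 \<Longrightarrow> x \<notin> elts A \<Longrightarrow> ext_epos tp w x A \<in> class_C0"

lemma elts_empty_epos [simp]: "elts empty_epos = {}"
  by (simp add: empty_epos_def)

lemma elts_ext_epos [simp]: "elts (ext_epos tp w x A) = insert x (elts A)"
  by (auto simp: ext_epos_def weak_sum_def strict_sum_def one_epos_def)

lemma elts_disj_union [simp]: "elts (disj_union P Q) = elts P \<union> elts Q"
  by (simp add: disj_union_def)

lemma leq_ext_epos:
  "leq (ext_epos tp w x A) =
    insert (x, x) (leq A) \<union> (if tp then elts A \<times> {x} else {x} \<times> elts A)"
  by (auto simp: ext_epos_def weak_sum_def strict_sum_def one_epos_def)

lemma strict_ext_epos:
  "strict (ext_epos tp w x A) =
    strict A \<union> (if w then {} else if tp then max_elts A \<times> {x} else {x} \<times> min_elts A)"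
proof -
  have "min_elts (one_epos x) = {x}" "max_elts (one_epos x) = {x}" "strict (one_epos x) = {}"
    by (auto simp: min_elts_def max_elts_def less_rel_def one_epos_def)
  then show ?thesis
    by (simp add: ext_epos_def weak_sum_def strict_sum_def)
qed

lemma class_C_edge_subset: "class_C_edge \<subseteq> class_C0"
proof
  fix S :: "'a epos"
  assume "S \<in> class_C_edge"
  then show "S \<in> class_C0"
  proof induction
    case (one x)
    have "one_epos x = ext_epos False True x empty_epos"
      by (simp add: one_epos_def ext_epos_def weak_sum_def empty_epos_def)
    then show ?case
      using class_C0.ext[OF class_C0.empty, of x] by simp
  next
    case (weak_below P x)
    then show ?case using class_C0.ext[of P x False True] by (simp add: ext_epos_def)
  next
    case (strict_below P x)
    then show ?case using class_C0.ext[of P x False False] by (simp add: ext_epos_def)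
  next
    case (weak_above P x)
    then show ?case using class_C0.ext[of P x True True] by (simp add: ext_epos_def)
  next
    case (strict_above P x)
    then show ?case using class_C0.ext[of P x True False] by (simp add: ext_epos_def)
  qed (rule class_C0.union)
qed

lemma edge_poset_ok_iff:
  "edge_poset_ok S \<longleftrightarrow> finite (elts S) \<and>
    (\<forall>a b. (a, b) \<in> leq S \<longrightarrow> a \<in> elts S \<and> b \<in> elts S) \<and> (\<forall>a\<in>elts S. (a, a) \<in> leq S) \<and>
    (\<forall>a b c. (a, b) \<in> leq S \<longrightarrow> (b, c) \<in> leq S \<longrightarrow> (a, c) \<in> leq S) \<and>
    (\<forall>a b. (a, b) \<in> leq S \<longrightarrow> (b, a) \<in> leq S \<longrightarrow> a = b) \<and> strict S \<subseteq> leq S"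
proof -
  have "leq S \<subseteq> elts S \<times> elts S \<longleftrightarrow> (\<forall>a b. (a, b) \<in> leq S \<longrightarrow> a \<in> elts S \<and> b \<in> elts S)"
    by auto
  then show ?thesis
    by (simp add: edge_poset_ok_def partial_order_on_def preorder_on_def refl_on_def trans_def
        antisym_def)
qed

lemma edge_poset_okD:
  assumes "edge_poset_ok S"
  shows "finite (elts S)" "(a, b) \<in> leq S \<Longrightarrow> a \<in> elts S \<and> b \<in> elts S"
    "a \<in> elts S \<Longrightarrow> (a, a) \<in> leq S" "(a, b) \<in> leq S \<Longrightarrow> (b, c) \<in> leq S \<Longrightarrow> (a, c) \<in> leq S"
    "(a, b) \<in> leq S \<Longrightarrow> (b, a) \<in> leq S \<Longrightarrow> a = b"
    "(a, b) \<in> strict S \<Longrightarrow> (a, b) \<in> leq S" "(a, b) \<in> strict S \<Longrightarrow> a \<in> elts S \<and> b \<in> elts S"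
  using assms unfolding edge_poset_ok_iff by blast+

lemma min_elts_subset: "min_elts S \<subseteq> elts S" and max_elts_subset: "max_elts S \<subseteq> elts S"
  by (auto simp: min_elts_def max_elts_def)

lemma leq_disj_union: "(a, b) \<in> leq (disj_union P Q) \<longleftrightarrow> (a, b) \<in> leq P \<or> (a, b) \<in> leq Q"
  and strict_disj_union: "strict (disj_union P Q) = strict P \<union> strict Q"
  by (simp_all add: disj_union_def)

lemma edge_poset_ok_disj_union:
  assumes "edge_poset_ok P" "edge_poset_ok Q" and disj: "elts P \<inter> elts Q = {}"
  shows "edge_poset_ok (disj_union P Q)"
proof -
  note P = edge_poset_okD[OF assms(1)] and Q = edge_poset_okD[OF assms(2)]
  have no: "(a, b) \<in> leq P \<Longrightarrow> (c, d) \<in> leq Q \<Longrightarrow> a \<noteq> c \<and> a \<noteq> d \<and> b \<noteq> c \<and> b \<noteq> d" for a b c d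
    using P(2) Q(2) disj by blast
  show ?thesis
    unfolding edge_poset_ok_iff
  proof (intro conjI allI ballI impI)
    show "(a, c) \<in> leq (disj_union P Q)"
      if "(a, b) \<in> leq (disj_union P Q)" "(b, c) \<in> leq (disj_union P Q)" for a b c
      using that P(4)[of a b c] Q(4)[of a b c] no[of a b b c] no[of b c a b]
      unfolding leq_disj_union by blast
    show "a = b" if "(a, b) \<in> leq (disj_union P Q)" "(b, a) \<in> leq (disj_union P Q)" for a b
      using that P(5)[of a b] Q(5)[of a b] no[of a b b a] no[of b a a b]
      unfolding leq_disj_union by blast
  qed (use P(1-3,6) Q(1-3,6) in \<open>auto simp: leq_disj_union strict_disj_union\<close>)
qed

lemma edge_poset_ok_ext:
  assumes "edge_poset_ok A" and x: "x \<notin> elts A"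
  shows "edge_poset_ok (ext_epos tp w x A)"
proof -
  note A = edge_poset_okD[OF assms(1)]
  have iff: "(a, b) \<in> leq (ext_epos tp w x A) \<longleftrightarrow> (a, b) \<in> leq A \<or> a = x \<and> b = x \<or>
      (if tp then a \<in> elts A \<and> b = x else a = x \<and> b \<in> elts A)" for a b
    by (auto simp: leq_ext_epos)
  have nox: "(a, b) \<in> leq A \<Longrightarrow> a \<noteq> x \<and> b \<noteq> x" for a b
    using A(2) x by blast
  show ?thesis
    unfolding edge_poset_ok_iff
  proof (intro conjI allI ballI impI)
    show "(a, c) \<in> leq (ext_epos tp w x A)"
      if "(a, b) \<in> leq (ext_epos tp w x A)" "(b, c) \<in> leq (ext_epos tp w x A)" for a b c
      using that A(2)[of a b] A(2)[of b c] A(4)[of a b c] nox[of a b] nox[of b c] x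
      unfolding iff by (cases tp) auto
    show "a = b" if "(a, b) \<in> leq (ext_epos tp w x A)" "(b, a) \<in> leq (ext_epos tp w x A)" for a b
      using that A(5)[of a b] nox[of a b] nox[of b a] x unfolding iff by (cases tp) auto
    show "strict (ext_epos tp w x A) \<subseteq> leq (ext_epos tp w x A)"
      using A(6) min_elts_subset[of A] max_elts_subset[of A]
      by (auto simp: strict_ext_epos leq_ext_epos)
  qed (use A(1-3) in \<open>auto simp: iff split: if_splits\<close>)
qed

lemma class_C0_ok: "S \<in> class_C0 \<Longrightarrow> edge_poset_ok S"
proof (induction rule: class_C0.induct)
  case empty
  show ?case
    by (simp add: edge_poset_ok_iff empty_epos_def)
qed (auto intro: edge_poset_ok_disj_union edge_poset_ok_ext)

text \<open>Among the elements below \<open>a\<close>, one with the smallest down-set is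
  minimal.\<close>

lemma finite_partial_order_min_below:
  assumes "finite A" "partial_order_on A r" "a \<in> A"
  shows "\<exists>m\<in>A. (m, a) \<in> r \<and> (\<forall>b. (b, m) \<in> r \<longrightarrow> b = m)"
proof -
  have r: "r \<subseteq> A \<times> A" "\<And>x. x \<in> A \<Longrightarrow> (x, x) \<in> r" "trans r" "antisym r"
    using assms(2) by (auto simp: partial_order_on_def preorder_on_def refl_on_def)
  let ?d = "\<lambda>b. card {c. (c, b) \<in> r}"
  obtain m where m: "(m, a) \<in> r" and least: "\<And>b. (b, a) \<in> r \<Longrightarrow> ?d m \<le> ?d b"
    using ex_has_least_nat[of "\<lambda>b. (b, a) \<in> r" a ?d] r(2) assms(3) by blast
  have "b = m" if b: "(b, m) \<in> r" for b
  proof (rule ccontr)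
    assume "b \<noteq> m"
    then have "(m, b) \<notin> r"
      using b r(4) by (auto dest: antisymD)
    moreover have "(m, m) \<in> r"
      using m r(1,2) by auto
    moreover have "{c. (c, b) \<in> r} \<subseteq> {c. (c, m) \<in> r}"
      using b r(3) by (auto dest: transD)
    ultimately have "{c. (c, b) \<in> r} \<subset> {c. (c, m) \<in> r}"
      by auto
    moreover have "finite {c. (c, m) \<in> r}"
      by (rule finite_subset[OF _ assms(1)]) (use r(1) in auto)
    ultimately have "?d b < ?d m"
      by (intro psubset_card_mono)
    then show False
      using least[of b] b m r(3) by (meson leD transD)
  qed
  then show ?thesis
    using m r(1) by blast
qed

lemma min_elts_below:
  assumes "edge_poset_ok S" "a \<in> elts S"
  shows "\<exists>m\<in>min_elts S. (m, a) \<in> leq S"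
  using finite_partial_order_min_below[of "elts S" "leq S" a] assms
  by (auto simp: edge_poset_ok_def min_elts_def less_rel_def)

lemma max_elts_above:
  assumes "edge_poset_ok S" "a \<in> elts S"
  shows "\<exists>m\<in>max_elts S. (a, m) \<in> leq S"
proof -
  have "\<exists>m\<in>elts S. (m, a) \<in> (leq S)\<inverse> \<and> (\<forall>b. (b, m) \<in> (leq S)\<inverse> \<longrightarrow> b = m)"
    using assms by (intro finite_partial_order_min_below) (simp_all add: edge_poset_ok_def)
  then show ?thesis
    by (fastforce simp: max_elts_def less_rel_def)
qed

section \<open>Partitions for marked edges\<close>

text \<open>The set \<open>J\<close> of values is a parameter: it consists of positions in a list or
  of indices of variables, and it shrinks when an extreme letter is removed.\<close>

definition edge_partitions :: "'a epos \<Rightarrow> nat set \<Rightarrow> ('a \<Rightarrow> nat) set" where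
  "edge_partitions S J = {f \<in> elts S \<rightarrow>\<^sub>E J.
    (\<forall>(a, b)\<in>leq S. f a \<le> f b) \<and> (\<forall>(a, b)\<in>strict S. f a < f b)}"

lemma edge_partitionsI:
  "f \<in> extensional (elts S) \<Longrightarrow> (\<And>a. a \<in> elts S \<Longrightarrow> f a \<in> J) \<Longrightarrow>
    (\<And>a b. (a, b) \<in> leq S \<Longrightarrow> f a \<le> f b) \<Longrightarrow> (\<And>a b. (a, b) \<in> strict S \<Longrightarrow> f a < f b) \<Longrightarrow>
    f \<in> edge_partitions S J"
  by (auto simp: edge_partitions_def PiE_def)

lemma edge_partitionsD:
  assumes "f \<in> edge_partitions S J"
  shows "f \<in> extensional (elts S)" "a \<in> elts S \<Longrightarrow> f a \<in> J" "(a, b) \<in> leq S \<Longrightarrow> f a \<le> f b"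
    "(a, b) \<in> strict S \<Longrightarrow> f a < f b"
  using assms by (auto simp: edge_partitions_def PiE_def)

definition enum_on :: "'a epos \<Rightarrow> (nat \<Rightarrow> int) \<Rightarrow> nat set \<Rightarrow> int" where
  "enum_on S v J = (\<Sum>f\<in>edge_partitions S J. \<Prod>a\<in>elts S. v (f a))"

lemma finite_edge_partitions: "finite (elts S) \<Longrightarrow> finite J \<Longrightarrow> finite (edge_partitions S J)"
  unfolding edge_partitions_def by (rule finite_subset[of _ "elts S \<rightarrow>\<^sub>E J"]) (auto intro: finite_PiE)

lemma enum_on_cong:
  assumes "\<And>j. j \<in> J \<Longrightarrow> v j = v' j"
  shows "enum_on S v J = enum_on S v' J"
  unfolding enum_on_def by (intro sum.cong prod.cong refl assms) (auto simp: edge_partitions_def)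

text \<open>Partitions only compare values. The case \<open>h = Suc\<close> shifts positions when
  the first letter is split off, and translates between positions from 0 and variables from
  1.\<close>

lemma enum_on_image:
  assumes S: "edge_poset_ok S" and h: "strict_mono h"
  shows "enum_on S v (h ` J) = enum_on S (v \<circ> h) J"
proof -
  have h': "h (inv h j) = j" if "j \<in> h ` J" for j
    using that by (auto simp: f_inv_into_f)
  have inv: "inv h (h j) = j" for j
    using h by (simp add: strict_mono_eq inj_on_def strict_mono_imp_inj_on)
  have ok: "\<And>a b. (a, b) \<in> leq S \<Longrightarrow> a \<in> elts S \<and> b \<in> elts S"
    "\<And>a b. (a, b) \<in> strict S \<Longrightarrow> a \<in> elts S \<and> b \<in> elts S"
    using edge_poset_okD[OF S] by blast+
  have mono: "inv h i \<le> inv h j \<longleftrightarrow> i \<le> j" "inv h i < inv h j \<longleftrightarrow> i < j"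
    if "i \<in> h ` J" "j \<in> h ` J" for i j
    using that h by (auto simp: inv strict_mono_less strict_mono_less_eq)
  show ?thesis
    unfolding enum_on_def
  proof (rule sum.reindex_bij_witness[of _ "\<lambda>f. \<lambda>a\<in>elts S. h (f a)" "\<lambda>f. \<lambda>a\<in>elts S. inv h (f a)"])
    fix f assume f: "f \<in> edge_partitions S (h ` J)"
    then have fJ: "f a \<in> h ` J" if "a \<in> elts S" for a
      using that by (auto simp: edge_partitions_def PiE_def)
    show "(\<lambda>a\<in>elts S. h ((\<lambda>a\<in>elts S. inv h (f a)) a)) = f"
    proof
      fix a show "(\<lambda>a\<in>elts S. h ((\<lambda>a\<in>elts S. inv h (f a)) a)) a = f a"
        using f fJ[of a] h' by (auto simp: edge_partitions_def PiE_def extensional_def)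
    qed
    show "(\<lambda>a\<in>elts S. inv h (f a)) \<in> edge_partitions S J"
    proof -
      have "inv h (f a) \<in> J" if "a \<in> elts S" for a
        using fJ[OF that] inv by auto
      moreover have "inv h (f a) \<le> inv h (f b)" if "(a, b) \<in> leq S" for a b
        using f ok(1)[OF that] fJ that by (auto simp: edge_partitions_def mono)
      moreover have "inv h (f a) < inv h (f b)" if "(a, b) \<in> strict S" for a b
        using f ok(2)[OF that] fJ that by (auto simp: edge_partitions_def mono)
      ultimately show ?thesis
        using ok by (auto simp: edge_partitions_def)
    qed
    show "(\<Prod>a\<in>elts S. (v \<circ> h) ((\<lambda>a\<in>elts S. inv h (f a)) a)) = (\<Prod>a\<in>elts S. v (f a))"
      by (rule prod.cong) (use fJ h' in auto)
  next
    fix f assume f: "f \<in> edge_partitions S J"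
    show "(\<lambda>a\<in>elts S. inv h ((\<lambda>a\<in>elts S. h (f a)) a)) = f"
    proof
      fix a show "(\<lambda>a\<in>elts S. inv h ((\<lambda>a\<in>elts S. h (f a)) a)) a = f a"
        using f inv by (auto simp: edge_partitions_def PiE_def extensional_def)
    qed
    show "(\<lambda>a\<in>elts S. h (f a)) \<in> edge_partitions S (h ` J)"
      by (rule edge_partitionsI)
        (use ok edge_partitionsD[OF f] h in \<open>auto simp: strict_mono_less strict_mono_less_eq\<close>)
  qed
qed

lemma enum_on_empty_epos: "enum_on (empty_epos :: 'a epos) v J = 1"
proof -
  have "edge_partitions (empty_epos :: 'a epos) J = {\<lambda>_. undefined}"
    by (auto simp: edge_partitions_def empty_epos_def)
  then show ?thesis
    unfolding enum_on_def by simp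
qed

lemma enum_on_disj_union:
  assumes P: "edge_poset_ok P" and Q: "edge_poset_ok Q" and disj: "elts P \<inter> elts Q = {}"
  shows "enum_on (disj_union P Q) v J = enum_on P v J * enum_on Q v J"
proof -
  have okP: "\<And>a b. (a, b) \<in> leq P \<Longrightarrow> a \<in> elts P \<and> b \<in> elts P"
    "\<And>a b. (a, b) \<in> strict P \<Longrightarrow> a \<in> elts P \<and> b \<in> elts P"
    using edge_poset_okD[OF P] by blast+
  have okQ: "\<And>a b. (a, b) \<in> leq Q \<Longrightarrow> a \<in> elts Q \<and> b \<in> elts Q"
    "\<And>a b. (a, b) \<in> strict Q \<Longrightarrow> a \<in> elts Q \<and> b \<in> elts Q"
    using edge_poset_okD[OF Q] by blast+
  have fin: "finite (elts P)" "finite (elts Q)"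
    using P Q by (auto simp: edge_poset_ok_def)
  let ?glue = "\<lambda>(f, g) a. if a \<in> elts P then f a else g a"
  have "enum_on (disj_union P Q) v J = (\<Sum>(f, g)\<in>edge_partitions P J \<times> edge_partitions Q J.
      (\<Prod>a\<in>elts P. v (f a)) * (\<Prod>a\<in>elts Q. v (g a)))"
    unfolding enum_on_def
  proof (rule sum.reindex_bij_witness[of _ ?glue "\<lambda>f. (restrict f (elts P), restrict f (elts Q))"])
    fix f assume f: "f \<in> edge_partitions (disj_union P Q) J"
    note f' = edge_partitionsD[OF f]
    show "?glue (restrict f (elts P), restrict f (elts Q)) = f"
      using f'(1) by (auto simp: extensional_def fun_eq_iff)
    have "restrict f (elts P) \<in> edge_partitions P J"
      by (rule edge_partitionsI) (use okP f' in \<open>auto simp: leq_disj_union strict_disj_union\<close>)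
    moreover have "restrict f (elts Q) \<in> edge_partitions Q J"
      by (rule edge_partitionsI) (use okQ f' in \<open>auto simp: leq_disj_union strict_disj_union\<close>)
    ultimately show "(restrict f (elts P), restrict f (elts Q)) \<in> edge_partitions P J \<times> edge_partitions Q J"
      by simp
    show "(case (restrict f (elts P), restrict f (elts Q)) of (f, g) \<Rightarrow>
        (\<Prod>a\<in>elts P. v (f a)) * (\<Prod>a\<in>elts Q. v (g a))) = (\<Prod>a\<in>elts (disj_union P Q). v (f a))"
      using fin disj by (simp add: prod.union_disjoint)
  next
    fix p assume p: "p \<in> edge_partitions P J \<times> edge_partitions Q J"
    then obtain f g where fg: "p = (f, g)" "f \<in> edge_partitions P J" "g \<in> edge_partitions Q J"
      by auto
    have notin: "a \<notin> elts P" if "a \<in> elts Q" for a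
      using that disj by auto
    note f = edge_partitionsD[OF fg(2)] and g = edge_partitionsD[OF fg(3)]
    have "restrict (?glue p) (elts P) = f"
      using f(1) by (auto simp: extensional_def fun_eq_iff fg(1))
    moreover have "restrict (?glue p) (elts Q) = g"
      using g(1) notin by (auto simp: extensional_def fun_eq_iff fg(1))
    ultimately show "(restrict (?glue p) (elts P), restrict (?glue p) (elts Q)) = p"
      using fg(1) by simp
    show "?glue p \<in> edge_partitions (disj_union P Q) J"
    proof (rule edge_partitionsI)
      show "?glue p \<in> extensional (elts (disj_union P Q))"
        using f(1) g(1) by (auto simp: extensional_def fg(1))
      show "?glue p a \<in> J" if "a \<in> elts (disj_union P Q)" for a
        using that f(2) g(2) by (auto simp: fg(1))
      show "?glue p a \<le> ?glue p b" if "(a, b) \<in> leq (disj_union P Q)" for a b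
        using that f(3) g(3) okP(1)[of a b] okQ(1)[of a b] notin
        by (auto simp: fg(1) leq_disj_union)
      show "?glue p a < ?glue p b" if "(a, b) \<in> strict (disj_union P Q)" for a b
        using that f(4) g(4) okP(2)[of a b] okQ(2)[of a b] notin
        by (auto simp: fg(1) strict_disj_union)
    qed
  qed
  also have "\<dots> = enum_on P v J * enum_on Q v J"
    by (simp add: enum_on_def sum_product sum.cartesian_product)
  finally show ?thesis .
qed

text \<open>\<open>i\<close> stands for the value of the new element and \<open>j\<close> for that
  of an old one.\<close>

definition on_side :: "bool \<Rightarrow> bool \<Rightarrow> nat \<Rightarrow> nat \<Rightarrow> bool" where
  "on_side tp w i j \<longleftrightarrow> (if tp then j \<le> i else i \<le> j) \<and> (w \<or> i \<noteq> j)"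

text \<open>A strict sum adds strict edges only at the maximal or minimal elements of
  \<open>A\<close>. Every element of \<open>A\<close> lies below or above one of these, so
  monotonicity spreads the strict inequality to all of \<open>A\<close>.\<close>

lemma edge_partitions_ext_iff:
  assumes A: "edge_poset_ok A" and x: "x \<notin> elts A"
  shows "f \<in> edge_partitions (ext_epos tp w x A) J \<longleftrightarrow>
    f \<in> extensional (insert x (elts A)) \<and> f x \<in> J \<and> restrict f (elts A) \<in> edge_partitions A J \<and>
    (\<forall>a\<in>elts A. on_side tp w (f x) (f a))" (is "?l \<longleftrightarrow> ?r")
proof
  note ok = edge_poset_okD[OF A]
  assume ?l
  note f = edge_partitionsD[OF this]
  have leq: "f a \<le> f b" if "(a, b) \<in> leq A" for a b
    using f(3)[of a b] that by (simp add: leq_ext_epos)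
  have "restrict f (elts A) \<in> edge_partitions A J"
  proof (rule edge_partitionsI)
    show "restrict f (elts A) a \<le> restrict f (elts A) b" if "(a, b) \<in> leq A" for a b
      using leq[OF that] ok(2)[OF that] by simp
    show "restrict f (elts A) a < restrict f (elts A) b" if "(a, b) \<in> strict A" for a b
      using f(4)[of a b] that ok(7)[OF that] by (simp add: strict_ext_epos)
  qed (use f(2) in auto)
  moreover have "on_side tp w (f x) (f a)" if a: "a \<in> elts A" for a
  proof (cases tp)
    case True
    obtain b where b: "b \<in> max_elts A" "(a, b) \<in> leq A"
      using max_elts_above[OF A a] by blast
    have "f a \<le> f x"
      using f(3)[of a x] a True by (simp add: leq_ext_epos)
    moreover have "f b < f x" if "\<not> w"
      using f(4)[of b x] b(1) True that by (simp add: strict_ext_epos)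
    ultimately show ?thesis
      using leq[OF b(2)] True by (auto simp: on_side_def)
  next
    case False
    obtain b where b: "b \<in> min_elts A" "(b, a) \<in> leq A"
      using min_elts_below[OF A a] by blast
    have "f x \<le> f a"
      using f(3)[of x a] a False by (simp add: leq_ext_epos)
    moreover have "f x < f b" if "\<not> w"
      using f(4)[of x b] b(1) False that by (simp add: strict_ext_epos)
    ultimately show ?thesis
      using leq[OF b(2)] False by (auto simp: on_side_def)
  qed
  ultimately show ?r
    using f(1,2) by simp
next
  note ok = edge_poset_okD[OF A]
  assume r: ?r
  note f = edge_partitionsD[of "restrict f (elts A)" A J]
  have side: "if tp then f a \<le> f x else f x \<le> f a" "\<not> w \<Longrightarrow> f a \<noteq> f x" if "a \<in> elts A" for a
    using r that by (auto simp: on_side_def)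
  show ?l
  proof (rule edge_partitionsI)
    show "f a \<in> J" if "a \<in> elts (ext_epos tp w x A)" for a
      using that r f(2)[of a] by auto
    show "f a \<le> f b" if "(a, b) \<in> leq (ext_epos tp w x A)" for a b
      using that r f(3)[of a b] ok(2)[of a b] side(1)[of a] side(1)[of b]
      by (auto simp: leq_ext_epos split: if_splits)
    show "f a < f b" if ab: "(a, b) \<in> strict (ext_epos tp w x A)" for a b
    proof (cases "(a, b) \<in> strict A")
      case True
      then show ?thesis using r f(4)[of a b] ok(7)[OF True] by simp
    next
      case False
      then show ?thesis
        using ab side[of a] side[of b] min_elts_subset[of A] max_elts_subset[of A]
        by (fastforce simp: strict_ext_epos split: if_splits)
    qed
  qed (use r in auto)
qed

text \<open>\<open>m\<close> is the extreme value on the side of \<open>x\<close>. If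
  \<open>x\<close> takes it, the rest is a partition of \<open>A\<close>, avoiding \<open>m\<close>
  in the strict case; otherwise no element takes it, because \<open>f x\<close> separates
  \<open>m\<close> from the other values.\<close>

lemma enum_on_ext:
  assumes A: "edge_poset_ok A" and x: "x \<notin> elts A" and J: "finite J" "m \<in> J"
    and m: "\<And>j. j \<in> J \<Longrightarrow> on_side tp True m j"
  shows "enum_on (ext_epos tp w x A) v J =
    v m * enum_on A v (if w then J else J - {m}) + enum_on (ext_epos tp w x A) v (J - {m})"
proof -
  let ?S = "ext_epos tp w x A"
  let ?J = "if w then J else J - {m}"
  have fin: "finite (elts A)" "finite (edge_partitions ?S J)"
    using A J by (auto simp: edge_poset_ok_def intro!: finite_edge_partitions)
  have "edge_partitions ?S J =
      {f \<in> edge_partitions ?S J. f x = m} \<union> edge_partitions ?S (J - {m})"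
  proof (intro equalityI subsetI)
    fix f assume f: "f \<in> edge_partitions ?S J"
    show "f \<in> {f \<in> edge_partitions ?S J. f x = m} \<union> edge_partitions ?S (J - {m})"
    proof (cases "f x = m")
      case False
      have fJ: "f x \<in> J" "\<And>a. a \<in> elts A \<Longrightarrow> on_side tp w (f x) (f a)"
        using f unfolding edge_partitions_ext_iff[OF A x] by auto
      have "f a \<noteq> m" if "a \<in> elts A" for a
        using fJ(2)[OF that] m[OF fJ(1)] False by (auto simp: on_side_def split: if_splits)
      then have "f \<in> edge_partitions ?S (J - {m})"
        using f False by (auto simp: edge_partitions_def)
      then show ?thesis by simp
    qed (use f in simp)
  qed (auto simp: edge_partitions_def)
  moreover have "{f \<in> edge_partitions ?S J. f x = m} \<inter> edge_partitions ?S (J - {m}) = {}"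
    by (auto simp: edge_partitions_def)
  ultimately have "enum_on ?S v J =
      (\<Sum>f\<in>{f \<in> edge_partitions ?S J. f x = m}. \<Prod>a\<in>elts ?S. v (f a)) + enum_on ?S v (J - {m})"
    unfolding enum_on_def using fin J
    by (metis (no_types, lifting) finite_Un sum.union_disjoint)
  also have "(\<Sum>f\<in>{f \<in> edge_partitions ?S J. f x = m}. \<Prod>a\<in>elts ?S. v (f a)) =
      (\<Sum>f\<in>edge_partitions A ?J. v m * (\<Prod>a\<in>elts A. v (f a)))"
  proof (rule sum.reindex_bij_witness[of _ "\<lambda>f. f(x := m)" "\<lambda>f. restrict f (elts A)"])
    fix f assume "f \<in> {f \<in> edge_partitions ?S J. f x = m}"
    then have f: "f \<in> extensional (insert x (elts A))" "f x = m"
      "restrict f (elts A) \<in> edge_partitions A J" "\<And>a. a \<in> elts A \<Longrightarrow> on_side tp w m (f a)"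
      unfolding mem_Collect_eq edge_partitions_ext_iff[OF A x] by auto
    show "(restrict f (elts A))(x := m) = f"
      using f(1,2) by (auto simp: extensional_def fun_eq_iff)
    show "restrict f (elts A) \<in> edge_partitions A ?J"
      using f(3,4) by (cases w) (auto simp: edge_partitions_def on_side_def)
    show "v m * (\<Prod>a\<in>elts A. v (restrict f (elts A) a)) = (\<Prod>a\<in>elts ?S. v (f a))"
      using fin(1) x f(2) by simp
  next
    fix f assume f: "f \<in> edge_partitions A ?J"
    then have ext: "f \<in> extensional (elts A)" and fJ: "\<And>a. a \<in> elts A \<Longrightarrow> f a \<in> ?J"
      by (auto simp: edge_partitions_def PiE_def)
    show r: "restrict (f(x := m)) (elts A) = f"
      using ext x by (auto simp: extensional_def fun_eq_iff)
    have "f \<in> edge_partitions A J"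
      using f by (cases w) (auto simp: edge_partitions_def)
    moreover have "on_side tp w m (f a)" if "a \<in> elts A" for a
      using fJ[OF that] m[of "f a"] by (cases w) (auto simp: on_side_def)
    ultimately have "f(x := m) \<in> edge_partitions ?S J"
      unfolding edge_partitions_ext_iff[OF A x] r using ext J(2) x by (auto simp: extensional_def)
    then show "f(x := m) \<in> {f \<in> edge_partitions ?S J. f x = m}"
      by simp
  qed
  finally show ?thesis
    by (simp add: enum_on_def sum_distrib_left)
qed

section \<open>Recursion of the enumerator in an extreme letter\<close>

text \<open>The values are positions counted from 0, whereas the variables of \<open>K_enum\<close>
  are counted from 1.\<close>

definition enum_list :: "'a epos \<Rightarrow> int list \<Rightarrow> int" where
  "enum_list S X = enum_on S (\<lambda>i. X ! i) {..<length X}"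

lemma enum_list_Cons: "edge_poset_ok S \<Longrightarrow> enum_on S (\<lambda>i. (t # X) ! i) {1..length X} = enum_list S X"
  using enum_on_image[of S Suc "\<lambda>i. (t # X) ! i" "{..<length X}"]
  by (simp add: enum_list_def comp_def strict_mono_Suc_iff image_Suc_lessThan)

lemma enum_list_snoc: "enum_on S (\<lambda>i. (X @ [t]) ! i) {..<length X} = enum_list S X"
  unfolding enum_list_def by (rule enum_on_cong) (simp add: nth_append)

lemma enum_list_ext_Cons:
  assumes "A \<in> class_C0" "x \<notin> elts A"
  shows "enum_list (ext_epos False w x A) (t # X) =
    enum_list (ext_epos False w x A) X + t * (if w then enum_list A (t # X) else enum_list A X)"
proof -
  note ok = class_C0_ok[OF assms(1)] class_C0_ok[OF class_C0.ext[OF assms]]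
  let ?v = "\<lambda>i. (t # X) ! i" and ?J = "{..<length (t # X)}"
  have J: "?J - {0} = {1..length X}" by auto
  have "enum_list (ext_epos False w x A) (t # X) =
      ?v 0 * enum_on A ?v (if w then ?J else ?J - {0}) + enum_on (ext_epos False w x A) ?v (?J - {0})"
    unfolding enum_list_def by (rule enum_on_ext[OF ok(1) assms(2)]) (auto simp: on_side_def)
  then show ?thesis
    unfolding J enum_list_Cons[OF ok(2)]
    by (cases w)
      (simp_all only: if_True if_False enum_list_Cons[OF ok(1)] enum_list_def nth_Cons_0 add.commute)
qed

lemma enum_list_ext_snoc:
  assumes "A \<in> class_C0" "x \<notin> elts A"
  shows "enum_list (ext_epos True w x A) (X @ [t]) =
    enum_list (ext_epos True w x A) X + t * (if w then enum_list A (X @ [t]) else enum_list A X)"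
proof -
  note ok = class_C0_ok[OF assms(1)]
  let ?v = "\<lambda>i. (X @ [t]) ! i" and ?J = "{..<length (X @ [t])}"
  have J: "?J - {length X} = {..<length X}" by auto
  have "enum_list (ext_epos True w x A) (X @ [t]) = ?v (length X) *
      enum_on A ?v (if w then ?J else ?J - {length X}) + enum_on (ext_epos True w x A) ?v (?J - {length X})"
    unfolding enum_list_def by (rule enum_on_ext[OF ok assms(2)]) (auto simp: on_side_def)
  then show ?thesis
    unfolding J enum_list_snoc nth_append_length
    by (cases w) (simp_all only: if_True if_False enum_list_snoc enum_list_def[symmetric] add.commute)
qed

lemma qsym_fun_ConsI:
  assumes "qsym_fun G" "\<And>t X. F (t # X) = F X + t * (if w then G (t # X) else G X)"
  shows "qsym_fun F"
proof (cases w)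
  case True
  obtain n H where H: "\<And>j. qsym_fun (H j)" "\<And>t X. G (t # X) = (\<Sum>j\<le>n. t ^ j * H j X)"
    by (rule qsym_fun_expand[OF assms(1)]) blast
  \<comment> \<open>The factor \<open>t\<close> raises every exponent by one, so only positive
    exponents arise in the weak case too.\<close>
  have "t * (\<Sum>j\<le>n. t ^ j * H j X) = (\<Sum>j=1..Suc n. t ^ j * H (j - 1) X)" for t X
    unfolding sum_distrib_left
    by (rule sum.reindex_bij_witness[of _ "\<lambda>j. j - 1" Suc]) auto
  then have "F (t # X) = F X + (\<Sum>j=1..Suc n. t ^ j * H (j - 1) X)" for t X
    by (simp only: assms(2) True if_True H(2))
  then show ?thesis
    using H(1) by (rule qsym_funI[rotated])
next
  case False
  have "F (t # X) = F X + (\<Sum>j=1..1. t ^ j * G X)" for t X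
    using assms(2) False by simp
  then show ?thesis
    using assms(1) by (rule qsym_funI[rotated])
qed

lemma qsym_fun_enum_list: "S \<in> class_C0 \<Longrightarrow> qsym_fun (enum_list S)"
proof (induction rule: class_C0.induct)
  case empty
  have "enum_list (empty_epos :: 'a epos) = (\<lambda>_. 1)"
    by (simp add: enum_list_def enum_on_empty_epos fun_eq_iff)
  then show ?case
    using qsym_fun_const by simp
next
  case (union P Q)
  have "enum_list (disj_union P Q) = (\<lambda>X. enum_list P X * enum_list Q X)"
    using enum_on_disj_union[OF class_C0_ok[OF union.hyps(1)] class_C0_ok[OF union.hyps(2)]
        union.hyps(3)]
    by (simp add: enum_list_def fun_eq_iff)
  then show ?case
    using qsym_fun_mult union.IH by simp
next
  case (ext A x tp w)
  show ?case
  proof (cases tp)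
    case True
    \<comment> \<open>A new greatest element gives a recursion in the last letter, which is the
      first letter of the reversed alphabet.\<close>
    have "qsym_fun (\<lambda>X. enum_list (ext_epos True w x A) (rev X))"
      by (rule qsym_fun_ConsI[OF qsym_fun_rev[OF ext.IH], of _ w])
        (simp add: enum_list_ext_snoc[OF ext.hyps])
    from qsym_fun_rev[OF this] show ?thesis
      using True by simp
  next
    case False
    then show ?thesis
      using qsym_fun_ConsI[OF ext.IH enum_list_ext_Cons[OF ext.hyps]] by simp
  qed
qed

definition enum :: "'a epos \<Rightarrow> qsym" where
  "enum S = Abs_qsym (enum_list S)"

lemma Rep_enum: "S \<in> class_C0 \<Longrightarrow> Rep_qsym (enum S) = enum_list S"
  by (simp add: enum_def Abs_qsym_inverse qsym_fun_enum_list)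

lemma enum_empty: "enum empty_epos = 1"
  by (rule qsym_eqI)
    (simp add: Rep_enum class_C0.empty enum_list_def enum_on_empty_epos one_qsym.rep_eq)

lemma enum_disj_union:
  "P \<in> class_C0 \<Longrightarrow> Q \<in> class_C0 \<Longrightarrow> elts P \<inter> elts Q = {} \<Longrightarrow>
    enum (disj_union P Q) = enum P * enum Q"
  by (rule qsym_eqI)
    (simp add: Rep_enum class_C0.union enum_list_def enum_on_disj_union class_C0_ok times_qsym.rep_eq)

lemma letter_op_False_enum_ext:
  assumes "A \<in> class_C0" "x \<notin> elts A"
  shows "letter_op tp False t (enum (ext_epos tp w x A)) =
    enum (ext_epos tp w x A) + of_int t * (if w then letter_op tp False t (enum A) else enum A)"
  by (rule qsym_eqI, cases tp)
    (simp_all add: Rep_letter_op Rep_enum assms class_C0.ext plus_qsym.rep_eq times_qsym.rep_eq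
      Rep_qsym_of_int enum_list_ext_snoc enum_list_ext_Cons)

text \<open>For strict edges this is the recursion in the extreme letter itself. For weak edges that
  recursion involves \<open>A\<close> on the enlarged alphabet, and
  \<open>letter_op_exchange\<close> brings it into this form.\<close>

lemma letter_op_enum_ext:
  assumes "A \<in> class_C0" "x \<notin> elts A"
  shows "letter_op tp w t (enum (ext_epos tp w x A)) = enum (ext_epos tp w x A) + of_int t * enum A"
  using letter_op_False_enum_ext[OF assms]
    letter_op_exchange[of tp False "enum (ext_epos tp True x A)" "enum A"]
  by (cases w) simp_all

lemma letter_op_Not_enum_ext:
  assumes "A \<in> class_C0" "x \<notin> elts A"
  shows "letter_op tp (\<not> w) t (enum (ext_epos tp w x A)) =
    enum (ext_epos tp w x A) + of_int t * letter_op tp (\<not> w) t (enum A)"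
  using letter_op_exchange'[OF letter_op_enum_ext[OF assms]] .

text \<open>Each partition contributes one letter per element. This makes the number of elements
  visible even if the enumerator is known only up to a constant factor.\<close>

lemma enum_homogeneous:
  assumes "S \<in> class_C0"
  shows "Rep_qsym (enum S) (map ((*) c) X) = c ^ card (elts S) * Rep_qsym (enum S) X"
proof -
  have "(\<Prod>a\<in>elts S. map ((*) c) X ! f a) = c ^ card (elts S) * (\<Prod>a\<in>elts S. X ! f a)"
    if "f \<in> edge_partitions S {..<length X}" for f
  proof -
    have "(\<Prod>a\<in>elts S. map ((*) c) X ! f a) = (\<Prod>a\<in>elts S. c * X ! f a)"
      by (rule prod.cong) (use that in \<open>auto simp: edge_partitions_def PiE_def Pi_def\<close>)
    then show ?thesis by (simp add: prod.distrib)
  qed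
  then show ?thesis
    by (simp add: Rep_enum[OF assms] enum_list_def enum_on_def sum_distrib_left)
qed

section \<open>Isomorphisms and the reconstruction of posets\<close>

definition epos_iso :: "'a epos \<Rightarrow> 'b epos \<Rightarrow> bool" where
  "epos_iso S T \<longleftrightarrow> (\<exists>\<phi>. bij_betw \<phi> (elts S) (elts T) \<and>
    (\<forall>a\<in>elts S. \<forall>b\<in>elts S. ((a, b) \<in> leq S \<longleftrightarrow> (\<phi> a, \<phi> b) \<in> leq T) \<and>
      ((a, b) \<in> strict S \<longleftrightarrow> (\<phi> a, \<phi> b) \<in> strict T)))"

lemma epos_iso_disj_union:
  assumes "edge_poset_ok P" "edge_poset_ok P'" "elts P \<inter> elts P' = {}"
    and "edge_poset_ok Q" "edge_poset_ok Q'" "elts Q \<inter> elts Q' = {}"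
    and "epos_iso P Q" "epos_iso P' Q'"
  shows "epos_iso (disj_union P P') (disj_union Q Q')"
proof -
  from assms(7) obtain \<phi> where \<phi>: "bij_betw \<phi> (elts P) (elts Q)"
    "\<And>a b. a \<in> elts P \<Longrightarrow> b \<in> elts P \<Longrightarrow> (a, b) \<in> leq P \<longleftrightarrow> (\<phi> a, \<phi> b) \<in> leq Q"
    "\<And>a b. a \<in> elts P \<Longrightarrow> b \<in> elts P \<Longrightarrow> (a, b) \<in> strict P \<longleftrightarrow> (\<phi> a, \<phi> b) \<in> strict Q"
    unfolding epos_iso_def by blast
  from assms(8) obtain \<psi> where \<psi>: "bij_betw \<psi> (elts P') (elts Q')"
    "\<And>a b. a \<in> elts P' \<Longrightarrow> b \<in> elts P' \<Longrightarrow> (a, b) \<in> leq P' \<longleftrightarrow> (\<psi> a, \<psi> b) \<in> leq Q'"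
    "\<And>a b. a \<in> elts P' \<Longrightarrow> b \<in> elts P' \<Longrightarrow> (a, b) \<in> strict P' \<longleftrightarrow> (\<psi> a, \<psi> b) \<in> strict Q'"
    unfolding epos_iso_def by blast
  note ok = edge_poset_okD(2,7)[OF assms(1)] edge_poset_okD(2,7)[OF assms(2)]
    edge_poset_okD(2,7)[OF assms(4)] edge_poset_okD(2,7)[OF assms(5)]
  define \<theta> where "\<theta> a = (if a \<in> elts P then \<phi> a else \<psi> a)" for a
  have P: "\<theta> a = \<phi> a" "\<theta> a \<in> elts Q" "\<theta> a \<notin> elts Q'" "a \<notin> elts P'" if "a \<in> elts P" for a
    using that \<phi>(1) assms(3,6) by (auto simp: \<theta>_def bij_betw_def)
  have P': "\<theta> a = \<psi> a" "\<theta> a \<in> elts Q'" "\<theta> a \<notin> elts Q" "a \<notin> elts P" if "a \<in> elts P'" for a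
    using that \<psi>(1) assms(3,6) by (auto simp: \<theta>_def bij_betw_def)
  have "bij_betw \<theta> (elts P) (elts Q)" "bij_betw \<theta> (elts P') (elts Q')"
    using \<phi>(1) \<psi>(1) P(1) P'(1) by (simp_all cong: bij_betw_cong)
  then have "bij_betw \<theta> (elts P \<union> elts P') (elts Q \<union> elts Q')"
    using assms(6) by (rule bij_betw_combine)
  moreover have "((a, b) \<in> leq (disj_union P P') \<longleftrightarrow> (\<theta> a, \<theta> b) \<in> leq (disj_union Q Q')) \<and>
      ((a, b) \<in> strict (disj_union P P') \<longleftrightarrow> (\<theta> a, \<theta> b) \<in> strict (disj_union Q Q'))"
    if ab: "a \<in> elts P \<union> elts P'" "b \<in> elts P \<union> elts P'" for a b
  proof (cases "a \<in> elts P \<longleftrightarrow> b \<in> elts P")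
    case True
    show ?thesis
    proof (cases "a \<in> elts P")
      case a: True
      with True have b: "b \<in> elts P" by simp
      show ?thesis
        using P[OF a] P[OF b] \<phi>(2,3)[OF a b] ok
        by (auto simp: leq_disj_union strict_disj_union)
    next
      case False
      then have a: "a \<in> elts P'" and b: "b \<in> elts P'" using True ab by auto
      show ?thesis
        using P'[OF a] P'[OF b] \<psi>(2,3)[OF a b] ok
        by (auto simp: leq_disj_union strict_disj_union)
    qed
  next
    case False
    then have "a \<in> elts P \<and> b \<in> elts P' \<or> a \<in> elts P' \<and> b \<in> elts P"
      using ab by auto
    then have "\<not> (a \<in> elts P \<and> b \<in> elts P)" "\<not> (a \<in> elts P' \<and> b \<in> elts P')"
      "\<not> (\<theta> a \<in> elts Q \<and> \<theta> b \<in> elts Q)" "\<not> (\<theta> a \<in> elts Q' \<and> \<theta> b \<in> elts Q')"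
      using P(2-4) P'(2-4) by blast+
    then show ?thesis
      using ok unfolding leq_disj_union strict_disj_union Un_iff by blast
  qed
  ultimately show ?thesis
    unfolding epos_iso_def elts_disj_union by blast
qed

lemma epos_iso_ext:
  assumes A: "edge_poset_ok A" "x \<notin> elts A" and B: "edge_poset_ok B" "y \<notin> elts B"
    and "epos_iso A B"
  shows "epos_iso (ext_epos tp w x A) (ext_epos tp w y B)"
proof -
  from assms(5) obtain \<phi> where \<phi>: "bij_betw \<phi> (elts A) (elts B)"
    "\<And>a b. a \<in> elts A \<Longrightarrow> b \<in> elts A \<Longrightarrow> (a, b) \<in> leq A \<longleftrightarrow> (\<phi> a, \<phi> b) \<in> leq B"
    "\<And>a b. a \<in> elts A \<Longrightarrow> b \<in> elts A \<Longrightarrow> (a, b) \<in> strict A \<longleftrightarrow> (\<phi> a, \<phi> b) \<in> strict B"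
    unfolding epos_iso_def by blast
  note okA = edge_poset_okD(2,7)[OF A(1)] and okB = edge_poset_okD(2,7)[OF B(1)]
  have mem: "\<phi> a \<in> elts B" if "a \<in> elts A" for a
    using that \<phi>(1) by (auto simp: bij_betw_def)
  have inj: "\<phi> a = \<phi> b \<longleftrightarrow> a = b" if "a \<in> elts A" "b \<in> elts A" for a b
    using that \<phi>(1) by (auto simp: bij_betw_def inj_on_def)
  have surj: "\<exists>a\<in>elts A. \<phi> a = b" if "b \<in> elts B" for b
    using that \<phi>(1) by (metis bij_betw_imp_surj_on imageE)
  have less: "(a, b) \<in> less_rel A \<longleftrightarrow> (\<phi> a, \<phi> b) \<in> less_rel B" if "a \<in> elts A" "b \<in> elts A" for a b
    using that \<phi>(2) inj by (simp add: less_rel_def)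
  have lessA: "(a, b) \<in> less_rel A \<Longrightarrow> a \<in> elts A \<and> b \<in> elts A" for a b
    using okA(1)[of a b] by (simp add: less_rel_def)
  have lessB: "(a, b) \<in> less_rel B \<Longrightarrow> a \<in> elts B \<and> b \<in> elts B" for a b
    using okB(1)[of a b] by (simp add: less_rel_def)
  have mins: "a \<in> min_elts A \<longleftrightarrow> \<phi> a \<in> min_elts B" and maxs: "a \<in> max_elts A \<longleftrightarrow> \<phi> a \<in> max_elts B"
    if a: "a \<in> elts A" for a
  proof -
    have "(\<exists>b. (b, a) \<in> less_rel A) \<longleftrightarrow> (\<exists>b. (b, \<phi> a) \<in> less_rel B)"
      using lessA lessB surj less a by metis
    then show "a \<in> min_elts A \<longleftrightarrow> \<phi> a \<in> min_elts B"
      using a mem[OF a] unfolding min_elts_def mem_Collect_eq by blast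
    have "(\<exists>b. (a, b) \<in> less_rel A) \<longleftrightarrow> (\<exists>b. (\<phi> a, b) \<in> less_rel B)"
      using lessA lessB surj less a by metis
    then show "a \<in> max_elts A \<longleftrightarrow> \<phi> a \<in> max_elts B"
      using a mem[OF a] unfolding max_elts_def mem_Collect_eq by blast
  qed
  define \<theta> where "\<theta> = \<phi>(x := y)"
  have \<theta>: "\<theta> x = y" "\<And>a. a \<in> elts A \<Longrightarrow> \<theta> a = \<phi> a"
    using A(2) by (auto simp: \<theta>_def)
  have "bij_betw \<theta> (elts A) (elts B)"
    using \<phi>(1) \<theta>(2) by (simp cong: bij_betw_cong)
  then have "bij_betw \<theta> (insert x (elts A)) (insert y (elts B))"
    using notIn_Un_bij_betw[of x "elts A" \<theta> "elts B"] A(2) B(2) \<theta>(1) by simp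
  moreover have "((a, b) \<in> leq (ext_epos tp w x A) \<longleftrightarrow> (\<theta> a, \<theta> b) \<in> leq (ext_epos tp w y B)) \<and>
      ((a, b) \<in> strict (ext_epos tp w x A) \<longleftrightarrow> (\<theta> a, \<theta> b) \<in> strict (ext_epos tp w y B))"
    if ab: "a \<in> insert x (elts A)" "b \<in> insert x (elts A)" for a b
  proof -
    have nA: "a \<noteq> x" if "a \<in> elts A" for a using that A(2) by auto
    have nB: "\<phi> a \<noteq> y" if "a \<in> elts A" for a using mem[OF that] B(2) by auto
    have no: "(x, b) \<notin> leq A" "(b, x) \<notin> leq A" "(x, b) \<notin> strict A" "(b, x) \<notin> strict A"
      "(y, c) \<notin> leq B" "(c, y) \<notin> leq B" "(y, c) \<notin> strict B" "(c, y) \<notin> strict B"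
      "x \<notin> min_elts A" "x \<notin> max_elts A" "y \<notin> min_elts B" "y \<notin> max_elts B" for b c
      using okA okB A(2) B(2) by (auto simp: min_elts_def max_elts_def)
    consider "a = x" "b = x" | "a = x" "b \<in> elts A" | "a \<in> elts A" "b = x" | "a \<in> elts A" "b \<in> elts A"
      using ab by blast
    then show ?thesis
      by cases
        (simp_all add: leq_ext_epos strict_ext_epos \<theta> no nA nB A(2) B(2) mem \<phi>(2,3) mins maxs)
  qed
  ultimately show ?thesis
    unfolding epos_iso_def elts_ext_epos by blast
qed

lemma class_C0_elts_empty:
  assumes "S \<in> class_C0" "elts S = {}"
  shows "S = empty_epos"
proof -
  have "leq S = {}" "strict S = {}"
    using edge_poset_okD(2,7)[OF class_C0_ok[OF assms(1)]] assms(2) by auto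
  then show ?thesis
    using assms(2) by (simp add: empty_epos_def)
qed

lemma disj_union_empty [simp]: "disj_union empty_epos S = S" "disj_union S empty_epos = S"
  by (simp_all add: disj_union_def empty_epos_def)

lemma disj_union_assoc: "disj_union (disj_union P Q) R = disj_union P (disj_union Q R)"
  by (simp add: disj_union_def Un_assoc)

lemma disj_union_left_commute: "disj_union P (disj_union Q R) = disj_union Q (disj_union P R)"
  by (simp add: disj_union_def Un_left_commute)

lemma ext_epos_empty: "ext_epos tp w x empty_epos = one_epos x"
  by (rule pos.equality)
    (auto simp: ext_epos_def weak_sum_def strict_sum_def one_epos_def empty_epos_def min_elts_def max_elts_def)

text \<open>A new top does not change the minimal elements of a nonempty poset, nor a new bottom the
  maximal ones. For empty \<open>A\<close> the claim can fail: \<open>x\<close> and \<open>y\<close>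
  are then joined by one edge, whose kind is that of the step performed last.\<close>

lemma ext_epos_commute:
  assumes A: "edge_poset_ok A" "elts A \<noteq> {}" and xy: "x \<notin> elts A" "y \<notin> elts A"
  shows "ext_epos (\<not> tp) w' y (ext_epos tp w x A) = ext_epos tp w x (ext_epos (\<not> tp) w' y A)"
proof -
  have mins: "min_elts (ext_epos True v z A) = min_elts A" if "z \<notin> elts A" for v z
    using A(2) that edge_poset_okD(2)[OF A(1)]
    by (auto simp: min_elts_def less_rel_def leq_ext_epos)
  have maxs: "max_elts (ext_epos False v z A) = max_elts A" if "z \<notin> elts A" for v z
    using A(2) that edge_poset_okD(2)[OF A(1)]
    by (auto simp: max_elts_def less_rel_def leq_ext_epos)
  show ?thesis
    by (cases tp; rule epos.equality)
      (auto simp: leq_ext_epos strict_ext_epos mins[OF xy(1)] mins[OF xy(2)] maxs[OF xy(1)] maxs[OF xy(2)])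
qed

section \<open>Recognizing the last construction step by degrees\<close>

lemma enum_neq_0: "S \<in> class_C0 \<Longrightarrow> enum S \<noteq> 0"
proof (induction rule: class_C0.induct)
  case (ext A x tp w)
  show ?case
    using letter_op_enum_ext[OF ext.hyps, of tp w 1] ext.IH by (auto simp: letter_op.zero)
qed (simp_all add: enum_empty enum_disj_union)

lemma of_int_factor:
  fixes F G :: qsym
  assumes "F * G = of_int c" "c \<noteq> 0"
  shows "\<exists>c. F = of_int c" "\<exists>c. G = of_int c"
proof -
  have "F \<noteq> 0" "G \<noteq> 0" using assms by auto
  then have "degree (letter_op.expand False False F) + degree (letter_op.expand False False G) = 0"
    using letter_op.degree_expand_mult[of F G False False] assms(1)
    by (simp add: letter_op.expand_of_int)
  then show "\<exists>c. F = of_int c" "\<exists>c. G = of_int c"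
    using letter_op.degree_expand_eq_0 by auto
qed

lemma enum_not_const: "S \<in> class_C0 \<Longrightarrow> elts S \<noteq> {} \<Longrightarrow> enum S \<noteq> of_int c"
proof (induction arbitrary: c rule: class_C0.induct)
  case (union P Q)
  show ?case
  proof
    assume "enum (disj_union P Q) = of_int c"
    moreover have "c \<noteq> 0"
      using enum_neq_0[OF class_C0.union[OF union.hyps]] calculation by auto
    ultimately show False
      using of_int_factor[of "enum P" "enum Q" c] union.IH union.prems
      by (auto simp: enum_disj_union union.hyps)
  qed
next
  case (ext A x tp w)
  show ?case
    using letter_op_enum_ext[OF ext.hyps, of tp w 1] enum_neq_0[OF ext.hyps(1)]
    by (auto simp: letter_op.of_int)
qed simp

text \<open>
  If the new edges are of the wrong kind for the operator, then its degree on \<open>ext_epos tp w' x A\<close>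
  exceeds its degree on \<open>A\<close> by one.
\<close>

lemma linear_same_side:
  assumes A: "A \<in> class_C0" "x \<notin> elts A"
    and lin: "\<And>t. letter_op tp w t (enum (ext_epos tp w' x A)) = enum (ext_epos tp w' x A) + of_int t * g"
  shows "w' = w \<or> elts A = {}"
proof (rule ccontr)
  assume neg: "\<not> (w' = w \<or> elts A = {})"
  let ?f = "enum (ext_epos tp w' x A)"
  have w: "w \<longleftrightarrow> \<not> w'" using neg by auto
  have "letter_op.expand tp w ?f = pCons ?f (letter_op.expand tp w (enum A))"
    by (rule letter_op.expand_eqI) (simp add: letter_op.poly_expand w letter_op_Not_enum_ext[OF A])
  moreover have "letter_op.expand tp w ?f = [:?f, g:]"
    using lin letter_op.expand_linear_iff by blast
  ultimately have "letter_op.expand tp w (enum A) = [:g:]" by simp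
  then have "\<exists>c. enum A = of_int c"
    by (intro letter_op.degree_expand_eq_0[of tp w]) simp
  then show False
    using enum_not_const[OF A(1)] neg by auto
qed

text \<open>A disjoint union of two nonempty parts would have degree at least 2. A last step on the
  side \<open>tp\<close> must be of kind \<open>w\<close> unless \<open>A\<close> is empty. After a
  last step on the other side, \<open>A\<close> inherits the linear behaviour since the operators
  commute; so by induction \<open>A\<close> ends with a step of the desired type, which can be
  interchanged with the last one.\<close>

lemma linear_imp_ext:
  assumes "S \<in> class_C0" "elts S \<noteq> {}"
    and "\<And>t. letter_op tp w t (enum S) = enum S + of_int t * g"
  shows "\<exists>x A. A \<in> class_C0 \<and> x \<notin> elts A \<and> S = ext_epos tp w x A"
  using assms
proof (induction arbitrary: g rule: class_C0.induct)
  case (union P Q)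
  consider "elts P = {}" | "elts Q = {}" | "elts P \<noteq> {}" "elts Q \<noteq> {}" by blast
  then show ?case
  proof cases
    case 1
    then have "disj_union P Q = Q"
      using class_C0_elts_empty union.hyps by force
    then show ?thesis using union.IH(2)[of g] union.prems by simp
  next
    case 2
    then have "disj_union P Q = P"
      using class_C0_elts_empty union.hyps by force
    then show ?thesis using union.IH(1)[of g] union.prems by simp
  next
    case 3
    have "letter_op.expand tp w (enum (disj_union P Q)) = [:enum (disj_union P Q), g:]"
      using union.prems(2) letter_op.expand_linear_iff by blast
    then have "degree (letter_op.expand tp w (enum P * enum Q)) \<le> 1"
      by (simp add: enum_disj_union union.hyps)
    then have "degree (letter_op.expand tp w (enum P)) = 0 \<or> degree (letter_op.expand tp w (enum Q)) = 0"
      using letter_op.degree_expand_mult[OF enum_neq_0[OF union.hyps(1)]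
          enum_neq_0[OF union.hyps(2)], of tp w]
      by simp linarith
    then show ?thesis
      using letter_op.degree_expand_eq_0[of tp w] enum_not_const[OF union.hyps(1) 3(1)]
        enum_not_const[OF union.hyps(2) 3(2)] by blast
  qed
next
  case (ext A x tp' w')
  show ?case
  proof (cases "elts A = {}")
    case True
    then have "ext_epos tp' w' x A = ext_epos tp w x empty_epos"
      using class_C0_elts_empty[OF ext.hyps(1)] by (simp add: ext_epos_empty)
    then show ?thesis
      using class_C0.empty by (metis elts_empty_epos empty_iff)
  next
    case A: False
    show ?thesis
    proof (cases "tp' = tp")
      case True
      then have "w' = w"
        using linear_same_side[OF ext.hyps, of tp w w'] ext.prems(2) A by blast
      then show ?thesis
        using True ext.hyps by blast
    next
      case False
      then have tp': "tp' = (\<not> tp)" by simp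
      let ?f = "enum (ext_epos tp' w' x A)"
      \<comment> \<open>Expresses \<open>enum A\<close> through operators at the other end, which
        commute with the one under consideration.\<close>
      have fA: "enum A = letter_op tp' w' 1 ?f - ?f"
        using letter_op_enum_ext[OF ext.hyps, of tp' w' 1] by simp
      have "letter_op tp w t (enum A) = enum A + of_int t * (letter_op tp' w' 1 g - g)" for t
      proof -
        have "letter_op tp w t (enum A) = letter_op tp' w' 1 (letter_op tp w t ?f) - letter_op tp w t ?f"
          unfolding fA letter_op.diff tp' letter_op_commute ..
        then show ?thesis
          unfolding ext.prems(2)[of t]
          by (simp add: fA letter_op.add letter_op.mult letter_op.of_int algebra_simps)
      qed
      from ext.IH[OF A this] obtain z B where B: "B \<in> class_C0" "z \<notin> elts B" "A = ext_epos tp w z B"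
        by blast
      have xz: "x \<noteq> z" "x \<notin> elts B" using ext.hyps(2) B(3) by auto
      show ?thesis
      proof (cases "elts B = {}")
        case True
        \<comment> \<open>The poset is a chain of two elements \<open>x\<close> and
          \<open>z\<close>. Its only edge has kind \<open>w'\<close>, and \<open>z\<close> may as
          well be regarded as the element added last, on the side \<open>tp\<close>; linearity then
          forces \<open>w' = w\<close>.\<close>
        let ?A = "ext_epos tp w x empty_epos"
        have A': "?A \<in> class_C0" "z \<notin> elts ?A"
          using xz by (auto intro: class_C0.intros)
        have "B = empty_epos"
          using class_C0_elts_empty[OF B(1) True] .
        then have eq: "ext_epos tp' w' x A = ext_epos tp w' z ?A"
          unfolding B(3) tp' by (cases tp) (simp_all add: ext_epos_empty, simp_all add: ext_epos_def)
        have "w' = w"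
          using linear_same_side[OF A', of tp w w' g] ext.prems(2) unfolding eq by auto
        then show ?thesis
          using eq A' by blast
      next
        case False
        have "ext_epos tp' w' x A = ext_epos tp w z (ext_epos (\<not> tp) w' x B)"
          unfolding B(3) tp' by (rule ext_epos_commute) (use B(1,2) xz False class_C0_ok in auto)
        moreover have "ext_epos (\<not> tp) w' x B \<in> class_C0" "z \<notin> elts (ext_epos (\<not> tp) w' x B)"
          using B xz by (auto intro: class_C0.ext)
        ultimately show ?thesis by blast
      qed
    qed
  qed
qed simp

text \<open>Doubling all letters multiplies the two sides by powers of 2 whose exponents are the
  numbers of elements.\<close>

lemma enum_proportional_card:
  assumes S: "S \<in> class_C0" and T: "T \<in> class_C0"
    and eq: "of_int c * enum S = of_int d * enum T" and c: "c \<noteq> 0"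
  shows "card (elts S) = card (elts T)"
proof -
  obtain X where X: "Rep_qsym (enum S) X \<noteq> 0"
    using enum_neq_0[OF S] qsym_eqI[of "enum S" 0] by (auto simp: zero_qsym.rep_eq)
  have eqX: "c * Rep_qsym (enum S) Y = d * Rep_qsym (enum T) Y" for Y
    using arg_cong[OF eq, of "\<lambda>F. Rep_qsym F Y"] by (simp add: times_qsym.rep_eq Rep_qsym_of_int)
  let ?Y = "map ((*) 2) X"
  have "2 ^ card (elts S) * (c * Rep_qsym (enum S) X) = c * Rep_qsym (enum S) ?Y"
    by (simp add: enum_homogeneous[OF S])
  also have "\<dots> = 2 ^ card (elts T) * (c * Rep_qsym (enum S) X)"
    unfolding eqX by (simp add: enum_homogeneous[OF T])
  finally have "(2 :: int) ^ card (elts S) = 2 ^ card (elts T)"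
    using X c by simp
  then show ?thesis by simp
qed

section \<open>Primality and splitting into components\<close>

text \<open>The connected members of the class: a least or greatest element is comparable to
  everything. \<open>A\<close> may be empty, which gives \<open>[1]\<close>.\<close>

definition prime_ext :: "'a epos \<Rightarrow> bool" where
  "prime_ext E \<longleftrightarrow> (\<exists>tp w x A. A \<in> class_C0 \<and> x \<notin> elts A \<and> E = ext_epos tp w x A)"

lemma prime_ext_class_C0: "prime_ext E \<Longrightarrow> E \<in> class_C0"
  by (auto simp: prime_ext_def intro: class_C0.ext)

lemma prime_ext_dvd:
  assumes "prime_ext E" "enum E = F * G" "\<nexists>c. F = of_int c"
  shows "\<exists>c. G = of_int c"
proof -
  obtain tp w x A where A: "A \<in> class_C0" "x \<notin> elts A" "E = ext_epos tp w x A"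
    using assms(1) by (auto simp: prime_ext_def)
  have "letter_op.expand tp w (enum E) = [:enum E, enum A:]"
    using letter_op.expand_linear_iff letter_op_enum_ext[OF A(1,2)] A(3) by blast
  then show ?thesis
    using letter_op.dvd_linear enum_neq_0[OF A(1)] assms(2,3) by metis
qed

text \<open>The factors are kept together with the posets they come from, as the induction for
  primality needs their sizes.\<close>

lemma enum_factorization:
  fixes S :: "'a epos"
  shows "S \<in> class_C0 \<Longrightarrow> \<exists>M :: 'a epos multiset. enum S = prod_mset (image_mset enum M) \<and>
    (\<forall>E\<in>#M. prime_ext E \<and> card (elts E) \<le> card (elts S))"
proof (induction rule: class_C0.induct)
  case empty
  show ?case
    by (intro exI[of _ "{#}"]) (simp add: enum_empty)
next
  case (union P Q)
  then obtain M N :: "'a epos multiset" where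
    "enum P = prod_mset (image_mset enum M)" "enum Q = prod_mset (image_mset enum N)"
    and MN: "\<forall>E\<in>#M. prime_ext E \<and> card (elts E) \<le> card (elts P)"
    "\<forall>E\<in>#N. prime_ext E \<and> card (elts E) \<le> card (elts Q)"
    by blast
  moreover have "card (elts P) \<le> card (elts (disj_union P Q))" "card (elts Q) \<le> card (elts (disj_union P Q))"
    using edge_poset_okD(1)[OF class_C0_ok] union.hyps by (auto intro!: card_mono)
  ultimately show ?case
    by (intro exI[of _ "M + N"]) (auto simp: enum_disj_union union.hyps intro: order_trans)
next
  case (ext A x tp w)
  then show ?case
    by (intro exI[of _ "{#ext_epos tp w x A#}"]) (auto simp: prime_ext_def)
qed

lemma prime_elem_enum:
  fixes E :: "'a epos"
  shows "prime_ext E \<Longrightarrow> prime_elem (enum E)"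
proof (induction "card (elts E)" arbitrary: E rule: less_induct)
  case less
  obtain tp w x A where A: "A \<in> class_C0" "x \<notin> elts A" "E = ext_epos tp w x A"
    using less.prems by (auto simp: prime_ext_def)
  obtain M :: "'a epos multiset" where M: "enum A = prod_mset (image_mset enum M)"
    "\<And>C. C \<in># M \<Longrightarrow> prime_ext C \<and> card (elts C) \<le> card (elts A)"
    using enum_factorization[OF A(1)] by blast
  have card: "card (elts A) < card (elts E)"
    using A edge_poset_okD(1)[OF class_C0_ok[OF A(1)]] by simp
  have lin: "letter_op.expand tp w (enum E) = [:enum E, prod_mset (image_mset enum M):]"
    using letter_op.expand_linear_iff letter_op_enum_ext[OF A(1,2)] A(3) M(1) by metis
  show ?case
  proof (rule letter_op.prime_elem_linear[OF lin])
    fix p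
    assume "p \<in># image_mset enum M"
    then obtain C where C: "C \<in># M" "p = enum C" by auto
    note C' = M(2)[OF C(1)]
    then have CC0: "C \<in> class_C0" using prime_ext_class_C0 by blast
    have "prime_elem p"
      using less.hyps[of C] C' card C(2) by simp
    moreover have "\<not> p dvd enum E"
    proof
      \<comment> \<open>The cofactor would be an integer, so \<open>C\<close> and \<open>E\<close>
        would have equally many elements; but \<open>C\<close> is no larger than
        \<open>A\<close>.\<close>
      assume "p dvd enum E"
      then obtain G where G: "enum E = enum C * G" using C(2) by blast
      have "elts C \<noteq> {}" using C' by (auto simp: prime_ext_def)
      then have "\<nexists>c. enum C = of_int c"
        using enum_not_const[OF CC0] by blast
      then obtain c where "G = of_int c"
        using prime_ext_dvd[OF less.prems G] by blast
      then have "of_int 1 * enum E = of_int c * enum C"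
        using G by (simp add: mult.commute)
      then have "card (elts E) = card (elts C)"
        by (rule enum_proportional_card[OF prime_ext_class_C0[OF less.prems] CC0]) simp
      then show False using C' card by simp
    qed
    ultimately show "prime_elem p \<and> \<not> p dvd enum E" ..
  qed
qed

lemma class_C0_split:
  "S \<in> class_C0 \<Longrightarrow> elts S \<noteq> {} \<Longrightarrow>
    \<exists>E T. prime_ext E \<and> T \<in> class_C0 \<and> elts E \<inter> elts T = {} \<and> S = disj_union E T"
proof (induction rule: class_C0.induct)
  case (union P Q)
  show ?case
  proof (cases "elts P = {}")
    case True
    then have "disj_union P Q = Q"
      using class_C0_elts_empty union.hyps by force
    then show ?thesis using union.IH(2) union.prems by simp
  next
    case False
    then obtain E T where E: "prime_ext E" "T \<in> class_C0" "elts E \<inter> elts T = {}" "P = disj_union E T"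
      using union.IH(1) by blast
    then show ?thesis
      using union.hyps
      by (intro exI[of _ E] exI[of _ "disj_union T Q"])
        (auto simp: disj_union_assoc intro: class_C0.union)
  qed
next
  case (ext A x tp w)
  have "prime_ext (ext_epos tp w x A)"
    using ext.hyps by (auto simp: prime_ext_def)
  then show ?case
    by (intro exI[of _ "ext_epos tp w x A"] exI[of _ empty_epos]) (simp add: class_C0.empty)
qed simp

text \<open>A prime divisor of a product divides one of the factors, and the component belonging to
  it can be split off first.\<close>

lemma class_C0_split_dvd:
  fixes S :: "'a epos"
  assumes "S \<in> class_C0" "prime_elem p" "p dvd enum S"
  shows "\<exists>E T. prime_ext E \<and> T \<in> class_C0 \<and> elts E \<inter> elts T = {} \<and>
    S = disj_union E T \<and> p dvd enum E"
  using assms(1,3)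
proof (induction rule: class_C0.induct)
  case empty
  then show ?case
    using assms(2) prime_elem_not_unit[of p] by (simp add: enum_empty)
next
  case (union P Q)
  then have "p dvd enum P \<or> p dvd enum Q"
    using assms(2) by (simp add: enum_disj_union prime_elem_dvd_mult_iff)
  then show ?case
  proof
    assume "p dvd enum P"
    then obtain E T where E: "prime_ext E" "T \<in> class_C0" "elts E \<inter> elts T = {}" "P = disj_union E T"
      "p dvd enum E"
      using union.IH(1) by blast
    then show ?thesis
      using union.hyps
      by (intro exI[of _ E] exI[of _ "disj_union T Q"])
        (auto simp: disj_union_assoc intro: class_C0.union)
  next
    assume "p dvd enum Q"
    then obtain E T where E: "prime_ext E" "T \<in> class_C0" "elts E \<inter> elts T = {}" "Q = disj_union E T"
      "p dvd enum E"
      using union.IH(2) by blast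
    then show ?thesis
      using union.hyps
      by (intro exI[of _ E] exI[of _ "disj_union P T"])
        (auto simp: disj_union_left_commute[of P] intro: class_C0.union)
  qed
next
  case (ext A x tp w)
  have "prime_ext (ext_epos tp w x A)"
    using ext.hyps by (auto simp: prime_ext_def)
  then show ?case
    using ext.prems by (intro exI[of _ "ext_epos tp w x A"] exI[of _ empty_epos]) (simp add: class_C0.empty)
qed

text \<open>A prime factor of \<open>enum P\<close> is matched with one of \<open>enum Q\<close>
  only up to an integer, and this integer is passed on both to the posets inside the matched
  components and to the remaining components. The constants \<open>c\<close> and \<open>d\<close>
  absorb it.\<close>

theorem enum_proportional_imp_iso:
  fixes P :: "'a epos" and Q :: "'b epos"
  assumes "P \<in> class_C0" "Q \<in> class_C0" "of_int c * enum P = of_int d * enum Q" "c \<noteq> 0" "d \<noteq> 0"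
  shows "epos_iso P Q"
  using assms
proof (induction "card (elts P)" arbitrary: P Q c d rule: less_induct)
  case less
  have card: "card (elts P) = card (elts Q)"
    using enum_proportional_card less.prems by metis
  have fin: "finite (elts P)" "finite (elts Q)"
    using edge_poset_okD(1) class_C0_ok less.prems by blast+
  show ?case
  proof (cases "elts P = {}")
    case True
    then show ?thesis
      using card fin by (simp add: epos_iso_def bij_betw_def)
  next
    case False
    then obtain E P' where E: "prime_ext E" "P' \<in> class_C0" "elts E \<inter> elts P' = {}" "P = disj_union E P'"
      using class_C0_split less.prems(1) by blast
    note EC = prime_ext_class_C0[OF E(1)]
    have prime: "prime_elem (enum E)" using prime_elem_enum[OF E(1)] .
    have E_ne: "elts E \<noteq> {}" using E(1) by (auto simp: prime_ext_def)
    then have E_nc: "\<nexists>c. enum E = of_int c" using enum_not_const[OF EC] by blast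
    have "enum E dvd of_int d * enum Q"
      by (simp add: less.prems(3)[symmetric] E(4) enum_disj_union[OF EC E(2,3)])
    \<comment> \<open>A divisor of a nonzero integer is an integer, by degrees.\<close>
    moreover have "\<not> enum E dvd of_int d"
      using of_int_factor(1)[of "enum E" _ d] E_nc less.prems(5) by (metis dvdE)
    ultimately have "enum E dvd enum Q"
      using prime prime_elem_dvd_mult_iff by blast
    then obtain E2 Q' where E2: "prime_ext E2" "Q' \<in> class_C0" "elts E2 \<inter> elts Q' = {}"
      "Q = disj_union E2 Q'" "enum E dvd enum E2"
      using class_C0_split_dvd[OF less.prems(2) prime] by blast
    note E2C = prime_ext_class_C0[OF E2(1)]
    obtain G where G: "enum E2 = enum E * G" using E2(5) by blast
    obtain c' where c': "G = of_int c'" using prime_ext_dvd[OF E2(1) G E_nc] by blast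
    have c'0: "c' \<noteq> 0" using enum_neq_0[OF E2C] G c' by auto
    obtain tp w x A where A: "A \<in> class_C0" "x \<notin> elts A" "E = ext_epos tp w x A"
      using E(1) by (auto simp: prime_ext_def)
    \<comment> \<open>A constant multiple reacts linearly to the same operator, so \<open>E2\<close>
      ends with a step of the same type as \<open>E\<close>.\<close>
    have lin: "letter_op tp w t (enum E2) = enum E2 + of_int t * (enum A * of_int c')" for t
      unfolding G c'
      by (simp add: letter_op.mult letter_op.of_int A(3) letter_op_enum_ext[OF A(1,2)] algebra_simps)
    have "elts E2 \<noteq> {}" using E2(1) by (auto simp: prime_ext_def)
    from linear_imp_ext[OF E2C this lin] obtain y B where
      B: "B \<in> class_C0" "y \<notin> elts B" "E2 = ext_epos tp w y B" by blast
    have "enum B = enum A * of_int c'"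
      using lin[of 1] letter_op_enum_ext[OF B(1,2), of tp w 1] B(3) by simp
    then have AB: "of_int c' * enum A = of_int 1 * enum B" by (simp add: mult.commute)
    have "card (elts A) < card (elts P)"
      using A(2) fin unfolding E(4) A(3) by (intro psubset_card_mono) auto
    from less.hyps[OF this A(1) B(1) AB c'0] have "epos_iso A B" by simp
    then have EE2: "epos_iso E E2"
      unfolding A(3) B(3)
      by (rule epos_iso_ext[OF class_C0_ok[OF A(1)] A(2) class_C0_ok[OF B(1)] B(2)])
    \<comment> \<open>The factor \<open>c'\<close> between \<open>E2\<close> and \<open>E\<close>
      moves to the remainder \<open>Q'\<close>.\<close>
    have "enum E * (of_int c * enum P') = enum E * (of_int (d * c') * enum Q')"
      using less.prems(3)
      unfolding E(4) E2(4) enum_disj_union[OF EC E(2,3)] enum_disj_union[OF E2C E2(2,3)] G c'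
      by (simp add: mult_ac)
    then have PQ: "of_int c * enum P' = of_int (d * c') * enum Q'"
      using enum_neq_0[OF EC] by simp
    have "card (elts P') < card (elts P)"
      using E_ne E(3) fin unfolding E(4) by (intro psubset_card_mono) auto
    from less.hyps[OF this E(2) E2(2) PQ less.prems(4)] have "epos_iso P' Q'"
      using less.prems(5) c'0 by simp
    with EE2 show ?thesis
      unfolding E(4) E2(4)
      by (intro epos_iso_disj_union class_C0_ok EC E2C E(2,3) E2(2,3))
  qed
qed

section \<open>Labeled posets\<close>

lemma edge_poset_simps [simp]:
  "elts (edge_poset P) = elts P" "leq (edge_poset P) = leq P" "strict (edge_poset P) = strict_edges P"
  by (simp_all add: edge_poset_def)

lemma edge_poset_ok_edge_poset:
  assumes "labeled_poset P"
  shows "edge_poset_ok (edge_poset P)"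
  using assms by (auto simp: edge_poset_ok_def labeled_poset_def strict_edges_def covers_def less_rel_def)

lemma lab_neq:
  assumes "labeled_poset P" "(a, b) \<in> less_rel P"
  shows "lab P a \<noteq> lab P b"
proof -
  have "a \<in> elts P" "b \<in> elts P" "a \<noteq> b"
    using assms(2) edge_poset_okD(2)[OF edge_poset_ok_edge_poset[OF assms(1)], of a b]
    by (auto simp: less_rel_def)
  then show ?thesis
    using assms(1) by (auto simp: labeled_poset_def bij_betw_def inj_on_def)
qed

text \<open>
  Along a saturated chain from \<open>a\<close> to \<open>b\<close> the labels can only drop across a strict edge, so it is
  enough to require strictness on the strict edges.
\<close>

lemma edge_partition_less_or_lab_less:
  assumes P: "labeled_poset P" and f: "f \<in> edge_partitions (edge_poset P) J" and "(a, b) \<in> less_rel P"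
  shows "f a < f b \<or> lab P a < lab P b"
  using assms(3)
proof (induction "card {c. (a, c) \<in> less_rel P \<and> (c, b) \<in> less_rel P}" arbitrary: a b rule: less_induct)
  case less
  note ok = edge_poset_okD[OF edge_poset_ok_edge_poset[OF P], simplified]
  have trans: "(x, z) \<in> less_rel P" if "(x, y) \<in> less_rel P" "(y, z) \<in> less_rel P" for x y z
    using that ok(4)[of x y z] ok(5)[of x y] by (auto simp: less_rel_def)
  have irrefl: "(x, x) \<notin> less_rel P" for x
    by (simp add: less_rel_def)
  let ?I = "\<lambda>a b. {c. (a, c) \<in> less_rel P \<and> (c, b) \<in> less_rel P}"
  show ?case
  proof (cases "(a, b) \<in> covers P")
    case True
    then show ?thesis
      using edge_partitionsD(4)[OF f, of a b] lab_neq[OF P less.prems] by (auto simp: strict_edges_def)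
  next
    case False
    then obtain c where c: "(a, c) \<in> less_rel P" "(c, b) \<in> less_rel P"
      using less.prems by (auto simp: covers_def)
    have fin: "finite (?I a b)"
      by (rule finite_subset[OF _ ok(1)]) (use ok(2) in \<open>auto simp: less_rel_def\<close>)
    have "?I a c \<subset> ?I a b" "?I c b \<subset> ?I a b"
      using c trans irrefl by blast+
    then have "card (?I a c) < card (?I a b)" "card (?I c b) < card (?I a b)"
      using fin by (auto intro: psubset_card_mono)
    then have "f a < f c \<or> lab P a < lab P c" "f c < f b \<or> lab P c < lab P b"
      using less.hyps c by blast+
    moreover have "f a \<le> f c" "f c \<le> f b"
      using c edge_partitionsD(3)[OF f] by (auto simp: less_rel_def)
    ultimately show ?thesis by linarith
  qed
qed

lemma P_partitions_eq:
  assumes P: "labeled_poset P"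
  shows "P_partitions P = edge_partitions (edge_poset P) {1..}"
proof (intro equalityI subsetI)
  fix f assume f: "f \<in> P_partitions P"
  show "f \<in> edge_partitions (edge_poset P) {1..}"
  proof (rule edge_partitionsI)
    show "f a \<le> f b" if "(a, b) \<in> leq (edge_poset P)" for a b
      using f that by (cases "a = b") (auto simp: P_partitions_def less_rel_def)
    show "f a < f b" if "(a, b) \<in> strict (edge_poset P)" for a b
      using f that by (auto simp: P_partitions_def strict_edges_def covers_def)
  qed (use f in \<open>auto simp: P_partitions_def PiE_def\<close>)
next
  fix f assume f: "f \<in> edge_partitions (edge_poset P) {1..}"
  have "f a \<le> f b" if "(a, b) \<in> less_rel P" for a b
    using that edge_partitionsD(3)[OF f] by (simp add: less_rel_def)
  moreover have "f a < f b" if "(a, b) \<in> less_rel P" "lab P a > lab P b" for a b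
    using edge_partition_less_or_lab_less[OF P f that(1)] that(2) by linarith
  moreover have "f \<in> elts P \<rightarrow>\<^sub>E {1..}"
    using edge_partitionsD(1,2)[OF f] by (auto simp: PiE_def)
  ultimately show "f \<in> P_partitions P"
    unfolding P_partitions_def by blast
qed

section \<open>From the coefficients of \<open>K_enum\<close> to finite alphabets\<close>

definition fibre_monomial :: "'a set \<Rightarrow> ('a \<Rightarrow> nat) \<Rightarrow> nat \<Rightarrow>\<^sub>0 nat" where
  "fibre_monomial A f = Abs_poly_mapping (\<lambda>i. card {a \<in> A. f a = i})"

lemma lookup_fibre_monomial:
  assumes "finite A"
  shows "Poly_Mapping.lookup (fibre_monomial A f) i = card {a \<in> A. f a = i}"
proof -
  have "{i. card {a \<in> A. f a = i} \<noteq> 0} \<subseteq> f ` A"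
    using assms by auto
  then have "finite {i. card {a \<in> A. f a = i} \<noteq> 0}"
    using assms finite_subset by blast
  then show ?thesis
    unfolding fibre_monomial_def by (subst Poly_Mapping.Abs_poly_mapping_inverse) simp_all
qed

text \<open>This is \<open>K_enum P\<close> with \<open>v i\<close> substituted for the first
  \<open>n\<close> variables and 0 for the others. \<open>M\<close> may be larger than the set of
  monomials that occur, so that two posets can be compared over a common set.\<close>

lemma enum_on_eq_K_enum:
  assumes P: "labeled_poset P"
    and M: "finite M" "\<And>f. f \<in> edge_partitions (edge_poset P) {1..n} \<Longrightarrow> fibre_monomial (elts P) f \<in> M"
      "\<And>m i. m \<in> M \<Longrightarrow> Poly_Mapping.lookup m i \<noteq> 0 \<Longrightarrow> i \<in> {1..n}"
  shows "enum_on (edge_poset P) v {1..n} =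
    (\<Sum>m\<in>M. K_enum P m * (\<Prod>i=1..n. v i ^ Poly_Mapping.lookup m i))"
proof -
  let ?E = "edge_partitions (edge_poset P) {1..n}"
  let ?fib = "fibre_monomial (elts P)"
  have fin: "finite (elts P)" using P by (simp add: labeled_poset_def)
  have finE: "finite ?E" using fin by (intro finite_edge_partitions) auto
  have "enum_on (edge_poset P) v {1..n} =
      (\<Sum>f\<in>?E. \<Prod>i=1..n. v i ^ Poly_Mapping.lookup (?fib f) i)"
    unfolding enum_on_def
  proof (rule sum.cong[OF refl])
    fix f assume f: "f \<in> ?E"
    have "(\<Prod>a\<in>elts P. v (f a)) = (\<Prod>i=1..n. \<Prod>a\<in>{a \<in> elts P. f a = i}. v (f a))"
      by (rule prod.group[symmetric]) (use fin edge_partitionsD(2)[OF f] in auto)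
    also have "\<dots> = (\<Prod>i=1..n. v i ^ Poly_Mapping.lookup (?fib f) i)"
      by (rule prod.cong) (simp_all add: lookup_fibre_monomial[OF fin])
    finally show "(\<Prod>a\<in>elts (edge_poset P). v (f a)) = \<dots>" by simp
  qed
  also have "\<dots> = (\<Sum>m\<in>M. \<Sum>f\<in>{f \<in> ?E. ?fib f = m}. \<Prod>i=1..n. v i ^ Poly_Mapping.lookup (?fib f) i)"
    by (rule sum.group[symmetric]) (use finE M in auto)
  also have "\<dots> = (\<Sum>m\<in>M. K_enum P m * (\<Prod>i=1..n. v i ^ Poly_Mapping.lookup m i))"
  proof (rule sum.cong[OF refl])
    fix m assume m: "m \<in> M"
    have "{f \<in> ?E. ?fib f = m} = {f \<in> P_partitions P.
        \<forall>i. Poly_Mapping.lookup m i = card {a \<in> elts P. f a = i}}"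
    proof (intro equalityI subsetI)
      fix f assume "f \<in> {f \<in> ?E. ?fib f = m}"
      then show "f \<in> {f \<in> P_partitions P. \<forall>i. Poly_Mapping.lookup m i = card {a \<in> elts P. f a = i}}"
        by (auto simp: P_partitions_eq[OF P] lookup_fibre_monomial[OF fin] edge_partitions_def)
    next
      fix f assume f: "f \<in> {f \<in> P_partitions P. \<forall>i. Poly_Mapping.lookup m i = card {a \<in> elts P. f a = i}}"
      then have f': "f \<in> edge_partitions (edge_poset P) {1..}"
        and look: "\<And>i. Poly_Mapping.lookup m i = card {a \<in> elts P. f a = i}"
        by (simp_all add: P_partitions_eq[OF P])
      have "f \<in> ?E"
      proof (rule edge_partitionsI)
        fix a assume "a \<in> elts (edge_poset P)"
        then have "a \<in> {b \<in> elts P. f b = f a}" by simp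
        then have "Poly_Mapping.lookup m (f a) \<noteq> 0"
          using fin by (auto simp: look card_eq_0_iff)
        then show "f a \<in> {1..n}" by (rule M(3)[OF m])
      qed (use edge_partitionsD[OF f'] in auto)
      moreover have "?fib f = m"
        by (rule poly_mapping_eqI) (simp add: lookup_fibre_monomial[OF fin] look)
      ultimately show "f \<in> {f \<in> ?E. ?fib f = m}" by simp
    qed
    then have "int (card {f \<in> ?E. ?fib f = m}) = K_enum P m"
      by (simp only: K_enum_def)
    moreover have "(\<Sum>f\<in>{f \<in> ?E. ?fib f = m}. \<Prod>i=1..n. v i ^ Poly_Mapping.lookup (?fib f) i) =
        (\<Sum>f\<in>{f \<in> ?E. ?fib f = m}. \<Prod>i=1..n. v i ^ Poly_Mapping.lookup m i)"
      by (rule sum.cong) auto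
    ultimately show "(\<Sum>f\<in>{f \<in> ?E. ?fib f = m}. \<Prod>i=1..n. v i ^ Poly_Mapping.lookup (?fib f) i) =
        K_enum P m * (\<Prod>i=1..n. v i ^ Poly_Mapping.lookup m i)"
      by simp
  qed
  finally show ?thesis .
qed

lemma enum_list_eq_if_K_enum_eq:
  assumes P: "labeled_poset P" and Q: "labeled_poset Q" and K: "K_enum P = K_enum Q"
  shows "enum_list (edge_poset P) X = enum_list (edge_poset Q) X"
proof -
  let ?n = "length X" and ?v = "\<lambda>i. X ! (i - 1)"
  define M where "M = fibre_monomial (elts P) ` edge_partitions (edge_poset P) {1..?n} \<union>
    fibre_monomial (elts Q) ` edge_partitions (edge_poset Q) {1..?n}"
  have shift: "enum_list (edge_poset R) X = enum_on (edge_poset R) ?v {1..?n}"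
    if "labeled_poset R" for R :: "'c lpos"
    using enum_on_image[OF edge_poset_ok_edge_poset[OF that], of Suc ?v "{..<?n}"]
    by (simp add: enum_list_def comp_def strict_mono_Suc_iff image_Suc_lessThan)
  have fin: "finite (elts P)" "finite (elts Q)"
    using P Q by (auto simp: labeled_poset_def)
  have supp: "i \<in> {1..?n}" if R: "labeled_poset R" and f: "f \<in> edge_partitions (edge_poset R) {1..?n}"
    and i: "Poly_Mapping.lookup (fibre_monomial (elts R) f) i \<noteq> 0" for R :: "'c lpos" and f i
  proof -
    have "finite (elts R)" using R by (simp add: labeled_poset_def)
    then have "{a \<in> elts R. f a = i} \<noteq> {}"
      using i by (auto simp: lookup_fibre_monomial)
    then obtain a where "a \<in> elts R" "f a = i" by blast
    then show ?thesis
      using edge_partitionsD(2)[OF f, of a] by simp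
  qed
  have M: "finite M" "\<And>m i. m \<in> M \<Longrightarrow> Poly_Mapping.lookup m i \<noteq> 0 \<Longrightarrow> i \<in> {1..?n}"
  proof -
    show "finite M"
      using fin by (simp add: M_def finite_edge_partitions)
    show "i \<in> {1..?n}" if "m \<in> M" "Poly_Mapping.lookup m i \<noteq> 0" for m i
      using that supp[OF P] supp[OF Q] unfolding M_def by blast
  qed
  have "enum_list (edge_poset P) X = (\<Sum>m\<in>M. K_enum P m * (\<Prod>i=1..?n. ?v i ^ Poly_Mapping.lookup m i))"
    unfolding shift[OF P] by (rule enum_on_eq_K_enum[OF P M(1) _ M(2)]) (auto simp: M_def)
  also have "\<dots> = enum_list (edge_poset Q) X"
    unfolding shift[OF Q] K by (rule enum_on_eq_K_enum[OF Q M(1) _ M(2), symmetric]) (auto simp: M_def)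
  finally show ?thesis .
qed

section \<open>Isomorphisms of labeled posets\<close>

lemma covers_iff_of_order_iso:
  assumes bij: "bij_betw \<phi> (elts P) (elts Q)"
    and leq: "\<And>a b. a \<in> elts P \<Longrightarrow> b \<in> elts P \<Longrightarrow> (a, b) \<in> leq P \<longleftrightarrow> (\<phi> a, \<phi> b) \<in> leq Q"
    and P: "\<And>a b. (a, b) \<in> leq P \<Longrightarrow> a \<in> elts P \<and> b \<in> elts P"
    and Q: "\<And>a b. (a, b) \<in> leq Q \<Longrightarrow> a \<in> elts Q \<and> b \<in> elts Q"
    and ab: "a \<in> elts P" "b \<in> elts P"
  shows "(a, b) \<in> covers P \<longleftrightarrow> (\<phi> a, \<phi> b) \<in> covers Q"
proof -
  have less: "(a, b) \<in> less_rel P \<longleftrightarrow> (\<phi> a, \<phi> b) \<in> less_rel Q" if "a \<in> elts P" "b \<in> elts P" for a b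
    using leq[OF that] bij that by (auto simp: less_rel_def bij_betw_def inj_on_def)
  have lessP: "a \<in> elts P \<and> b \<in> elts P" if "(a, b) \<in> less_rel P" for a b
    using P[of a b] that by (simp add: less_rel_def)
  have lessQ: "a \<in> elts Q \<and> b \<in> elts Q" if "(a, b) \<in> less_rel Q" for a b
    using Q[of a b] that by (simp add: less_rel_def)
  have "(\<exists>c. (a, c) \<in> less_rel P \<and> (c, b) \<in> less_rel P) \<longleftrightarrow>
      (\<exists>c. (\<phi> a, c) \<in> less_rel Q \<and> (c, \<phi> b) \<in> less_rel Q)"
  proof
    assume "\<exists>c. (a, c) \<in> less_rel P \<and> (c, b) \<in> less_rel P"
    then show "\<exists>c. (\<phi> a, c) \<in> less_rel Q \<and> (c, \<phi> b) \<in> less_rel Q"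
      using less ab lessP by blast
  next
    assume "\<exists>c. (\<phi> a, c) \<in> less_rel Q \<and> (c, \<phi> b) \<in> less_rel Q"
    then obtain c where c: "(\<phi> a, c) \<in> less_rel Q" "(c, \<phi> b) \<in> less_rel Q" by blast
    then obtain c' where "c' \<in> elts P" "c = \<phi> c'"
      using lessQ bij by (metis bij_betw_imp_surj_on imageE)
    then show "\<exists>c. (a, c) \<in> less_rel P \<and> (c, b) \<in> less_rel P"
      using c less ab by blast
  qed
  then show ?thesis
    unfolding covers_def mem_Collect_eq case_prod_conv using less[OF ab] by blast
qed

text \<open>An order isomorphism preserves and reflects covers, and each cover is either strict or
  weak, as the labels of comparable elements differ. So preserving both kinds of edges amounts to
  preserving and reflecting the strict ones.\<close>

lemma labeled_poset_iso_iff: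
  assumes P: "labeled_poset P" and Q: "labeled_poset Q"
  shows "labeled_poset_iso P Q \<longleftrightarrow> epos_iso (edge_poset P) (edge_poset Q)"
proof -
  note okP = edge_poset_okD(2)[OF edge_poset_ok_edge_poset[OF P], simplified]
  note okQ = edge_poset_okD(2)[OF edge_poset_ok_edge_poset[OF Q], simplified]
  have edge: "(a, b) \<in> covers R \<longleftrightarrow> (a, b) \<in> strict_edges R \<or> (a, b) \<in> weak_edges R"
    if "labeled_poset R" for R :: "'c lpos" and a b
    using lab_neq[OF that, of a b] by (auto simp: strict_edges_def weak_edges_def covers_def)
  have disj: "\<not> ((a, b) \<in> strict_edges R \<and> (a, b) \<in> weak_edges R)" for R :: "'c lpos" and a b
    by (auto simp: strict_edges_def weak_edges_def)
  have mem: "a \<in> elts P \<and> b \<in> elts P" if "(a, b) \<in> covers P" for a b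
    using that okP by (auto simp: covers_def less_rel_def)
  show ?thesis
    unfolding labeled_poset_iso_def epos_iso_def edge_poset_simps
  proof (intro ex_cong1 conj_cong refl)
    fix \<phi> :: "'a \<Rightarrow> 'b"
    assume bij: "bij_betw \<phi> (elts P) (elts Q)"
    let ?leq = "\<forall>a\<in>elts P. \<forall>b\<in>elts P. (a, b) \<in> leq P \<longleftrightarrow> (\<phi> a, \<phi> b) \<in> leq Q"
    have cov: "(a, b) \<in> covers P \<longleftrightarrow> (\<phi> a, \<phi> b) \<in> covers Q"
      if ?leq "a \<in> elts P" "b \<in> elts P" for a b
      by (rule covers_iff_of_order_iso[OF bij _ okP okQ]) (use that in auto)
    show "?leq \<and> (\<forall>(a, b)\<in>strict_edges P. (\<phi> a, \<phi> b) \<in> strict_edges Q) \<and>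
        (\<forall>(a, b)\<in>weak_edges P. (\<phi> a, \<phi> b) \<in> weak_edges Q) \<longleftrightarrow>
      (\<forall>a\<in>elts P. \<forall>b\<in>elts P. ((a, b) \<in> leq P \<longleftrightarrow> (\<phi> a, \<phi> b) \<in> leq Q) \<and>
        ((a, b) \<in> strict_edges P \<longleftrightarrow> (\<phi> a, \<phi> b) \<in> strict_edges Q))" (is "?l \<longleftrightarrow> ?r")
    proof
      assume l: ?l
      have "(a, b) \<in> strict_edges P \<longleftrightarrow> (\<phi> a, \<phi> b) \<in> strict_edges Q"
        if ab: "a \<in> elts P" "b \<in> elts P" for a b
        using l cov[OF _ ab] edge[OF P, of a b] edge[OF Q, of "\<phi> a" "\<phi> b"] disj[of "\<phi> a" "\<phi> b" Q]
        by blast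
      then show ?r using l by blast
    next
      assume r: ?r
      then have leq: ?leq by blast
      have "(\<phi> a, \<phi> b) \<in> strict_edges Q" if "(a, b) \<in> strict_edges P" for a b
        using r that mem[of a b] edge[OF P, of a b] by blast
      moreover have "(\<phi> a, \<phi> b) \<in> weak_edges Q" if w: "(a, b) \<in> weak_edges P" for a b
      proof -
        have c: "(a, b) \<in> covers P" using w edge[OF P, of a b] by blast
        then have ab: "a \<in> elts P" "b \<in> elts P" using mem by auto
        then have "(\<phi> a, \<phi> b) \<notin> strict_edges Q"
          using r w disj[of a b P] by blast
        then show ?thesis
          using cov[OF leq ab] c edge[OF Q, of "\<phi> a" "\<phi> b"] by blast
      qed
      ultimately show ?l using leq by auto
    qed
  qed
qed

lemma card_edge_partitions_fibres_iso:
  assumes "edge_poset_ok S" "edge_poset_ok T" "epos_iso S T"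
  shows "card {f \<in> edge_partitions S J. \<forall>i. m i = card {a \<in> elts S. f a = i}} =
    card {f \<in> edge_partitions T J. \<forall>i. m i = card {a \<in> elts T. f a = i}}"
proof -
  from assms(3) obtain \<phi> where bij: "bij_betw \<phi> (elts S) (elts T)"
    and leq: "\<And>a b. a \<in> elts S \<Longrightarrow> b \<in> elts S \<Longrightarrow> (a, b) \<in> leq S \<longleftrightarrow> (\<phi> a, \<phi> b) \<in> leq T"
    and strict: "\<And>a b. a \<in> elts S \<Longrightarrow> b \<in> elts S \<Longrightarrow> (a, b) \<in> strict S \<longleftrightarrow> (\<phi> a, \<phi> b) \<in> strict T"
    unfolding epos_iso_def by blast
  define \<psi> where "\<psi> = inv_into (elts S) \<phi>"
  note okS = edge_poset_okD(2,7)[OF assms(1)] and okT = edge_poset_okD(2,7)[OF assms(2)]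
  have \<phi>: "\<phi> a \<in> elts T" "\<psi> (\<phi> a) = a" if "a \<in> elts S" for a
    using that bij by (auto simp: \<psi>_def bij_betw_def)
  have \<psi>: "\<psi> b \<in> elts S" "\<phi> (\<psi> b) = b" if "b \<in> elts T" for b
    using that bij by (auto simp: \<psi>_def bij_betw_def inv_into_into f_inv_into_f)
  have fibT: "card {a \<in> elts S. f (\<phi> a) = i} = card {b \<in> elts T. f b = i}" for f :: "'b \<Rightarrow> nat" and i
    by (rule bij_betw_same_card[of \<phi>], rule bij_betw_byWitness[of _ \<psi>]) (use \<phi> \<psi> in auto)
  have fibS: "card {b \<in> elts T. f (\<psi> b) = i} = card {a \<in> elts S. f a = i}" for f :: "'a \<Rightarrow> nat" and i
    by (rule bij_betw_same_card[of \<psi>], rule bij_betw_byWitness[of _ \<phi>]) (use \<phi> \<psi> in auto)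
  have toS: "(\<lambda>a\<in>elts S. f (\<phi> a)) \<in> edge_partitions S J" if f: "f \<in> edge_partitions T J" for f
  proof (rule edge_partitionsI)
    show "(\<lambda>a\<in>elts S. f (\<phi> a)) a \<le> (\<lambda>a\<in>elts S. f (\<phi> a)) b" if "(a, b) \<in> leq S" for a b
      using okS(1)[OF that] leq[of a b] that edge_partitionsD(3)[OF f] by simp
    show "(\<lambda>a\<in>elts S. f (\<phi> a)) a < (\<lambda>a\<in>elts S. f (\<phi> a)) b" if "(a, b) \<in> strict S" for a b
      using okS(2)[OF that] strict[of a b] that edge_partitionsD(4)[OF f] by simp
  qed (use edge_partitionsD(2)[OF f] \<phi> in auto)
  have toT: "(\<lambda>b\<in>elts T. f (\<psi> b)) \<in> edge_partitions T J" if f: "f \<in> edge_partitions S J" for f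
  proof (rule edge_partitionsI)
    show "(\<lambda>a\<in>elts T. f (\<psi> a)) a \<le> (\<lambda>a\<in>elts T. f (\<psi> a)) b" if "(a, b) \<in> leq T" for a b
      using okT(1)[OF that] leq[of "\<psi> a" "\<psi> b"] \<psi> that edge_partitionsD(3)[OF f] by simp
    show "(\<lambda>a\<in>elts T. f (\<psi> a)) a < (\<lambda>a\<in>elts T. f (\<psi> a)) b" if "(a, b) \<in> strict T" for a b
      using okT(2)[OF that] strict[of "\<psi> a" "\<psi> b"] \<psi> that edge_partitionsD(4)[OF f] by simp
  qed (use edge_partitionsD(2)[OF f] \<psi> in auto)
  have r: "{a \<in> A. restrict g A a = i} = {a \<in> A. g a = i}" for A :: "'c set" and g :: "'c \<Rightarrow> nat" and i
    by auto
  let ?S = "{f \<in> edge_partitions S J. \<forall>i. m i = card {a \<in> elts S. f a = i}}"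
  let ?T = "{f \<in> edge_partitions T J. \<forall>i. m i = card {a \<in> elts T. f a = i}}"
  have "bij_betw (\<lambda>f. \<lambda>b\<in>elts T. f (\<psi> b)) ?S ?T"
  proof (rule bij_betw_byWitness[of _ "\<lambda>f. \<lambda>a\<in>elts S. f (\<phi> a)"])
    show "\<forall>f\<in>?S. (\<lambda>a\<in>elts S. (\<lambda>b\<in>elts T. f (\<psi> b)) (\<phi> a)) = f"
      using \<phi> by (auto simp: fun_eq_iff edge_partitions_def PiE_def extensional_def)
    show "\<forall>f\<in>?T. (\<lambda>b\<in>elts T. (\<lambda>a\<in>elts S. f (\<phi> a)) (\<psi> b)) = f"
      using \<psi> by (auto simp: fun_eq_iff edge_partitions_def PiE_def extensional_def)
    show "(\<lambda>f. \<lambda>b\<in>elts T. f (\<psi> b)) ` ?S \<subseteq> ?T"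
      using toT by (intro image_subsetI) (simp add: r fibS del: restrict_apply)
    show "(\<lambda>f. \<lambda>a\<in>elts S. f (\<phi> a)) ` ?T \<subseteq> ?S"
      using toS by (intro image_subsetI) (simp add: r fibT del: restrict_apply)
  qed
  then show ?thesis by (rule bij_betw_same_card)
qed

theorem class_C_iso_iff:
  fixes P :: "'a lpos" and Q :: "'b lpos"
  assumes "P \<in> class_C" "Q \<in> class_C"
  shows "labeled_poset_iso P Q \<longleftrightarrow> K_enum P = K_enum Q"
proof
  have P: "labeled_poset P" "edge_poset P \<in> class_C0" and Q: "labeled_poset Q" "edge_poset Q \<in> class_C0"
    using assms class_C_edge_subset by (auto simp: class_C_def)
  show "K_enum P = K_enum Q" if "labeled_poset_iso P Q"
  proof
    fix m
    have "epos_iso (edge_poset P) (edge_poset Q)"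
      using that labeled_poset_iso_iff[OF P(1) Q(1)] by blast
    then show "K_enum P m = K_enum Q m"
      using card_edge_partitions_fibres_iso[OF edge_poset_ok_edge_poset[OF P(1)]
          edge_poset_ok_edge_poset[OF Q(1)], of "{1..}" "Poly_Mapping.lookup m"]
      by (simp add: K_enum_def P_partitions_eq P(1) Q(1))
  qed
  show "labeled_poset_iso P Q" if K: "K_enum P = K_enum Q"
  proof -
    have "enum (edge_poset P) = enum (edge_poset Q)"
      by (rule qsym_eqI) (simp add: Rep_enum P Q enum_list_eq_if_K_enum_eq[OF P(1) Q(1) K])
    then have "epos_iso (edge_poset P) (edge_poset Q)"
      using enum_proportional_imp_iso[OF P(2) Q(2), of 1 1] by simp
    then show ?thesis
      using labeled_poset_iso_iff[OF P(1) Q(1)] by blast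
  qed
qed

section \<open>Fair trees\<close>

definition restrict_epos :: "'a lpos \<Rightarrow> 'a set \<Rightarrow> 'a epos" where
  "restrict_epos P U = \<lparr>elts = U, leq = leq P \<inter> U \<times> U, strict = strict_edges P \<inter> U \<times> U\<rparr>"

text \<open>In a rooted tree, the vertex set of the subtree at \<open>v\<close>.\<close>

definition up_set :: "'a lpos \<Rightarrow> 'a \<Rightarrow> 'a set" where
  "up_set P v = {u. (v, u) \<in> leq P}"

context
  fixes P :: "'a lpos"
  assumes P: "labeled_poset P"
begin

lemmas order_okD = edge_poset_okD[OF edge_poset_ok_edge_poset[OF P], simplified edge_poset_simps]

lemma less_rel_iff: "(a, b) \<in> less_rel P \<longleftrightarrow> (a, b) \<in> leq P \<and> a \<noteq> b"
  by (simp add: less_rel_def)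

lemma less_rel_trans:
  "(a, b) \<in> less_rel P \<Longrightarrow> (b, c) \<in> leq P \<Longrightarrow> (a, c) \<in> less_rel P"
  "(a, b) \<in> leq P \<Longrightarrow> (b, c) \<in> less_rel P \<Longrightarrow> (a, c) \<in> less_rel P"
  unfolding less_rel_iff by (metis order_okD(4,5))+

lemma covers_imp_less: "(a, b) \<in> covers P \<Longrightarrow> (a, b) \<in> less_rel P"
  by (simp add: covers_def)

lemma finite_subset_elts: "S \<subseteq> elts P \<Longrightarrow> finite S"
  using order_okD(1) finite_subset by blast

lemma ex_cover_above_below:
  assumes "(a, b) \<in> less_rel P"
  shows "(\<exists>c. (a, c) \<in> covers P \<and> (c, b) \<in> leq P) \<and> (\<exists>c. (a, c) \<in> leq P \<and> (c, b) \<in> covers P)"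
  using assms
proof (induction "card {c. (a, c) \<in> less_rel P \<and> (c, b) \<in> less_rel P}" arbitrary: a b rule: less_induct)
  case less
  let ?I = "\<lambda>a b. {c. (a, c) \<in> less_rel P \<and> (c, b) \<in> less_rel P}"
  have ab: "a \<in> elts P" "b \<in> elts P"
    using less.prems order_okD(2) by (auto simp: less_rel_iff)
  show ?case
  proof (cases "(a, b) \<in> covers P")
    case True
    then show ?thesis
      using order_okD(3) ab by blast
  next
    case False
    then obtain c where c: "(a, c) \<in> less_rel P" "(c, b) \<in> less_rel P"
      using less.prems by (auto simp: covers_def)
    have fin: "finite (?I a b)"
      by (rule finite_subset_elts) (use order_okD(2) in \<open>auto simp: less_rel_iff\<close>)
    have "c \<in> ?I a b" "c \<notin> ?I a c" "c \<notin> ?I c b"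
      using c by (auto simp: less_rel_iff)
    moreover have cl: "(c, b) \<in> leq P" "(a, c) \<in> leq P"
      using c by (simp_all add: less_rel_iff)
    then have "?I a c \<subseteq> ?I a b" "?I c b \<subseteq> ?I a b"
      using less_rel_trans(1)[OF _ cl(1)] less_rel_trans(2)[OF cl(2)] by blast+
    ultimately have "?I a c \<subset> ?I a b" "?I c b \<subset> ?I a b"
      by blast+
    then have "card (?I a c) < card (?I a b)" "card (?I c b) < card (?I a b)"
      using fin by (auto intro: psubset_card_mono)
    then have "\<exists>d. (a, d) \<in> covers P \<and> (d, c) \<in> leq P" "\<exists>d. (c, d) \<in> leq P \<and> (d, b) \<in> covers P"
      using less.hyps c by blast+
    then show ?thesis
      using order_okD(4)[OF _ cl(1)] order_okD(4)[OF cl(2)] by blast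
  qed
qed

text \<open>Distinctness and the bounds on the members serve to join two such chains to a cycle
  without repetitions.\<close>

lemma ex_saturated_chain:
  assumes "(a, b) \<in> leq P"
  shows "\<exists>vs. vs \<noteq> [] \<and> hd vs = a \<and> last vs = b \<and> distinct vs \<and>
    successively (\<lambda>x y. (x, y) \<in> covers P) vs \<and> (\<forall>x\<in>set vs. (a, x) \<in> leq P \<and> (x, b) \<in> leq P)"
  using assms
proof (induction "card {x. (a, x) \<in> leq P}" arbitrary: a rule: less_induct)
  case less
  have a: "a \<in> elts P" "b \<in> elts P" using order_okD(2) less.prems by auto
  show ?case
  proof (cases "a = b")
    case True
    then show ?thesis
      using order_okD(3) a by (intro exI[of _ "[a]"]) auto
  next
    case False
    then obtain c where c: "(a, c) \<in> covers P" "(c, b) \<in> leq P"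
      using ex_cover_above_below less.prems less_rel_iff by blast
    have ac: "(a, c) \<in> less_rel P" "(a, c) \<in> leq P"
      using covers_imp_less[OF c(1)] by (auto simp: less_rel_iff)
    have "{x. (c, x) \<in> leq P} \<subset> {x. (a, x) \<in> leq P}"
    proof
      show "{x. (c, x) \<in> leq P} \<subseteq> {x. (a, x) \<in> leq P}"
        using order_okD(4)[OF ac(2)] by blast
      show "{x. (c, x) \<in> leq P} \<noteq> {x. (a, x) \<in> leq P}"
        using order_okD(3)[OF a(1)] order_okD(5)[OF ac(2)] ac(1) by (auto simp: less_rel_iff)
    qed
    moreover have "finite {x. (a, x) \<in> leq P}"
      by (rule finite_subset_elts) (use order_okD(2) in auto)
    ultimately have "card {x. (c, x) \<in> leq P} < card {x. (a, x) \<in> leq P}"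
      by (intro psubset_card_mono)
    from less.hyps[OF this c(2)] obtain vs where vs: "vs \<noteq> []" "hd vs = c" "last vs = b" "distinct vs"
      "successively (\<lambda>x y. (x, y) \<in> covers P) vs" "\<And>x. x \<in> set vs \<Longrightarrow> (c, x) \<in> leq P \<and> (x, b) \<in> leq P"
      by blast
    have "a \<notin> set vs"
      using vs(6)[of a] order_okD(5)[OF ac(2)] ac(1) by (auto simp: less_rel_iff)
    moreover have "(a, x) \<in> leq P" if "x \<in> set vs" for x
      using vs(6)[OF that] order_okD(4)[OF ac(2)] by blast
    ultimately show ?thesis
      using vs c(1) less.prems order_okD(3)[OF a(1)]
      by (intro exI[of _ "a # vs"]) (auto simp: successively_Cons)
  qed
qed

text \<open>
  Two saturated chains from a maximal common lower bound of \<open>w\<close> and \<open>w'\<close> to \<open>u\<close>, one through \<open>w\<close> and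
  the other one through \<open>w'\<close>, form a cycle in the Hasse diagram.
\<close>

lemma rooted_tree_unique_lower_cover:
  assumes tree: "rooted_tree P" and w: "(w, u) \<in> covers P" "(w', u) \<in> covers P"
  shows "w = w'"
proof (rule ccontr)
  assume neq: "w \<noteq> w'"
  have wu: "(w, u) \<in> less_rel P" "(w', u) \<in> less_rel P"
    using w covers_imp_less by auto
  then have elts: "w \<in> elts P" "w' \<in> elts P"
    using order_okD(2) by (auto simp: less_rel_iff)
  have incomparable: "(w, w') \<notin> leq P" "(w', w) \<notin> leq P"
    using w wu neq by (auto simp: covers_def less_rel_iff)
  obtain r where r: "\<And>m. m \<in> min_elts P \<Longrightarrow> m = r"
    using tree by (auto simp: rooted_tree_def)
  have below: "(r, x) \<in> leq P" if "x \<in> elts P" for x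
  proof -
    have "min_elts (edge_poset P) = min_elts P"
      by (simp add: min_elts_def less_rel_def)
    then show ?thesis
      using min_elts_below[OF edge_poset_ok_edge_poset[OF P], of x] that r by auto
  qed
  let ?c = "\<lambda>z. (z, w) \<in> leq P \<and> (z, w') \<in> leq P"
  let ?d = "\<lambda>z. card {x. (x, z) \<in> leq P}"
  have fin: "finite {x. (x, z) \<in> leq P}" for z
    by (rule finite_subset_elts) (use order_okD(2) in auto)
  have "?d z \<le> card (elts P)" for z
    by (rule card_mono) (use order_okD(1,2) in auto)
  \<comment> \<open>The root is a common lower bound, and a common lower bound with the largest
    down-set is maximal.\<close>
  then have "\<exists>z. ?c z \<and> (\<forall>y. ?c y \<longrightarrow> ?d y \<le> ?d z)"
    using below elts
    by (intro ex_has_greatest_nat[of ?c r ?d "Suc (card (elts P))"]) (auto simp: le_imp_less_Suc)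
  then obtain z where z: "(z, w) \<in> leq P" "(z, w') \<in> leq P" and max: "\<And>y. ?c y \<Longrightarrow> ?d y \<le> ?d z"
    by blast
  have no_above: "(z, y) \<notin> less_rel P" if y: "?c y" for y
  proof
    assume zy: "(z, y) \<in> less_rel P"
    then have zy': "(z, y) \<in> leq P" "z \<noteq> y"
      by (simp_all add: less_rel_iff)
    then have "{x. (x, z) \<in> leq P} \<subseteq> {x. (x, y) \<in> leq P}" "y \<in> {x. (x, y) \<in> leq P}"
      "y \<notin> {x. (x, z) \<in> leq P}"
      using order_okD(2)[OF zy'(1)] order_okD(3)[of y] order_okD(4)[OF _ zy'(1)] order_okD(5)[OF zy'(1)] by blast+
    then have "?d z < ?d y"
      using fin by (intro psubset_card_mono) auto
    then show False using max[OF y] by simp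
  qed
  obtain vs where vs: "vs \<noteq> []" "hd vs = z" "last vs = w" "distinct vs"
    "successively (\<lambda>x y. (x, y) \<in> covers P) vs" "\<And>x. x \<in> set vs \<Longrightarrow> (z, x) \<in> leq P \<and> (x, w) \<in> leq P"
    using ex_saturated_chain[OF z(1)] by blast
  obtain us where us: "us \<noteq> []" "hd us = z" "last us = w'" "distinct us"
    "successively (\<lambda>x y. (x, y) \<in> covers P) us" "\<And>x. x \<in> set us \<Longrightarrow> (z, x) \<in> leq P \<and> (x, w') \<in> leq P"
    using ex_saturated_chain[OF z(2)] by blast
  \<comment> \<open>Both chains start at \<open>z\<close>, which may occur only once in the
    cycle.\<close>
  define ts where "ts = tl us"
  have us_eq: "us = z # ts" using us(1,2) by (cases us) (auto simp: ts_def)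
  have "ts \<noteq> []"
    using us(3) us_eq z(1) incomparable by auto
  have "length vs \<ge> 2"
  proof (rule ccontr)
    assume "\<not> length vs \<ge> 2"
    then have "vs = [z]" using vs(1,2) by (cases vs) (auto simp: not_less_eq_eq)
    then show False using vs(3) z(2) incomparable by auto
  qed
  let ?C = "vs @ u # rev ts"
  let ?adj = "\<lambda>x y. (x, y) \<in> hasse_adj P"
  have adj: "?adj x y" "?adj y x" if "(x, y) \<in> covers P" for x y
    using that by (auto simp: hasse_adj_def)
  have u_notin: "u \<notin> set vs" "u \<notin> set us"
    using vs(6)[of u] us(6)[of u] wu order_okD(5) by (auto simp: less_rel_iff)
  \<comment> \<open>A common member would be a common lower bound strictly above
    \<open>z\<close>.\<close>
  have "set vs \<inter> set ts = {}"
  proof -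
    have False if "x \<in> set vs" "x \<in> set ts" for x
    proof -
      have "x \<noteq> z" using that(2) us(4) us_eq by auto
      then have "(z, x) \<in> less_rel P" using vs(6)[OF that(1)] by (auto simp: less_rel_iff)
      then show False
        using no_above[of x] vs(6)[OF that(1)] us(6)[of x] that(2) us_eq by auto
    qed
    then show ?thesis by auto
  qed
  then have "distinct ?C"
    using vs(4) us(4) u_notin us_eq by auto
  moreover have "length ?C \<ge> 3"
    using \<open>length vs \<ge> 2\<close> by simp
  moreover have "successively ?adj ?C"
  proof -
    have "successively ?adj vs"
      by (rule successively_mono[OF vs(5)]) (use adj in auto)
    moreover have "?adj (last vs) u"
      using vs(3) w(1) adj by auto
    moreover have "successively (\<lambda>x y. (x, y) \<in> covers P) ts"
      using us(5) us_eq \<open>ts \<noteq> []\<close> by (auto simp: successively_Cons)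
    then have "successively ?adj (rev ts)"
      unfolding successively_rev by (rule successively_mono) (use adj in auto)
    moreover have "last ts = w'"
      using us(3) us_eq \<open>ts \<noteq> []\<close> by simp
    then have "?adj u (hd (rev ts))"
      using w(2) adj \<open>ts \<noteq> []\<close> by (simp add: hd_rev)
    ultimately show ?thesis
      using \<open>vs \<noteq> []\<close> \<open>ts \<noteq> []\<close> by (simp add: successively_append_iff successively_Cons)
  qed
  moreover have "?adj (last ?C) (hd ?C)"
  proof -
    have "(z, hd ts) \<in> covers P"
      using us(5) us_eq \<open>ts \<noteq> []\<close> by (auto simp: successively_Cons)
    then show ?thesis
      using adj vs(1,2) \<open>ts \<noteq> []\<close> by (simp add: last_rev)
  qed
  ultimately show False
    using tree unfolding rooted_tree_def is_tree_def by blast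
qed

text \<open>Descent: a common upper bound \<open>u\<close> of \<open>w\<close> and \<open>w'\<close>
  differs from both, and its only lower cover is again a common upper bound.\<close>

lemma rooted_tree_up_sets_disjoint:
  assumes tree: "rooted_tree P" and w: "(v, w) \<in> covers P" "(v, w') \<in> covers P" "w \<noteq> w'"
  shows "up_set P w \<inter> up_set P w' = {}"
proof -
  have vw: "(v, w) \<in> less_rel P" "(v, w') \<in> less_rel P"
    using w covers_imp_less by auto
  have incomparable: "(w, w') \<notin> leq P" "(w', w) \<notin> leq P"
    using w vw by (auto simp: covers_def less_rel_iff)
  have "False" if "(w, u) \<in> leq P" "(w', u) \<in> leq P" for u
    using that
  proof (induction "card {x. (x, u) \<in> leq P}" arbitrary: u rule: less_induct)
    case less
    have "(w, u) \<in> less_rel P" "(w', u) \<in> less_rel P"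
      using less.prems incomparable by (auto simp: less_rel_iff)
    then obtain p p' where p: "(w, p) \<in> leq P" "(p, u) \<in> covers P" "(w', p') \<in> leq P" "(p', u) \<in> covers P"
      using ex_cover_above_below by meson
    then have "(w', p) \<in> leq P"
      using rooted_tree_unique_lower_cover[OF tree p(2,4)] by simp
    have pu: "(p, u) \<in> leq P" "p \<noteq> u"
      using covers_imp_less[OF p(2)] by (auto simp: less_rel_iff)
    then have "{x. (x, p) \<in> leq P} \<subseteq> {x. (x, u) \<in> leq P}" "u \<in> {x. (x, u) \<in> leq P}"
      "u \<notin> {x. (x, p) \<in> leq P}"
      using order_okD(2)[OF pu(1)] order_okD(3)[of u] order_okD(4)[OF _ pu(1)] order_okD(5)[OF pu(1)] by blast+
    moreover have "finite {x. (x, u) \<in> leq P}"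
      by (rule finite_subset_elts) (use order_okD(2) in auto)
    ultimately have "card {x. (x, p) \<in> leq P} < card {x. (x, u) \<in> leq P}"
      by (intro psubset_card_mono) auto
    then show False
      using less.hyps p(1) \<open>(w', p) \<in> leq P\<close> by blast
  qed
  then show ?thesis
    by (auto simp: up_set_def)
qed

lemma up_set_eq:
  assumes "v \<in> elts P"
  shows "up_set P v = insert v (\<Union>w\<in>{w. (v, w) \<in> covers P}. up_set P w)"
proof (intro equalityI subsetI)
  fix u assume u: "u \<in> up_set P v"
  show "u \<in> insert v (\<Union>w\<in>{w. (v, w) \<in> covers P}. up_set P w)"
  proof (cases "u = v")
    case False
    then have "(v, u) \<in> less_rel P" using u by (auto simp: up_set_def less_rel_iff)
    then show ?thesis using ex_cover_above_below by (auto simp: up_set_def)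
  qed simp
next
  fix u assume "u \<in> insert v (\<Union>w\<in>{w. (v, w) \<in> covers P}. up_set P w)"
  then show "u \<in> up_set P v"
  proof (cases "u = v")
    case True
    then show ?thesis using order_okD(3)[OF assms] by (simp add: up_set_def)
  next
    case False
    then obtain w where "(v, w) \<in> covers P" "(w, u) \<in> leq P"
      using \<open>u \<in> insert v _\<close> by (auto simp: up_set_def)
    then show ?thesis
      using covers_imp_less[of v w] order_okD(4)[of v w u] by (simp add: up_set_def less_rel_iff)
  qed
qed

lemma restrict_epos_Un:
  assumes "\<And>a b. a \<in> U \<Longrightarrow> (a, b) \<in> leq P \<Longrightarrow> b \<in> U" "\<And>a b. a \<in> V \<Longrightarrow> (a, b) \<in> leq P \<Longrightarrow> b \<in> V"
    and "U \<inter> V = {}"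
  shows "restrict_epos P (U \<union> V) = disj_union (restrict_epos P U) (restrict_epos P V)"
proof -
  have "leq P \<inter> (U \<union> V) \<times> (U \<union> V) = leq P \<inter> U \<times> U \<union> leq P \<inter> V \<times> V"
    using assms by blast
  moreover have "strict_edges P \<subseteq> leq P"
    using order_okD(6) by auto
  then have "strict_edges P \<inter> (U \<union> V) \<times> (U \<union> V) = strict_edges P \<inter> U \<times> U \<union> strict_edges P \<inter> V \<times> V"
    using assms by blast
  ultimately show ?thesis
    by (simp add: restrict_epos_def disj_union_def)
qed

text \<open>The subtree at \<open>v\<close> is \<open>v\<close> placed below the disjoint union of
  the subtrees at its children. One ordinal sum gives all edges at \<open>v\<close> the same kind,
  which is what fairness asks for.\<close>

lemma restrict_epos_up_set_class_C:
  assumes tree: "rooted_tree P" and "v \<in> elts P"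
    and fair: "\<And>v. v \<in> elts P \<Longrightarrow> (\<forall>w. (v, w) \<in> covers P \<longrightarrow> (v, w) \<in> strict_edges P) \<or>
      (\<forall>w. (v, w) \<in> covers P \<longrightarrow> (v, w) \<in> weak_edges P)"
  shows "restrict_epos P (up_set P v) \<in> class_C_edge"
  using assms(2)
proof (induction "card (up_set P v)" arbitrary: v rule: less_induct)
  case less
  let ?W = "{w. (v, w) \<in> covers P}"
  let ?B = "\<Union>w\<in>?W. up_set P w"
  have vw: "(v, w) \<in> leq P" "v \<noteq> w" "w \<in> elts P" if "w \<in> ?W" for w
    using that covers_imp_less[of v w] order_okD(2)[of v w] by (simp_all add: less_rel_iff)
  have up: "b \<in> up_set P w" if "a \<in> up_set P w" "(a, b) \<in> leq P" for a b w
    using that order_okD(4)[of w a b] by (simp add: up_set_def)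
  have v_notin: "v \<notin> ?B"
    using vw(1,2) order_okD(5)[of v] unfolding up_set_def by blast
  have refl: "(v, v) \<in> leq P"
    using order_okD(3) less.prems .
  have strict_less: "(a, b) \<in> leq P" "a \<noteq> b" "(a, b) \<in> covers P" if "(a, b) \<in> strict_edges P" for a b
    using that by (auto simp: strict_edges_def covers_def less_rel_def)
  have to_v: "a = v" if "(a, v) \<in> leq P" "a \<in> insert v ?B" for a
    using that up v_notin by blast
  have from_v: "(v, b) \<in> leq P" if "b \<in> ?B" for b
    using that vw(1) order_okD(4)[of v _ b] unfolding up_set_def by blast
  have finite: "finite (up_set P w)" for w
    by (rule finite_subset_elts) (use order_okD(2) in \<open>auto simp: up_set_def\<close>)
  have IH: "restrict_epos P (up_set P w) \<in> class_C_edge" if w: "w \<in> ?W" for w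
  proof (rule less.hyps)
    have "up_set P w \<subseteq> up_set P v" "v \<in> up_set P v" "v \<notin> up_set P w"
      using w v_notin up_set_eq[OF less.prems] by auto
    then show "card (up_set P w) < card (up_set P v)"
      using finite by (intro psubset_card_mono) auto
  qed (rule vw(3)[OF w])
  show ?case
  proof (cases "?W = {}")
    case True
    then have "up_set P v = {v}"
      using up_set_eq[OF less.prems] by auto
    then have "restrict_epos P (up_set P v) = one_epos v"
      using refl strict_less(2)[of v v] by (auto simp: restrict_epos_def one_epos_def)
    then show ?thesis
      by (simp add: class_C_edge.one)
  next
    case False
    have "finite ?W"
      by (rule finite_subset_elts) (use vw(3) in auto)
    \<comment> \<open>The children are joined one at a time, starting with a single one, as the
      class has no empty member.\<close>
    have "restrict_epos P (\<Union>w\<in>F. up_set P w) \<in> class_C_edge"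
      if "finite F" "F \<noteq> {}" "F \<subseteq> ?W" for F
      using that
    proof (induction F rule: finite_ne_induct)
      case (singleton w)
      then show ?case using IH by simp
    next
      case (insert w F)
      have disj: "up_set P w \<inter> (\<Union>w\<in>F. up_set P w) = {}"
        using rooted_tree_up_sets_disjoint[OF tree, of v w] insert by blast
      have "restrict_epos P (\<Union>w\<in>insert w F. up_set P w) =
          disj_union (restrict_epos P (up_set P w)) (restrict_epos P (\<Union>w\<in>F. up_set P w))"
        unfolding UN_insert by (rule restrict_epos_Un) (use up disj in blast)+
      also have "\<dots> \<in> class_C_edge"
        using IH insert disj by (intro class_C_edge.union) (auto simp: restrict_epos_def)
      finally show ?case .
    qed
    then have B: "restrict_epos P ?B \<in> class_C_edge"
      using \<open>finite ?W\<close> False by blast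
    have vB: "v \<notin> elts (restrict_epos P ?B)"
      using v_notin by (simp add: restrict_epos_def)
    have leq: "leq P \<inter> up_set P v \<times> up_set P v = {(v, v)} \<union> leq P \<inter> ?B \<times> ?B \<union> {v} \<times> ?B"
      unfolding up_set_eq[OF less.prems] using refl to_v from_v by blast
    have WB: "?W \<subseteq> ?B"
      using vw(3) order_okD(3) by (auto simp: up_set_def)
    have strict_eq: "strict_edges P \<inter> up_set P v \<times> up_set P v =
        strict_edges P \<inter> ?B \<times> ?B \<union> {v} \<times> {b. (v, b) \<in> strict_edges P}"
      unfolding up_set_eq[OF less.prems]
    proof (intro equalityI subrelI)
      fix a b
      assume "(a, b) \<in> strict_edges P \<inter> insert v ?B \<times> insert v ?B"
      then have ab: "(a, b) \<in> strict_edges P" "a \<in> insert v ?B" "b \<in> insert v ?B"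
        by blast+
      have "b \<noteq> v"
        using to_v[of a] ab(2) strict_less(1,2)[OF ab(1)] by blast
      then show "(a, b) \<in> strict_edges P \<inter> ?B \<times> ?B \<union> {v} \<times> {b. (v, b) \<in> strict_edges P}"
        using ab by blast
    next
      fix a b
      assume "(a, b) \<in> strict_edges P \<inter> ?B \<times> ?B \<union> {v} \<times> {b. (v, b) \<in> strict_edges P}"
      then show "(a, b) \<in> strict_edges P \<inter> insert v ?B \<times> insert v ?B"
        using WB strict_less(3)[of v b] by blast
    qed
    show ?thesis
      using fair[OF less.prems]
    proof
      assume weak: "\<forall>w. (v, w) \<in> covers P \<longrightarrow> (v, w) \<in> weak_edges P"
      then have "(v, b) \<notin> strict_edges P" for b
        by (auto simp: weak_edges_def strict_edges_def)
      then have "strict_edges P \<inter> up_set P v \<times> up_set P v = strict_edges P \<inter> ?B \<times> ?B"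
        unfolding strict_eq by simp
      then have "restrict_epos P (up_set P v) = weak_sum (one_epos v) (restrict_epos P ?B)"
        using leq up_set_eq[OF less.prems] by (simp add: restrict_epos_def weak_sum_def one_epos_def)
      then show ?thesis
        using class_C_edge.weak_below[OF B vB] by simp
    next
      assume strict: "\<forall>w. (v, w) \<in> covers P \<longrightarrow> (v, w) \<in> strict_edges P"
      \<comment> \<open>So the strict sum adds precisely the edges from \<open>v\<close> to its
        children.\<close>
      have "min_elts (restrict_epos P ?B) = ?W"
      proof (intro equalityI subsetI)
        fix b assume b: "b \<in> min_elts (restrict_epos P ?B)"
        then obtain w where w: "w \<in> ?W" "b \<in> up_set P w"
          by (auto simp: min_elts_def restrict_epos_def)
        moreover have "w \<in> ?B"
          using w WB by blast
        ultimately have "w = b"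
          using b by (auto simp: min_elts_def restrict_epos_def less_rel_def up_set_def)
        then show "b \<in> ?W" using w by simp
      next
        fix w assume w: "w \<in> ?W"
        have "(c, w) \<notin> less_rel P" if "c \<in> ?B" for c
          using w from_v[OF that] that v_notin by (auto simp: covers_def less_rel_def)
        moreover have "w \<in> ?B"
          using w WB by blast
        ultimately show "w \<in> min_elts (restrict_epos P ?B)"
          by (auto simp: min_elts_def restrict_epos_def less_rel_def)
      qed
      moreover have "max_elts (one_epos v) = {v}"
        by (auto simp: max_elts_def one_epos_def less_rel_def)
      moreover have "{b. (v, b) \<in> strict_edges P} = ?W"
        using strict strict_less(3) by blast
      then have "strict_edges P \<inter> up_set P v \<times> up_set P v = strict_edges P \<inter> ?B \<times> ?B \<union> {v} \<times> ?W"
        unfolding strict_eq by simp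
      ultimately have "restrict_epos P (up_set P v) = strict_sum (one_epos v) (restrict_epos P ?B)"
        using leq up_set_eq[OF less.prems] by (simp add: restrict_epos_def strict_sum_def one_epos_def)
      then show ?thesis
        using class_C_edge.strict_below[OF B vB] by simp
    qed
  qed
qed

end

lemma fair_tree_class_C:
  assumes "fair_tree P"
  shows "P \<in> class_C"
proof -
  have P: "labeled_poset P" and tree: "rooted_tree P"
    and fair: "\<And>v. v \<in> elts P \<Longrightarrow> (\<forall>w. (v, w) \<in> covers P \<longrightarrow> (v, w) \<in> strict_edges P) \<or>
      (\<forall>w. (v, w) \<in> covers P \<longrightarrow> (v, w) \<in> weak_edges P)"
    using assms unfolding fair_tree_def by blast+
  obtain r where r: "r \<in> min_elts P" "\<And>m. m \<in> min_elts P \<Longrightarrow> m = r"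
    using tree by (auto simp: rooted_tree_def)
  have rP: "r \<in> elts P" using r(1) by (simp add: min_elts_def)
  note ok = edge_poset_okD[OF edge_poset_ok_edge_poset[OF P], simplified edge_poset_simps]
  have "min_elts (edge_poset P) = min_elts P"
    by (simp add: min_elts_def less_rel_def)
  then have "(r, x) \<in> leq P" if "x \<in> elts P" for x
    using min_elts_below[OF edge_poset_ok_edge_poset[OF P], of x] that r(2) by auto
  then have "up_set P r = elts P"
    using ok(2) by (auto simp: up_set_def)
  moreover have "restrict_epos P (elts P) = edge_poset P"
    using ok(2,7) by (auto simp: restrict_epos_def edge_poset_def)
  moreover have "restrict_epos P (up_set P r) \<in> class_C_edge"
    by (rule restrict_epos_up_set_class_C[OF P tree rP fair])
  ultimately have "edge_poset P \<in> class_C_edge" by simp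
  then show ?thesis
    using P by (simp add: class_C_def)
qed

theorem theorem4p4:
  fixes P :: "'a lpos" and Q :: "'b lpos"
  shows "(P \<in> class_C \<and> Q \<in> class_C \<longrightarrow> (labeled_poset_iso P Q \<longleftrightarrow> K_enum P = K_enum Q)) \<and>
         (fair_tree P \<and> fair_tree Q \<longrightarrow> (K_enum P = K_enum Q \<longleftrightarrow> labeled_poset_iso P Q))"
  using class_C_iso_iff[of P Q] fair_tree_class_C[of P] fair_tree_class_C[of Q] by blast

end
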